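(* Let $d=2$ and assume the setting (process, sampling scheme, taper) described in the context. Let $a=a(n)\in\mathbb{N}$ with $a\to\infty$, $a/\lambda\to\infty$ and $a^2/n=O(1)$ as $n\to\infty$. Then $$\hat F_{\lambda,a}:=\frac1{24}\Big(\frac{2\pi}{\lambda}\Big)^2\sum_{k=-a}^{a-1}I_{n,\lambda,2,h}(\tilde\omega_{k,\lambda})^4\ \xrightarrow{\ \mathbb P\ }\ \int_{\mathbb{R}^2}f^4(\omega)\,d\omega\qquad\text{as }a,\lambda,n\to\infty .$$ In particular, under the null hypothesis of isotropy (i.e. $f(\omega)=f_0(\|\omega\|)$ for all $\omega\in\mathbb{R}^2$ for some function $f_0:[0,\infty)\to\mathbb{R}$), the statistic $$\hat\tau_{H_0,\lambda,a}^2=2(2\pi)^2\hat F_{\lambda,a}\sum_{m=-a}^{a-1}\frac{H_{2,h}(m)^4}{H_{2,h}(0)^4}$$ is a consistent estimator (i.e. converges in probability) of $$\tau_{H_0}^2=2(2\pi)^2\sum_{m\in\mathbb{Z}^2}\frac{H_{2,h}(m)^4}{H_{2,h}(0)^4}\int_{\mathbb{R}^2}f^4(\omega)\,d\omega .$$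
   Context: Process. $Z=\{Z(s):s\in\mathbb{R}^2\}$ is a real-valued, second-order stationary, mean-square continuous, centered Gaussian random field with covariance function $c(h)=\mathrm{Cov}[Z(s),Z(s+h)]$, which is uniformly bounded and satisfies $c(h)=O(\|h\|^{-(2+\varepsilon)})$ as $\|h\|\to\infty$ for some $\varepsilon>0$. Its spectral density $f(\omega)=\int_{\mathbb{R}^2}\exp(-\mathrm{i}\omega^\top h)c(h)\,dh$ (Fourier pair: $c(h)=(2\pi)^{-2}\int_{\mathbb{R}^2}\exp(\mathrm{i}\omega^\top h)f(\omega)\,d\omega$) exists, is twice differentiable, and for some $\delta>2$ satisfies $f\le\beta_{1+\delta}$, $|\partial f/\partial\omega_i|\le\beta_{1+\delta}$, $|\partial^2 f/\partial\omega_i\partial\omega_j|\le\beta_{1+\delta}$ for all $i,j$. Here $\beta_\eta(\omega)=\beta_\eta(\omega_1)\beta_\eta(\omega_2)$ with, for a constant $C>0$, $\beta_\eta(x)=C$ for $|x|\le1$ and $\beta_\eta(x)=C|x|^{-\eta}$ for $|x|>1$. Sampling. $\lambda=\lambda(n)>0$ with $\lambda\to\infty$ and $\lambda^2/n\to0$ as $n\to\infty$; for each $n$ the locations $s_1,\dots,s_n$ are independent, uniformly distributed on $[-\lambda/2,\lambda/2]^2$, and independent of $Z$. Taper. $h:\mathbb{R}^2\to[0,\infty)$, $h(s)=h_1(s_1)h_2(s_2)$, not identically zero, where each $h_i:\mathbb{R}\to[0,\infty)$ is symmetric, supported in $[-1/2,1/2]$ and twice differentiable on $\mathbb{R}$.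 For $m\in\mathbb{Z}^2$, $H_{2,h}(m):=\int_{[-1/2,1/2]^2}h^2(s)\exp(-2\pi\mathrm{i}\,s^\top m)\,ds$. Tapered spatial periodogram. $$I_{n,\lambda,2,h}(\omega)=\frac{\lambda^2}{n^2H_{2,h}(0)}\Big|\sum_{j=1}^nh\big(\tfrac{s_j}{\lambda}\big)Z(s_j)\exp(\mathrm{i}\,s_j^\top\omega)\Big|^2,\qquad\omega\in\mathbb{R}^2 .$$ For $k\in\mathbb{Z}^2$, $\tilde\omega_{k,\lambda}:=(\frac{2\pi k_1}{\lambda}+\frac{\pi}{\lambda},\frac{2\pi k_2}{\lambda}+\frac{\pi}{\lambda})$. Sums over vector indices from $-a$ to $a-1$ are over both components from $-a$ to $a-1$. *)

theory Defs
  imports "HOL-Probability.Probability"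
begin

section \<open>Convergence in probability\<close>

text \<open>Measurability of the \<open>X n\<close> is part of the notion: \<^const>\<open>measure\<close> is \<open>0\<close> on
  non-measurable sets, so the limit alone would be meaningless for non-measurable \<open>X n\<close>.\<close>

definition converges_in_probability ::
    "'w measure \<Rightarrow> (nat \<Rightarrow> 'w \<Rightarrow> real) \<Rightarrow> real \<Rightarrow> bool" where
  "converges_in_probability M X L \<longleftrightarrow>
     (\<forall>n. X n \<in> borel_measurable M) \<and>
     (\<forall>e>0. (\<lambda>n. measure M {w \<in> space M. \<bar>X n w - L\<bar> > e}) \<longlonglongrightarrow> 0)"


section \<open>The random field\<close>

definition covariance :: "'w measure \<Rightarrow> ('w \<Rightarrow> real) \<Rightarrow> ('w \<Rightarrow> real) \<Rightarrow> real" where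
  "covariance M X Y =
     (LINT w|M. (X w - (LINT v|M. X v)) * (Y w - (LINT v|M. Y v)))"

text \<open>Degenerate normal laws (\<open>\<sigma> = 0\<close>) have to be admitted, since linear combinations of
  jointly Gaussian variables may be almost surely constant.\<close>

definition gaussian_rv :: "'w measure \<Rightarrow> ('w \<Rightarrow> real) \<Rightarrow> bool" where
  "gaussian_rv M X \<longleftrightarrow> X \<in> borel_measurable M \<and>
     (\<exists>\<mu> \<sigma>. \<sigma> \<ge> 0 \<and> distr M borel X =
        (if \<sigma> = 0 then return borel \<mu> else density lborel (\<lambda>x. ennreal (normal_density \<mu> \<sigma> x))))"

definition gaussian_field :: "'w measure \<Rightarrow> (real^2 \<Rightarrow> 'w \<Rightarrow> real) \<Rightarrow> bool" where
  "gaussian_field M Z \<longleftrightarrow>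
     (\<forall>T \<alpha>. finite T \<longrightarrow> gaussian_rv M (\<lambda>w. \<Sum>t\<in>T. \<alpha> t * Z t w))"

definition centered_field :: "'w measure \<Rightarrow> (real^2 \<Rightarrow> 'w \<Rightarrow> real) \<Rightarrow> bool" where
  "centered_field M Z \<longleftrightarrow> (\<forall>s. integrable M (Z s) \<and> (LINT w|M. Z s w) = 0)"

definition second_order_stationary ::
    "'w measure \<Rightarrow> (real^2 \<Rightarrow> 'w \<Rightarrow> real) \<Rightarrow> (real^2 \<Rightarrow> real) \<Rightarrow> bool" where
  "second_order_stationary M Z c \<longleftrightarrow>
     (\<forall>s. Z s \<in> borel_measurable M \<and> integrable M (\<lambda>w. (Z s w)\<^sup>2)) \<and>
     (\<exists>\<mu>. \<forall>s. (LINT w|M. Z s w) = \<mu>) \<and>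
     (\<forall>s u. covariance M (Z s) (Z (s + u)) = c u)"

definition mean_square_continuous :: "'w measure \<Rightarrow> (real^2 \<Rightarrow> 'w \<Rightarrow> real) \<Rightarrow> bool" where
  "mean_square_continuous M Z \<longleftrightarrow>
     (\<forall>s. ((\<lambda>t. LINT w|M. (Z t w - Z s w)\<^sup>2) \<longlongrightarrow> 0) (at s))"


section \<open>Spectral density\<close>

definition spectral_density :: "(real^2 \<Rightarrow> real) \<Rightarrow> (real^2 \<Rightarrow> real) \<Rightarrow> bool" where
  "spectral_density c f \<longleftrightarrow>
     integrable lborel c \<and> integrable lborel f \<and>
     (\<forall>\<omega>. complex_of_real (f \<omega>) =
        (LINT u|lborel. exp (- (\<i> * complex_of_real (\<omega> \<bullet> u))) * complex_of_real (c u))) \<and>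
     (\<forall>u. complex_of_real (c u) =
        (LINT \<omega>|lborel. exp (\<i> * complex_of_real (\<omega> \<bullet> u)) * complex_of_real (f \<omega>)) / (2 * pi)\<^sup>2)"

definition partial_deriv :: "2 \<Rightarrow> (real^2 \<Rightarrow> real) \<Rightarrow> real^2 \<Rightarrow> real" where
  "partial_deriv i f x = deriv (\<lambda>t. f (x + t *\<^sub>R axis i 1)) 0"

definition twice_differentiable2 :: "(real^2 \<Rightarrow> real) \<Rightarrow> bool" where
  "twice_differentiable2 f \<longleftrightarrow>
     (\<forall>x. f differentiable (at x)) \<and> (\<forall>i x. partial_deriv i f differentiable (at x))"

definition beta1 :: "real \<Rightarrow> real \<Rightarrow> real \<Rightarrow> real" where
  "beta1 C \<eta> x = (if \<bar>x\<bar> \<le> 1 then C else C * \<bar>x\<bar> powr (- \<eta>))"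

definition beta2 :: "real \<Rightarrow> real \<Rightarrow> real^2 \<Rightarrow> real" where
  "beta2 C \<eta> \<omega> = beta1 C \<eta> (\<omega> $ 1) * beta1 C \<eta> (\<omega> $ 2)"

definition isotropic :: "(real^2 \<Rightarrow> real) \<Rightarrow> bool" where
  "isotropic f \<longleftrightarrow> (\<exists>f0 :: real \<Rightarrow> real. \<forall>\<omega>. f \<omega> = f0 (norm \<omega>))"


section \<open>Sampling\<close>

definition cube :: "real \<Rightarrow> (real^2) set" where
  "cube l = cbox (\<chi> i. - l / 2) (\<chi> i. l / 2)"

text \<open>The locations form a triangular array: \<open>S n j\<close> is the \<open>j\<close>-th location of the \<open>n\<close>-th
  sample, \<open>1 \<le> j \<le> n\<close>; nothing is assumed about different rows.

  Independence of locations and field is expressed through a sub-sigma-algebra \<open>G\<close> that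
  carries the field. Evaluating the field at a random location only makes sense for a field
  that is jointly measurable, and joint measurability is required with respect to \<open>G\<close>
  rather than \<open>M\<close>: otherwise one could change \<open>Z s w\<close> to \<open>0\<close> whenever \<open>s = S n j w\<close>. This
  affects none of the finite-dimensional laws of the field, but it would make the observed
  values vanish identically. On a product space with the field defined on the first and the
  locations on the second factor, \<open>G\<close> is the sigma-algebra of the first factor.\<close>

definition jointly_measurable_field ::
    "'w measure \<Rightarrow> 'w measure \<Rightarrow> (real^2 \<Rightarrow> 'w \<Rightarrow> real) \<Rightarrow> bool" where
  "jointly_measurable_field M G Z \<longleftrightarrow>
     subalgebra M G \<and> (\<lambda>(s, w). Z s w) \<in> borel_measurable (borel \<Otimes>\<^sub>M G)"

definition uniform_sampling ::
    "'w measure \<Rightarrow> 'w measure \<Rightarrow> (nat \<Rightarrow> real) \<Rightarrow> (nat \<Rightarrow> nat \<Rightarrow> 'w \<Rightarrow> real^2) \<Rightarrow> bool" where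
  "uniform_sampling M G lam S \<longleftrightarrow>
     (\<forall>n. prob_space.indep_vars M (\<lambda>_. borel) (S n) {1..n} \<and>
        (\<forall>j\<in>{1..n}. distr M borel (S n j) = uniform_measure lborel (cube (lam n))) \<and>
        prob_space.indep_set M (sets G)
          (sets (vimage_algebra (space M) (\<lambda>w. \<lambda>j\<in>{1..n}. S n j w)
             (Pi\<^sub>M {1..n} (\<lambda>_. borel)))))"


section \<open>Taper and tapered periodogram\<close>

definition taper1 :: "(real \<Rightarrow> real) \<Rightarrow> bool" where
  "taper1 g \<longleftrightarrow>
     (\<forall>x. g x \<ge> 0) \<and> (\<forall>x. g (- x) = g x) \<and> (\<forall>x. x \<notin> {- 1 / 2..1 / 2} \<longrightarrow> g x = 0) \<and>
     (\<forall>x. g differentiable (at x)) \<and> (\<forall>x. deriv g differentiable (at x))"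

definition taper :: "(real^2 \<Rightarrow> real) \<Rightarrow> bool" where
  "taper h \<longleftrightarrow>
     (\<exists>h1 h2. taper1 h1 \<and> taper1 h2 \<and> (\<forall>s. h s = h1 (s $ 1) * h2 (s $ 2))) \<and> (\<exists>s. h s \<noteq> 0)"

definition H2 :: "(real^2 \<Rightarrow> real) \<Rightarrow> int^2 \<Rightarrow> complex" where
  "H2 h m = (LINT s:cube 1|lborel.
     complex_of_real ((h s)\<^sup>2) * exp (- (2 * pi * \<i> * complex_of_real (s \<bullet> (\<chi> i. of_int (m $ i))))))"

text \<open>Because a taper is symmetric, its transform is real; this justifies taking real parts of
  \<^const>\<open>H2\<close> in the real-valued statistics below.\<close>

lemma H2_real:
  assumes "taper h"
  shows "H2 h m = complex_of_real (Re (H2 h m))"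
proof -
  define F where "F = (\<lambda>s :: real^2. indicat_real (cube 1) s *\<^sub>R (complex_of_real ((h s)\<^sup>2) *
     exp (- (2 * pi * \<i> * complex_of_real (s \<bullet> (\<chi> i. of_int (m $ i)))))))"
  have H: "H2 h m = (LINT s|lborel. F s)"
    unfolding H2_def set_lebesgue_integral_def F_def ..
  obtain h1 h2 where t: "taper1 h1" "taper1 h2" and h: "\<And>s. h s = h1 (s $ 1) * h2 (s $ 2)"
    using assms unfolding taper_def by blast
  have hm: "h (- s) = h s" for s
    using t by (simp add: h taper1_def)
  have mem: "- s \<in> cube 1 \<longleftrightarrow> s \<in> cube 1" for s
    unfolding cube_def mem_box_cart forall_2 by auto
  have sym: "F (- s) = cnj (F s)" for s
    unfolding F_def by (simp add: hm mem indicator_def exp_cnj)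
  have contg: "continuous_on A g" if "taper1 g" for g and A :: "real set"
    using that unfolding taper1_def
    by (simp add: continuous_at_imp_continuous_on differentiable_imp_continuous_within)
  have "continuous_on UNIV (\<lambda>s :: real^2. h1 (s $ 1) * h2 (s $ 2))"
    by (intro continuous_on_mult continuous_on_compose2[OF contg[OF t(1), of UNIV]]
          continuous_on_compose2[OF contg[OF t(2), of UNIV]] continuous_on_component
          continuous_on_id subset_UNIV)
  moreover have "h = (\<lambda>s. h1 (s $ 1) * h2 (s $ 2))"
    by (rule ext) (rule h)
  ultimately have conth: "continuous_on UNIV h"
    by simp
  have measF: "F \<in> borel_measurable borel"
    unfolding F_def
  proof (rule borel_measurable_scaleR)
    show "indicat_real (cube 1) \<in> borel_measurable borel"
      by (simp add: cube_def)
    show "(\<lambda>s. complex_of_real ((h s)\<^sup>2) *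
        exp (- (2 * pi * \<i> * complex_of_real (s \<bullet> (\<chi> i. of_int (m $ i))))))
        \<in> borel_measurable borel"
      by (intro borel_measurable_continuous_onI continuous_intros conth)
  qed
  have "(LINT s|lborel. F s) = (LINT s|distr lborel borel uminus. F s)"
    using lborel_affine[of "-1" "0 :: real^2"] by (simp add: density_1)
  also have "\<dots> = (LINT s|lborel. F (- s))"
    by (rule integral_distr) (use measF in auto)
  also have "\<dots> = cnj (LINT s|lborel. F s)" by (simp add: sym)
  finally have "cnj (H2 h m) = H2 h m" using H by simp
  then show ?thesis by (metis Reals_cnj_iff of_real_Re)
qed

definition periodogram ::
    "(real^2 \<Rightarrow> real) \<Rightarrow> nat \<Rightarrow> real \<Rightarrow> (real^2 \<Rightarrow> 'w \<Rightarrow> real) \<Rightarrow> (nat \<Rightarrow> 'w \<Rightarrow> real^2) \<Rightarrow> real^2 \<Rightarrow> 'w \<Rightarrow> real"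
    where
  "periodogram h n l Z s \<omega> w =
     l\<^sup>2 / ((real n)\<^sup>2 * Re (H2 h 0)) *
     (cmod (\<Sum>j=1..n. complex_of_real (h ((1 / l) *\<^sub>R s j w) * Z (s j w) w)
                      * exp (\<i> * complex_of_real (s j w \<bullet> \<omega>))))\<^sup>2"

definition shifted_freq :: "real \<Rightarrow> int^2 \<Rightarrow> real^2" where
  "shifted_freq l k = (\<chi> i. 2 * pi * of_int (k $ i) / l + pi / l)"

definition index_range :: "nat \<Rightarrow> (int^2) set" where
  "index_range a = {k. \<forall>i. k $ i \<in> {- int a..int a - 1}}"

lemma finite_index_range: "finite (index_range a)"
proof -
  have "index_range a \<subseteq> (\<lambda>(x, y). vector [x, y]) ` ({- int a..int a - 1} \<times> {- int a..int a - 1})"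
  proof
    fix k :: "int^2" assume "k \<in> index_range a"
    moreover have "k = vector [k $ 1, k $ 2]" by (simp add: vec_eq_iff forall_2)
    ultimately show "k \<in> (\<lambda>(x, y). vector [x, y]) ` ({- int a..int a - 1} \<times> {- int a..int a - 1})"
      unfolding index_range_def by (intro image_eqI[where x = "(k $ 1, k $ 2)"]) auto
  qed
  then show ?thesis by (rule finite_subset) simp
qed

definition F_hat ::
    "(real^2 \<Rightarrow> real) \<Rightarrow> nat \<Rightarrow> real \<Rightarrow> nat \<Rightarrow> (real^2 \<Rightarrow> 'w \<Rightarrow> real) \<Rightarrow> (nat \<Rightarrow> 'w \<Rightarrow> real^2) \<Rightarrow> 'w \<Rightarrow> real"
    where
  "F_hat h n l a Z s w =
     1 / 24 * (2 * pi / l)\<^sup>2 * (\<Sum>k\<in>index_range a. periodogram h n l Z s (shifted_freq l k) w ^ 4)"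

definition tau_sq_hat ::
    "(real^2 \<Rightarrow> real) \<Rightarrow> nat \<Rightarrow> real \<Rightarrow> nat \<Rightarrow> (real^2 \<Rightarrow> 'w \<Rightarrow> real) \<Rightarrow> (nat \<Rightarrow> 'w \<Rightarrow> real^2) \<Rightarrow> 'w \<Rightarrow> real"
    where
  "tau_sq_hat h n l a Z s w =
     2 * (2 * pi)\<^sup>2 * F_hat h n l a Z s w * (\<Sum>m\<in>index_range a. Re (H2 h m) ^ 4 / Re (H2 h 0) ^ 4)"

definition tau_sq :: "(real^2 \<Rightarrow> real) \<Rightarrow> (real^2 \<Rightarrow> real) \<Rightarrow> real" where
  "tau_sq h f =
     2 * (2 * pi)\<^sup>2 * (\<Sum>\<^sub>\<infinity>m. Re (H2 h m) ^ 4 / Re (H2 h 0) ^ 4) * (LINT \<omega>|lborel. f \<omega> ^ 4)"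

end

(*
  Conditionally on the locations, the discrete Fourier transform of the tapered sample is a Gaussian
  vector, so the moments of powers of the periodogram are polynomials in quadratic forms of the
  covariance function c.  Writing c as the Fourier transform of f turns such a form into an integral
  against f of products of empirical Fourier transforms of the taper.  The empirical transforms
  concentrate around their means at rate n^(-1/2) in every moment (Hoeffding), so the normalised forms
  converge in every moment: to f(omega)/2 for the cosine and the sine part at one frequency, to 0 for
  the covariance of the two parts and for distinct frequencies.  Hence E I^4 tends to 24 f^4, and
  E I(omega)^4 I(omega')^4 factorises in the limit.  Reading the frequency sums as integrals of step
  functions, with the majorant (phi2 + lambda^2/n)^4 obtained from the decay of f and of the transform
  of the taper, Pratt's lemma gives E F -> int f^4 and E F^2 -> (int f^4)^2, and Chebyshev's
  inequality concludes.
*)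
theory Submission
  imports Defs
begin

text \<open>The grid is the obstacle. It covers a square of side \<open>4 * pi * a / lam\<close>, so
  its area tends to infinity, while every periodogram ordinate carries sampling noise of order
  \<open>lam^2 / n\<close> that does not decay in frequency. The majorant therefore depends on n.
  Its noise part has an integral of order (lam^2/n)^4 (a/lam)^2 = (lam^2/n)^3 (a^2/n), which
  vanishes because a^2/n stays bounded. The second moment of the estimator involves a
  sixteenth-degree Gaussian moment. Instead of summing over pairings, Hilbert's identity writes (x^2
  + y^2)^4 as a positive combination of eighth powers of linear forms, so a single bivariate moment
  E U^8 V^8 suffices. The factor 24 = 4! is the fourth moment of the standard exponential law. The
  moment limits exclude frequency 0 and pairs with \<omega>' = \<omega> or \<omega>' = -\<omega>;
  these are null sets for the integrals, so no rate in the separation of frequencies is required.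
  Conditioning on the locations is carried out with nonnegative integrals, since integrability of
  powers of the observed field is itself a conclusion.\<close>

section \<open>Moment inequalities and dominated convergence\<close>

text \<open>Truncation at \<open>G\<close> makes dominated convergence applicable to min(f_n, G).
  What is cut off is at most g_n - min(g_n, G), because f_n \<le> g_n, and the integral of that
  tends to 0 since the integrals of g_n converge to that of \<open>G\<close>.\<close>

lemma pratt_nonneg:
  fixes f g :: "nat \<Rightarrow> 'a \<Rightarrow> real"
  assumes f[measurable]: "\<And>n. f n \<in> borel_measurable M" and f0[measurable]: "F \<in> borel_measurable M"
    and g: "\<And>n. integrable M (g n)" "integrable M G"
    and limf: "AE x in M. (\<lambda>n. f n x) \<longlonglongrightarrow> F x"
    and limg: "AE x in M. (\<lambda>n. g n x) \<longlonglongrightarrow> G x"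
    and intg: "(\<lambda>n. \<integral>x. g n x \<partial>M) \<longlonglongrightarrow> (\<integral>x. G x \<partial>M)"
    and le: "\<And>n x. 0 \<le> f n x" "\<And>n x. f n x \<le> g n x"
  shows "integrable M F \<and> (\<lambda>n. \<integral>x. f n x \<partial>M) \<longlonglongrightarrow> (\<integral>x. F x \<partial>M)"
proof -
  note [measurable] = borel_measurable_integrable[OF g(1)] borel_measurable_integrable[OF g(2)]
  have G0: "AE x in M. 0 \<le> F x \<and> F x \<le> G x"
    using limf limg
  proof eventually_elim
    case (elim x)
    from elim(1) have "0 \<le> F x" by (rule LIMSEQ_le_const) (use le in auto)
    moreover have "F x \<le> G x" by (rule LIMSEQ_le[OF elim]) (use le in auto)
    ultimately show ?case by simp
  qed
  have dct: "(\<lambda>n. \<integral>x. min (f n x) (G x) \<partial>M) \<longlonglongrightarrow> (\<integral>x. F x \<partial>M)"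
    and intF: "integrable M F"
  proof -
    have A: "AE x in M. (\<lambda>n. min (f n x) (G x)) \<longlonglongrightarrow> F x"
      using limf G0
    proof eventually_elim
      case (elim x)
      have "(\<lambda>n. min (f n x) (G x)) \<longlonglongrightarrow> min (F x) (G x)"
        by (intro tendsto_min elim tendsto_const)
      then show ?case using elim by (simp add: min_def)
    qed
    have B: "AE x in M. norm (min (f n x) (G x)) \<le> G x" for n
      using G0 by eventually_elim (use le in \<open>auto simp: min_def\<close>)
    show "(\<lambda>n. \<integral>x. min (f n x) (G x) \<partial>M) \<longlonglongrightarrow> (\<integral>x. F x \<partial>M)"
      by (rule integral_dominated_convergence[where w=G]) (use A B g in auto)
    show "integrable M F"
      by (rule integrable_dominated_convergence[where w=G and s="\<lambda>n x. min (f n x) (G x)"]) (use A B g in auto)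
  qed
  have dct2: "(\<lambda>n. \<integral>x. min (g n x) (G x) \<partial>M) \<longlonglongrightarrow> (\<integral>x. G x \<partial>M)"
  proof (rule integral_dominated_convergence[where w=G])
    show "AE x in M. (\<lambda>n. min (g n x) (G x)) \<longlonglongrightarrow> G x"
      using limg
    proof eventually_elim
      case (elim x)
      have "(\<lambda>n. min (g n x) (G x)) \<longlonglongrightarrow> min (G x) (G x)"
        by (intro tendsto_min elim tendsto_const)
      then show ?case by simp
    qed
    show "AE x in M. norm (min (g n x) (G x)) \<le> G x" for n
      using G0
    proof eventually_elim
      case (elim x)
      have "0 \<le> g n x" using le[of n x] by linarith
      then show ?case using elim by (auto simp: min_def)
    qed
  qed (use g in auto)
  have intf: "integrable M (f n)" for n
    by (rule Bochner_Integration.integrable_bound[OF g(1)[of n]]) (auto simp: le intro!: AE_I2 order_trans[OF le(2) abs_ge_self])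
  have d0: "(\<lambda>n. (\<integral>x. g n x \<partial>M) - (\<integral>x. min (g n x) (G x) \<partial>M)) \<longlonglongrightarrow> 0"
    using tendsto_diff[OF intg dct2] by simp
  have "(\<lambda>n. (\<integral>x. f n x \<partial>M) - (\<integral>x. min (f n x) (G x) \<partial>M)) \<longlonglongrightarrow> 0"
  proof (rule tendsto_sandwich[OF _ _ tendsto_const d0])
    have mi: "integrable M (\<lambda>x. min (f n x) (G x))" "integrable M (\<lambda>x. min (g n x) (G x))" for n
      using intf g by auto
    show "\<forall>\<^sub>F n in sequentially. 0 \<le> (\<integral>x. f n x \<partial>M) - (\<integral>x. min (f n x) (G x) \<partial>M)"
      by (intro always_eventually allI) (simp add: integral_mono[OF mi(1) intf])
    show "\<forall>\<^sub>F n in sequentially. (\<integral>x. f n x \<partial>M) - (\<integral>x. min (f n x) (G x) \<partial>M)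
      \<le> (\<integral>x. g n x \<partial>M) - (\<integral>x. min (g n x) (G x) \<partial>M)"
    proof (intro always_eventually allI)
      fix n
      have "(\<integral>x. f n x - min (f n x) (G x) \<partial>M) \<le> (\<integral>x. g n x - min (g n x) (G x) \<partial>M)"
      proof (rule integral_mono)
        show "f n x - min (f n x) (G x) \<le> g n x - min (g n x) (G x)" for x
          using le(2)[of n x] by linarith
      qed (use mi intf g in auto)
      then show "(\<integral>x. f n x \<partial>M) - (\<integral>x. min (f n x) (G x) \<partial>M)
      \<le> (\<integral>x. g n x \<partial>M) - (\<integral>x. min (g n x) (G x) \<partial>M)"
        using mi intf g by simp
    qed
  qed
  from tendsto_add[OF this dct] show ?thesis using intF by simp
qed

section \<open>Elementary inequalities for powers\<close>

lemma power_add_le: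
  fixes a b :: real
  assumes "0 \<le> a" "0 \<le> b"
  shows "(a + b) ^ p \<le> 2 ^ p * (a ^ p + b ^ p)"
proof -
  have "(a + b) ^ p \<le> (2 * max a b) ^ p"
    by (rule power_mono) (use assms in auto)
  also have "\<dots> = 2 ^ p * (max a b) ^ p" by (simp add: power_mult_distrib)
  also have "(max a b) ^ p \<le> a ^ p + b ^ p"
    using assms by (auto simp: max_def)
  finally show ?thesis by simp
qed

text \<open>The graph of a power lies above its tangent at s. In the induction step the two sides
  differ from y times the previous inequality by the nonnegative multiple
  \<open>real (Suc n) * s ^ n * (y - s)\<^sup>2\<close>.\<close>

lemma power_tangent:
  fixes y s :: real
  assumes "0 \<le> y" "0 \<le> s"
  shows "s ^ Suc n + real (Suc n) * s ^ n * (y - s) \<le> y ^ Suc n"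
proof (induction n)
  case (Suc n)
  have "s ^ Suc (Suc n) + real (Suc (Suc n)) * s ^ Suc n * (y - s)
      = y * (s ^ Suc n + real (Suc n) * s ^ n * (y - s)) - real (Suc n) * s ^ n * (y - s)\<^sup>2"
    by (simp add: algebra_simps power2_eq_square)
  also have "\<dots> \<le> y * (s ^ Suc n + real (Suc n) * s ^ n * (y - s))"
    using assms by simp
  also have "\<dots> \<le> y * y ^ Suc n"
    by (rule mult_left_mono[OF Suc assms(1)])
  finally show ?case by simp
qed simp

text \<open>Jensen's inequality for the finite measure with density g, whose total mass need not be
  1; hence the factor \<open>(\<integral>x. g x \<partial>M) ^ p\<close>. The bound on Y only
  provides integrability.\<close>

lemma jensen_power:
  fixes g Y :: "'a \<Rightarrow> real"
  assumes g: "integrable M g" "\<And>x. 0 \<le> g x"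
    and Y[measurable]: "Y \<in> borel_measurable M" and Yb: "\<And>x. 0 \<le> Y x" "\<And>x. Y x \<le> B"
  shows "(\<integral>x. g x * Y x \<partial>M) ^ Suc p \<le> (\<integral>x. g x \<partial>M) ^ p * (\<integral>x. g x * Y x ^ Suc p \<partial>M)"
proof -
  note [measurable] = borel_measurable_integrable[OF g(1)]
  have igp: "integrable M (\<lambda>x. g x * Y x ^ k)" for k
  proof (rule Bochner_Integration.integrable_bound[where f="\<lambda>x. B ^ k * g x"])
    show "AE x in M. norm (g x * Y x ^ k) \<le> norm (B ^ k * g x)"
    proof (intro AE_I2)
      fix x
      have "0 \<le> B" using Yb[of x] by linarith
      moreover have "Y x ^ k \<le> B ^ k" by (rule power_mono) (use Yb in auto)
      ultimately show "norm (g x * Y x ^ k) \<le> norm (B ^ k * g x)"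
        using g(2)[of x] Yb(1)[of x] by (simp add: abs_mult mult.commute[of "B^k"] mult_left_mono)
    qed
  qed (use g in auto)
  define m where "m = (\<integral>x. g x \<partial>M)"
  define t where "t = (\<integral>x. g x * Y x \<partial>M)"
  have m0: "0 \<le> m" unfolding m_def using g by simp
  have t0: "0 \<le> t" unfolding t_def using g Yb by simp
  have ig1: "integrable M (\<lambda>x. g x * Y x)" using igp[of 1] by simp
  show ?thesis
  proof (cases "m = 0")
    case True
    have "t \<le> (\<integral>x. B * g x \<partial>M)"
      unfolding t_def by (rule integral_mono) (use g Yb ig1 in \<open>auto simp: mult.commute mult_right_mono\<close>)
    also have "\<dots> = B * m" by (simp add: m_def)
    finally have "t = 0" using True t0 by simp
    moreover have "0 \<le> (\<integral>x. g x * Y x ^ Suc p \<partial>M)"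
      using g Yb by (intro integral_nonneg_AE AE_I2) simp
    ultimately show ?thesis using m0 unfolding t_def[symmetric] m_def[symmetric] by simp
  next
    case False
    then have m: "0 < m" using m0 by simp
    \<comment> \<open>The tangent is taken at the g-weighted mean of Y, where its linear part
      integrates to zero.\<close>
    define s where "s = t / m"
    have s0: "0 \<le> s" using m t0 by (simp add: s_def)
    have "(\<integral>x. (s ^ Suc p - real (Suc p) * s ^ p * s) * g x + (real (Suc p) * s ^ p) * (g x * Y x) \<partial>M)
        \<le> (\<integral>x. g x * Y x ^ Suc p \<partial>M)"
    proof (rule integral_mono)
      fix x
      have "g x * (s ^ Suc p + real (Suc p) * s ^ p * (Y x - s)) \<le> g x * Y x ^ Suc p"
        by (rule mult_left_mono[OF power_tangent[OF Yb(1) s0] g(2)])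
      then show "(s ^ Suc p - real (Suc p) * s ^ p * s) * g x + (real (Suc p) * s ^ p) * (g x * Y x) \<le> g x * Y x ^ Suc p"
        by (simp add: algebra_simps)
    qed (use g ig1 igp[of "Suc p"] in auto)
    also have "(\<integral>x. (s ^ Suc p - real (Suc p) * s ^ p * s) * g x + (real (Suc p) * s ^ p) * (g x * Y x) \<partial>M)
      = (s ^ Suc p - real (Suc p) * s ^ p * s) * m + (real (Suc p) * s ^ p) * t"
      unfolding m_def t_def using g ig1 by simp
    also have "\<dots> = s ^ Suc p * m" using m by (simp add: s_def field_simps)
    finally have "m ^ p * (s ^ Suc p * m) \<le> m ^ p * (\<integral>x. g x * Y x ^ Suc p \<partial>M)"
      using m by simp
    moreover have "m ^ p * (s ^ Suc p * m) = t ^ Suc p"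
      using m by (simp add: s_def field_simps)
    ultimately show ?thesis unfolding m_def t_def by simp
  qed
qed

section \<open>Moments of sample means\<close>

lemma even_power_le_exp:
  fixes x :: real
  shows "x ^ (2 * p) \<le> fact (2 * p) * (exp x + exp (- x))"
proof -
  have *: "x ^ (2 * p) / fact (2 * p) \<le> exp x" if "0 \<le> x" for x :: real
  proof -
    have "(\<Sum>k\<in>{2*p}. inverse (fact k) *\<^sub>R x ^ k) \<le> exp x"
      unfolding exp_def
      by (rule sum_le_suminf) (use that in \<open>auto simp: summable_exp\<close>)
    then show ?thesis by (simp add: divide_inverse mult.commute)
  qed
  have "x ^ (2 * p) / fact (2 * p) \<le> exp x + exp (- x)"
  proof (cases "0 \<le> x")
    case True
    then show ?thesis using *[of x] by (smt (verit) exp_ge_zero)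
  next
    case False
    then show ?thesis using *[of "- x"] by (smt (verit) exp_ge_zero even_mult_iff even_numeral power_minus_even)
  qed
  then show ?thesis by (simp add: field_simps)
qed

text \<open>Hoeffding's lemma bounds the exponential moments at 1 and -1 of the sum normalised by
  sqrt n, uniformly in n. An even power is at most (2p)! times the sum of these two exponentials, so
  the normalised moments are bounded and undoing the normalisation gives the rate n^(-p).\<close>

lemma (in prob_space) sample_mean_moment_bound:
  fixes X :: "nat \<Rightarrow> 'a \<Rightarrow> real"
  assumes indep: "indep_vars (\<lambda>_. borel) X {1..n}" and n: "1 \<le> n"
    and B: "\<And>i w. i \<in> {1..n} \<Longrightarrow> w \<in> space M \<Longrightarrow> \<bar>X i w\<bar> \<le> B"
    and mean: "\<And>i. i \<in> {1..n} \<Longrightarrow> expectation (X i) = \<mu>"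
  shows "expectation (\<lambda>w. ((\<Sum>i=1..n. X i w) / real n - \<mu>) ^ (2 * p)) \<le> 2 * fact (2 * p) * exp (B\<^sup>2 / 2) / real n ^ p"
proof -
  interpret indep_interval_bounded_random_variables M "{1..n}" X "\<lambda>_. - B" "\<lambda>_. B"
    by unfold_locales (use indep B in \<open>auto intro!: AE_I2 simp: abs_le_iff minus_le_iff\<close>)
  define W where "W w = (\<Sum>i=1..n. X i w - \<mu>) / sqrt (real n)" for w
  define l where "l = 1 / sqrt (real n)"
  have l: "l > 0" using n by (simp add: l_def)
  have [measurable]: "X i \<in> borel_measurable M" if "i \<in> {1..n}" for i
    by (rule random_variable[OF that])
  have Wm[measurable]: "W \<in> borel_measurable M" unfolding W_def by measurable
  have one: "(\<integral>\<^sup>+w. ennreal (exp (e * W w)) \<partial>M) \<le> ennreal (exp (B\<^sup>2 / 2))" if e: "e = 1 \<or> e = -1" for e :: real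
  proof -
    have "(\<integral>\<^sup>+w. ennreal (exp (e * W w)) \<partial>M) = (\<integral>\<^sup>+w. (\<Prod>i\<in>{1..n}. ennreal (exp (l * (e * (X i w - \<mu>))))) \<partial>M)"
      \<comment> \<open>The exponential of the sum is written as a product, so that independence can
        factor the nonnegative integral.\<close>
      by (intro nn_integral_cong)
         (simp add: W_def l_def prod_ennreal flip: exp_sum, simp add: sum_distrib_left sum_divide_distrib algebra_simps)
    also have "\<dots> = (\<Prod>i\<in>{1..n}. \<integral>\<^sup>+w. ennreal (exp (l * (e * (X i w - \<mu>)))) \<partial>M)"
      by (intro indep_vars_nn_integral indep_vars_compose2[OF indep]) auto
    also have "\<dots> \<le> (\<Prod>i\<in>{1..n}. ennreal (exp (l\<^sup>2 * (B - (- B))\<^sup>2 / 8)))"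
    proof (intro prod_mono_ennreal)
      fix i assume i: "i \<in> {1..n}"
      note [measurable] = random_variable[OF i]
      interpret Y: interval_bounded_random_variable M "\<lambda>w. e * (X i w - \<mu>)" "- B - e * \<mu>" "B - e * \<mu>"
        by unfold_locales (use e B[OF i] in \<open>auto intro!: AE_I2 simp: abs_le_iff minus_le_iff algebra_simps\<close>)
      have ix: "integrable M (X i)"
        by (rule integrable_const_bound[where B=B]) (use B[OF i] in auto)
      have "expectation (\<lambda>w. e * (X i w - \<mu>)) = 0"
        using ix mean[OF i] by (simp add: prob_space)
      from Y.Hoeffdings_lemma_nn_integral_0[OF l this]
      show "(\<integral>\<^sup>+w. ennreal (exp (l * (e * (X i w - \<mu>)))) \<partial>M) \<le> ennreal (exp (l\<^sup>2 * (B - (- B))\<^sup>2 / 8))"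
        by simp
    qed
    also have "\<dots> = ennreal (exp (l\<^sup>2 * (B - (- B))\<^sup>2 / 8) ^ n)"
      by (simp add: ennreal_power)
    also have "exp (l\<^sup>2 * (B - (- B))\<^sup>2 / 8) ^ n = exp (real n * (l\<^sup>2 * (B - (- B))\<^sup>2 / 8))"
      by (rule exp_of_nat_mult[symmetric])
    \<comment> \<open>Each centred summand lies in an interval of length 2B and is scaled by 1/sqrt
      n, so it contributes B^2/(2n) to the exponent, and there are n of them.\<close>
    also have "real n * (l\<^sup>2 * (B - (- B))\<^sup>2 / 8) = B\<^sup>2 / 2"
      using n by (simp add: l_def power_divide power2_eq_square)
    finally show ?thesis .
  qed
  have bnd: "\<bar>X i w - \<mu>\<bar> \<le> B + \<bar>\<mu>\<bar>" if "i \<in> {1..n}" "w \<in> space M" for i w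
    using B[OF that] by linarith
  have Wb: "\<bar>W w\<bar> \<le> (\<Sum>i=1..n. B + \<bar>\<mu>\<bar>) / sqrt (real n)" if "w \<in> space M" for w
  proof -
    have "\<bar>\<Sum>i=1..n. X i w - \<mu>\<bar> \<le> (\<Sum>i=1..n. B + \<bar>\<mu>\<bar>)"
      by (rule order_trans[OF sum_abs sum_mono]) (use bnd that in auto)
    then show ?thesis unfolding W_def by (simp add: divide_right_mono abs_divide)
  qed
  have nn: "(\<integral>\<^sup>+w. ennreal (W w ^ (2 * p)) \<partial>M) \<le> ennreal (fact (2 * p) * (2 * exp (B\<^sup>2 / 2)))"
  proof -
    have "(\<integral>\<^sup>+w. ennreal (W w ^ (2 * p)) \<partial>M) \<le> (\<integral>\<^sup>+w. ennreal (fact (2 * p)) * (ennreal (exp (1 * W w)) + ennreal (exp (-1 * W w))) \<partial>M)"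
      by (intro nn_integral_mono) (auto simp flip: ennreal_plus ennreal_mult intro!: ennreal_leI even_power_le_exp)
    also have "\<dots> = ennreal (fact (2 * p)) * ((\<integral>\<^sup>+w. ennreal (exp (1 * W w)) \<partial>M) + (\<integral>\<^sup>+w. ennreal (exp (-1 * W w)) \<partial>M))"
      by (simp add: nn_integral_cmult nn_integral_add)
    also have "\<dots> \<le> ennreal (fact (2 * p)) * (ennreal (exp (B\<^sup>2 / 2)) + ennreal (exp (B\<^sup>2 / 2)))"
      by (intro mult_left_mono add_mono one) auto
    also have "\<dots> = ennreal (fact (2 * p) * (2 * exp (B\<^sup>2 / 2)))"
      by (simp flip: ennreal_plus ennreal_mult)
    finally show ?thesis .
  qed
  have Wint: "expectation (\<lambda>w. W w ^ (2 * p)) \<le> fact (2 * p) * (2 * exp (B\<^sup>2 / 2))"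
  proof -
    have "ennreal (expectation (\<lambda>w. W w ^ (2 * p))) = (\<integral>\<^sup>+w. ennreal (W w ^ (2 * p)) \<partial>M)"
    proof (rule nn_integral_eq_integral[symmetric])
      show "integrable M (\<lambda>w. W w ^ (2 * p))"
        by (rule integrable_const_bound[where B="((\<Sum>i=1..n. B + \<bar>\<mu>\<bar>) / sqrt (real n)) ^ (2 * p)"])
           (use Wb in \<open>auto intro!: AE_I2 power_mono simp: power_abs\<close>)
    qed auto
    with nn have "ennreal (expectation (\<lambda>w. W w ^ (2 * p))) \<le> ennreal (fact (2 * p) * (2 * exp (B\<^sup>2 / 2)))"
      by simp
    then show ?thesis by (subst (asm) ennreal_le_iff) auto
  qed
  have eq: "(\<Sum>i=1..n. X i w) / real n - \<mu> = W w / sqrt (real n)" for w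
    using n by (simp add: W_def sum_subtractf field_simps)
  have "expectation (\<lambda>w. ((\<Sum>i=1..n. X i w) / real n - \<mu>) ^ (2 * p)) = expectation (\<lambda>w. W w ^ (2 * p)) / real n ^ p"
    unfolding eq by (simp add: power_divide power_mult real_sqrt_pow2)
  also have "\<dots> \<le> fact (2 * p) * (2 * exp (B\<^sup>2 / 2)) / real n ^ p"
    by (intro divide_right_mono Wint) auto
  finally show ?thesis by (simp add: mult_ac)
qed

section \<open>Gaussian moments and convergence in all moments\<close>

text \<open>The factor is the double factorial (2k-1)!!. Expressing the moment through the second
  moment instead of \<sigma> lets one formula cover the degenerate laws as well; in either case the
  vanishing mean forces \<mu> = 0.\<close>

lemma gaussian_rv_even_moment:
  assumes "prob_space M" and g: "gaussian_rv M X" and mean: "(\<integral>w. X w \<partial>M) = 0"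
  shows "integrable M (\<lambda>w. X w ^ (2 * k))"
    and "(\<integral>w. X w ^ (2 * k) \<partial>M) = fact (2 * k) / (2 ^ k * fact k) * (\<integral>w. X w ^ 2 \<partial>M) ^ k"
proof -
  interpret prob_space M by fact
  have X[measurable]: "X \<in> borel_measurable M" using g by (simp add: gaussian_rv_def)
  obtain \<mu> \<sigma> where s: "\<sigma> \<ge> 0" and d: "distr M borel X =
        (if \<sigma> = 0 then return borel \<mu> else density lborel (\<lambda>x. ennreal (normal_density \<mu> \<sigma> x)))"
    using g unfolding gaussian_rv_def by blast
  have I: "integrable M (\<lambda>w. F (X w)) \<longleftrightarrow> integrable (distr M borel X) F"
    and E: "(\<integral>w. F (X w) \<partial>M) = (\<integral>x. F x \<partial>distr M borel X)" if [measurable]: "F \<in> borel_measurable borel" for F :: "real \<Rightarrow> real"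
    by (simp_all add: integrable_distr_eq integral_distr)
  show "integrable M (\<lambda>w. X w ^ (2 * k))"
    and "(\<integral>w. X w ^ (2 * k) \<partial>M) = fact (2 * k) / (2 ^ k * fact k) * (\<integral>w. X w ^ 2 \<partial>M) ^ k"
  proof -
    show "integrable M (\<lambda>w. X w ^ (2 * k))"
    proof (cases "\<sigma> = 0")
      case True
      then have d': "distr M borel X = return borel \<mu>" using d by simp
      show ?thesis unfolding I[of "\<lambda>x. x ^ (2 * k)", simplified] d'
        by (simp add: integrable_iff_bounded nn_integral_return)
    next
      case False
      then have s': "\<sigma> > 0" and d': "distr M borel X = density lborel (\<lambda>x. ennreal (normal_density \<mu> \<sigma> x))"
        using s d by auto
      have "(\<integral>w. X w \<partial>M) = (\<integral>x. normal_density \<mu> \<sigma> x * x \<partial>lborel)"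
        using E[of "\<lambda>x. x"] unfolding d' by (simp add: integral_density)
      then have mu: "\<mu> = 0" using mean integral_normal_moment_nz_1[OF s', of \<mu>] by simp
      show ?thesis unfolding I[of "\<lambda>x. x ^ (2 * k)", simplified] d'
        using integrable_normal_moment[OF s', of \<mu> "2 * k"] mu by (subst integrable_density) auto
    qed
    show "(\<integral>w. X w ^ (2 * k) \<partial>M) = fact (2 * k) / (2 ^ k * fact k) * (\<integral>w. X w ^ 2 \<partial>M) ^ k"
    proof (cases "\<sigma> = 0")
      case True
      then have d': "distr M borel X = return borel \<mu>" using d by simp
      have "\<mu> = 0" using mean E[of "\<lambda>x. x"] unfolding d' by (simp add: integral_return)
      then show ?thesis unfolding E[of "\<lambda>x. x ^ (2 * k)", simplified] E[of "\<lambda>x. x ^ 2", simplified] d'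
        by (cases "k = 0") (simp_all add: integral_return zero_power measure_return)
    next
      case False
      then have s': "\<sigma> > 0" and d': "distr M borel X = density lborel (\<lambda>x. ennreal (normal_density \<mu> \<sigma> x))"
        using s d by auto
      have "(\<integral>w. X w \<partial>M) = (\<integral>x. normal_density \<mu> \<sigma> x * x \<partial>lborel)"
        using E[of "\<lambda>x. x"] unfolding d' by (simp add: integral_density)
      then have mu: "\<mu> = 0" using mean integral_normal_moment_nz_1[OF s', of \<mu>] by simp
      have m: "(\<integral>w. X w ^ (2 * j) \<partial>M) = fact (2 * j) / ((2 / \<sigma>\<^sup>2)^j * fact j)" for j
        unfolding E[of "\<lambda>x. x ^ (2 * j)", simplified] d'
        using integral_normal_moment_even[OF s', of \<mu> j] mu by (subst integral_density) auto
      have "(\<integral>w. X w ^ 2 \<partial>M) = \<sigma>\<^sup>2" using m[of 1] by simp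
      then show ?thesis unfolding m by (simp add: power_divide)
    qed
  qed
qed

section \<open>A joint moment of a Gaussian pair\<close>

text \<open>The moment \<open>E U\<^sup>8 V\<^sup>8\<close> of a centred Gaussian pair with variances \<open>u\<close>, \<open>v\<close> and covariance \<open>r\<close>,
  read off from \<open>E (U + t V)\<^sup>1\<^sup>6 = 2027025 (u + 2 t r + t\<^sup>2 v)\<^sup>8\<close>.\<close>

definition moment88 :: "real \<Rightarrow> real \<Rightarrow> real \<Rightarrow> real" where
  "moment88 u v r = 2027025 / 12870 *
     (70 * u^4 * v^4 + 2240 * u^3 * v^3 * r^2 + 6720 * u^2 * v^2 * r^4 + 3584 * u * v * r^6 + 256 * r^8)"

lemma coeff_square_deg8:
  fixes a0 :: real
  shows "coeff ([:a0, a1, a2, a3, a4, a5, a6, a7, a8:] * [:a0, a1, a2, a3, a4, a5, a6, a7, a8:]) 8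
    = 2 * (a0 * a8) + 2 * (a1 * a7) + 2 * (a2 * a6) + 2 * (a3 * a5) + a4 * a4"
  unfolding coeff_mult by (simp add: numeral_eq_Suc atMost_Suc)

lemma square_deg4:
  fixes a0 :: real
  shows "[:a0, a1, a2, a3, a4:] * [:a0, a1, a2, a3, a4:] =
    [:a0 * a0, 2 * (a0 * a1), 2 * (a0 * a2) + a1 * a1, 2 * (a0 * a3) + 2 * (a1 * a2), 
      2 * (a0 * a4) + 2 * (a1 * a3) + a2 * a2, 2 * (a1 * a4) + 2 * (a2 * a3), 2 * (a2 * a4) + a3 * a3, 2 * (a3 * a4), a4 * a4:]"
  by simp

text \<open>The eighth power is reached by three squarings. Only the middle coefficient of the last
  square is ever expanded, which keeps the symbolic computation small.\<close>

lemma moment88_coeff: "moment88 u v r = 2027025 / 12870 * coeff ([:u, 2 * r, v:] ^ 8) 8"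
proof -
  have 2: "[:u, 2 * r, v:] ^ 2 = [:u^2, 4*u*r, 2 * u * v + 4 * r^2, 4 * r * v, v^2:]"
    by (simp add: power2_eq_square)
  have p8: "p ^ 8 = ((p ^ 2) * (p ^ 2)) * ((p ^ 2) * (p ^ 2))" for p :: "real poly"
    by (simp flip: power_add)
  have "coeff ([:u, 2 * r, v:] ^ 8) 8 = 2 * (u\<^sup>2 * u\<^sup>2 * (v\<^sup>2 * v\<^sup>2)) + 2 * (2 * (u\<^sup>2 * (4 * u * r)) * (2 * (4 * r * v * v\<^sup>2)))
     + 2 * ((2 * (u\<^sup>2 * (2 * u * v + 4 * r\<^sup>2)) + 4 * u * r * (4 * u * r)) * (2 * ((2 * u * v + 4 * r\<^sup>2) * v\<^sup>2) + 4 * r * v * (4 * r * v)))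
     + 2 * ((2 * (u\<^sup>2 * (4 * r * v)) + 2 * (4 * u * r * (2 * u * v + 4 * r\<^sup>2))) * (2 * (4 * u * r * v\<^sup>2) + 2 * ((2 * u * v + 4 * r\<^sup>2) * (4 * r * v))))
     + (2 * (u\<^sup>2 * v\<^sup>2) + 2 * (4 * u * r * (4 * r * v)) + (2 * u * v + 4 * r\<^sup>2) * (2 * u * v + 4 * r\<^sup>2)) * (2 * (u\<^sup>2 * v\<^sup>2) + 2 * (4 * u * r * (4 * r * v)) + (2 * u * v + 4 * r\<^sup>2) * (2 * u * v + 4 * r\<^sup>2))"
    unfolding p8 2 square_deg4 coeff_square_deg8 ..
  also have "\<dots> = 70 * u^4 * v^4 + 2240 * u^3 * v^3 * r^2 + 6720 * u^2 * v^2 * r^4 + 3584 * u * v * r^6 + 256 * r^8"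
    by (simp add: algebra_simps power2_eq_square power_numeral_even power_numeral_odd)
  finally show ?thesis unfolding moment88_def by simp
qed

text \<open>Polarisation: for every t the sixteenth moment of U + tV is 15!! = 2027025 times the
  eighth power of its variance. Both sides are polynomials in t, so the coefficients of t^8 agree;
  on the left it is (16 choose 8) = 12870 times the wanted moment. Since only the laws of linear
  combinations enter, degenerate pairs are included.\<close>

lemma gaussian_bivariate_moment88:
  fixes U V :: "'a \<Rightarrow> real"
  assumes M: "prob_space M"
    and g: "\<And>t. gaussian_rv M (\<lambda>w. U w + t * V w)" "gaussian_rv M V"
    and i: "integrable M U" "integrable M V" and mean: "(\<integral>w. U w \<partial>M) = 0" "(\<integral>w. V w \<partial>M) = 0"
  shows "integrable M (\<lambda>w. U w ^ 8 * V w ^ 8)"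
    and "(\<integral>w. U w ^ 8 * V w ^ 8 \<partial>M) = moment88 (\<integral>w. U w ^ 2 \<partial>M) (\<integral>w. V w ^ 2 \<partial>M) (\<integral>w. U w * V w \<partial>M)"
proof -
  note [measurable] = borel_measurable_integrable[OF i(1)] borel_measurable_integrable[OF i(2)]
  have gU: "gaussian_rv M U" using g(1)[of 0] by simp
  note mU = gaussian_rv_even_moment[OF M gU mean(1)]
  note mV = gaussian_rv_even_moment[OF M g(2) mean(2)]
  \<comment> \<open>A mixed monomial of total degree 2m is dominated by the sum of the two pure
    powers, so all mixed moments exist.\<close>
  have ge: "\<bar>a ^ j * b ^ k\<bar> \<le> a ^ (2 * m) + b ^ (2 * m)" if "j + k = 2 * m" for a b :: real and j k m
  proof -
    let ?c = "max \<bar>a\<bar> \<bar>b\<bar>"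
    have "\<bar>a ^ j * b ^ k\<bar> = \<bar>a\<bar> ^ j * \<bar>b\<bar> ^ k" by (simp add: abs_mult power_abs)
    also have "\<dots> \<le> ?c ^ j * ?c ^ k" by (intro mult_mono power_mono) auto
    also have "\<dots> = ?c ^ (2 * m)" by (simp flip: power_add add: that)
    also have "\<dots> \<le> \<bar>a\<bar> ^ (2 * m) + \<bar>b\<bar> ^ (2 * m)" by (auto simp: max_def)
    finally show ?thesis by (simp add: power_mult)
  qed
  have ij: "integrable M (\<lambda>w. U w ^ j * V w ^ k)" if "j + k = 2 * m" for j k m
    by (rule Bochner_Integration.integrable_bound[OF Bochner_Integration.integrable_add[OF mU(1)[of m] mV(1)[of m]]])
       (use ge[OF that] in \<open>auto intro!: AE_I2 order_trans[OF _ abs_ge_self]\<close>)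
  show "integrable M (\<lambda>w. U w ^ 8 * V w ^ 8)" by (rule ij[of 8 8 8]) simp
  let ?u = "\<integral>w. U w ^ 2 \<partial>M" and ?v = "\<integral>w. V w ^ 2 \<partial>M" and ?r = "\<integral>w. U w * V w \<partial>M"
  define p where "p = (\<Sum>k\<le>16. monom (real (16 choose k) * (\<integral>w. U w ^ k * V w ^ (16 - k) \<partial>M)) (16 - k))"
  define q where "q = smult 2027025 ([:?u, 2 * ?r, ?v:] ^ 8)"
  have "poly p t = poly q t" for t
  proof -
    have iW: "(\<integral>w. U w + t * V w \<partial>M) = 0" using i mean by simp
    have "(\<integral>w. (U w + t * V w) ^ 2 \<partial>M) = (\<integral>w. U w ^ 2 * V w ^ 0 + 2 * t * (U w ^ 1 * V w ^ 1) + t^2 * (U w ^ 0 * V w ^ 2) \<partial>M)"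
      by (intro Bochner_Integration.integral_cong) (simp_all add: power2_eq_square algebra_simps)
    also have "\<dots> = (\<integral>w. U w ^ 2 * V w ^ 0 \<partial>M) + 2 * t * (\<integral>w. U w ^ 1 * V w ^ 1 \<partial>M) + t^2 * (\<integral>w. U w ^ 0 * V w ^ 2 \<partial>M)"
      using ij[of 2 0 1] ij[of 1 1 1] ij[of 0 2 1] by simp
    finally have var: "(\<integral>w. (U w + t * V w) ^ 2 \<partial>M) = ?u + 2 * t * ?r + t^2 * ?v" by simp
    have "(\<integral>w. (U w + t * V w) ^ (2 * 8) \<partial>M) = fact (2 * 8) / (2 ^ 8 * fact 8) * (?u + 2 * t * ?r + t^2 * ?v) ^ 8"
      using gaussian_rv_even_moment(2)[OF M g(1)[of t] iW, of 8] unfolding var .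
    also have "fact (2 * 8) / (2 ^ 8 * fact 8) = (2027025 :: real)" by (simp add: fact_numeral)
    also have "?u + 2 * t * ?r + t^2 * ?v = poly [:?u, 2 * ?r, ?v:] t"
      by (simp add: power2_eq_square algebra_simps)
    also have "2027025 * poly [:?u, 2 * ?r, ?v:] t ^ 8 = poly q t"
      by (simp only: q_def poly_smult poly_power)
    finally have 1: "(\<integral>w. (U w + t * V w) ^ 16 \<partial>M) = poly q t" by simp
    have "(\<integral>w. (U w + t * V w) ^ 16 \<partial>M) = (\<integral>w. (\<Sum>k\<le>16. real (16 choose k) * t ^ (16 - k) * (U w ^ k * V w ^ (16 - k))) \<partial>M)"
      by (intro Bochner_Integration.integral_cong refl, subst binomial_ring)
         (simp add: power_mult_distrib mult_ac)
    also have "\<dots> = (\<Sum>k\<le>16. real (16 choose k) * t ^ (16 - k) * (\<integral>w. U w ^ k * V w ^ (16 - k) \<partial>M))"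
    proof (subst Bochner_Integration.integral_sum)
      fix k :: nat assume "k \<in> {..16}"
      then show "integrable M (\<lambda>w. real (16 choose k) * t ^ (16 - k) * (U w ^ k * V w ^ (16 - k)))"
        using ij[of k "16 - k" 8] by simp
    qed simp
    also have "\<dots> = poly p t" by (simp add: p_def poly_sum poly_monom mult_ac)
    finally show ?thesis using 1 by simp
  qed
  then have "poly p = poly q" by (rule ext)
  then have "p = q" by (simp only: poly_eq_poly_eq_iff)
  then have "coeff p 8 = coeff q 8" by simp
  moreover have "coeff p 8 = 12870 * (\<integral>w. U w ^ 8 * V w ^ 8 \<partial>M)"
  proof -
    have "coeff p 8 = (\<Sum>k\<le>16. if k = 8 then real (16 choose k) * (\<integral>w. U w ^ k * V w ^ (16 - k) \<partial>M) else 0)"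
      unfolding p_def coeff_sum coeff_monom by (intro sum.cong refl) auto
    also have "\<dots> = real (16 choose 8) * (\<integral>w. U w ^ 8 * V w ^ 8 \<partial>M)"
      by (subst sum.delta) auto
    also have "(16 choose 8) = (12870::nat)" by (simp add: binomial_fact' fact_numeral)
    finally show ?thesis by simp
  qed
  moreover have "coeff q 8 = 12870 * moment88 ?u ?v ?r"
    by (simp add: q_def moment88_coeff)
  ultimately show "(\<integral>w. U w ^ 8 * V w ^ 8 \<partial>M) = moment88 ?u ?v ?r" by simp
qed

section \<open>Convergence in all moments\<close>

text \<open>The bound on \<open>X n\<close> may depend on \<open>n\<close>; it only serves to make all powers integrable, so that
  sums and products preserve the notion without side conditions.\<close>

definition Lconv :: "'a measure \<Rightarrow> (nat \<Rightarrow> 'a \<Rightarrow> real) \<Rightarrow> real \<Rightarrow> bool" where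
  "Lconv M X x \<longleftrightarrow> (\<forall>n. X n \<in> borel_measurable M \<and> (\<exists>B. \<forall>w\<in>space M. \<bar>X n w\<bar> \<le> B)) \<and>
     (\<forall>p. 0 < p \<longrightarrow> (\<lambda>n. \<integral>w. \<bar>X n w - x\<bar> ^ p \<partial>M) \<longlonglongrightarrow> 0)"

lemma Lconv_integrable:
  assumes "prob_space M" "Lconv M X x"
  shows "integrable M (\<lambda>w. X n w ^ p)" "integrable M (\<lambda>w. \<bar>X n w - x\<bar> ^ p)"
proof -
  interpret prob_space M by fact
  obtain B where B: "\<forall>w\<in>space M. \<bar>X n w\<bar> \<le> B" and [measurable]: "X n \<in> borel_measurable M"
    using assms(2) unfolding Lconv_def by blast
  show "integrable M (\<lambda>w. X n w ^ p)"
    by (rule integrable_const_bound[where B="B ^ p"]) (use B in \<open>auto intro!: AE_I2 power_mono simp: power_abs\<close>)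
  show "integrable M (\<lambda>w. \<bar>X n w - x\<bar> ^ p)"
  proof (rule integrable_const_bound[where B="(B + \<bar>x\<bar>) ^ p"])
    show "AE w in M. norm (\<bar>X n w - x\<bar> ^ p) \<le> (B + \<bar>x\<bar>) ^ p"
    proof (intro AE_I2)
      fix w assume "w \<in> space M"
      then have "\<bar>X n w - x\<bar> \<le> B + \<bar>x\<bar>" using B by fastforce
      then show "norm (\<bar>X n w - x\<bar> ^ p) \<le> (B + \<bar>x\<bar>) ^ p" by (simp add: power_mono)
    qed
  qed simp
qed

lemma LconvI:
  assumes "\<And>n. X n \<in> borel_measurable M" "\<And>n. \<exists>B. \<forall>w\<in>space M. \<bar>X n w\<bar> \<le> B"
    and "\<And>p. 0 < p \<Longrightarrow> \<exists>b. b \<longlonglongrightarrow> 0 \<and> (\<forall>\<^sub>F n in sequentially. (\<integral>w. \<bar>X n w - x\<bar> ^ p \<partial>M) \<le> b n)"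
  shows "Lconv M X x"
  unfolding Lconv_def
proof (intro conjI allI impI)
  fix p :: nat assume "0 < p"
  from assms(3)[OF this] obtain b where b: "b \<longlonglongrightarrow> 0" "\<forall>\<^sub>F n in sequentially. (\<integral>w. \<bar>X n w - x\<bar> ^ p \<partial>M) \<le> b n" by blast
  show "(\<lambda>n. \<integral>w. \<bar>X n w - x\<bar> ^ p \<partial>M) \<longlonglongrightarrow> 0"
    by (rule tendsto_sandwich[OF _ b(2) tendsto_const b(1)]) simp
qed (use assms in auto)

lemma Lconv_const:
  assumes "x \<longlonglongrightarrow> L" "prob_space M"
  shows "Lconv M (\<lambda>n w. x n) L"
proof (rule LconvI)
  interpret prob_space M by fact
  fix p :: nat assume p: "0 < p"
  have "(\<lambda>n. \<bar>x n - L\<bar> ^ p) \<longlonglongrightarrow> \<bar>L - L\<bar> ^ p"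
    by (intro tendsto_intros assms)
  then have "(\<lambda>n. \<bar>x n - L\<bar> ^ p) \<longlonglongrightarrow> 0"
    using p by (simp add: power_0_left del: tendsto_power_zero)
  then show "\<exists>b. b \<longlonglongrightarrow> 0 \<and> (\<forall>\<^sub>F n in sequentially. (\<integral>w. \<bar>x n - L\<bar> ^ p \<partial>M) \<le> b n)"
    by (intro exI[of _ "\<lambda>n. \<bar>x n - L\<bar> ^ p"]) (simp add: prob_space.prob_space[OF assms(2)])
qed auto

lemma Lconv_add:
  assumes M: "prob_space M" and X: "Lconv M X x" and Y: "Lconv M Y y"
  shows "Lconv M (\<lambda>n w. X n w + Y n w) (x + y)"
proof (rule LconvI)
  have mX: "X n \<in> borel_measurable M" and mY: "Y n \<in> borel_measurable M" for n
    using X Y by (auto simp: Lconv_def)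
  show "(\<lambda>w. X n w + Y n w) \<in> borel_measurable M" for n using mX mY by simp
  fix n
  obtain B C where "\<forall>w\<in>space M. \<bar>X n w\<bar> \<le> B" "\<forall>w\<in>space M. \<bar>Y n w\<bar> \<le> C"
    using X Y unfolding Lconv_def by metis
  then show "\<exists>B. \<forall>w\<in>space M. \<bar>X n w + Y n w\<bar> \<le> B"
    by (intro exI[of _ "B + C"]) (auto intro: order_trans[OF abs_triangle_ineq add_mono])
next
  fix p :: nat assume p: "0 < p"
  note i = Lconv_integrable(2)[OF M X] Lconv_integrable(2)[OF M Y]
  let ?b = "\<lambda>n. 2 ^ p * ((\<integral>w. \<bar>X n w - x\<bar> ^ p \<partial>M) + (\<integral>w. \<bar>Y n w - y\<bar> ^ p \<partial>M))"
  have "?b \<longlonglongrightarrow> 2 ^ p * (0 + 0)"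
    using X Y p unfolding Lconv_def by (intro tendsto_intros) auto
  moreover have "(\<integral>w. \<bar>X n w + Y n w - (x + y)\<bar> ^ p \<partial>M) \<le> ?b n" for n
  proof -
    have "(\<integral>w. \<bar>X n w + Y n w - (x + y)\<bar> ^ p \<partial>M) \<le> (\<integral>w. 2 ^ p * (\<bar>X n w - x\<bar> ^ p + \<bar>Y n w - y\<bar> ^ p) \<partial>M)"
    proof (rule integral_mono_AE')
      show "AE w in M. \<bar>X n w + Y n w - (x + y)\<bar> ^ p \<le> 2 ^ p * (\<bar>X n w - x\<bar> ^ p + \<bar>Y n w - y\<bar> ^ p)"
      proof (intro AE_I2)
        fix w
        have "\<bar>X n w + Y n w - (x + y)\<bar> ^ p \<le> (\<bar>X n w - x\<bar> + \<bar>Y n w - y\<bar>) ^ p"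
          by (rule power_mono) auto
        also have "\<dots> \<le> 2 ^ p * (\<bar>X n w - x\<bar> ^ p + \<bar>Y n w - y\<bar> ^ p)" by (rule power_add_le) auto
        finally show "\<bar>X n w + Y n w - (x + y)\<bar> ^ p \<le> \<dots>" .
      qed
    qed (use i in auto)
    also have "\<dots> = ?b n" using i by simp
    finally show ?thesis .
  qed
  ultimately show "\<exists>b. b \<longlonglongrightarrow> 0 \<and> (\<forall>\<^sub>F n in sequentially. (\<integral>w. \<bar>X n w + Y n w - (x + y)\<bar> ^ p \<partial>M) \<le> b n)"
    by (intro exI[of _ ?b]) simp
qed

text \<open>The p-th moment of a product is bounded by the 2p-th moments of the factors. The
  exponent doubles, which is why \<open>Lconv\<close> asks for all moments at once.\<close>

lemma Lconv_mult_null: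
  assumes M: "prob_space M" and X: "Lconv M X 0" and Y: "Lconv M Y 0"
  shows "Lconv M (\<lambda>n w. X n w * Y n w) 0"
proof (rule LconvI)
  have mX: "X n \<in> borel_measurable M" and mY: "Y n \<in> borel_measurable M" for n
    using X Y by (auto simp: Lconv_def)
  show "(\<lambda>w. X n w * Y n w) \<in> borel_measurable M" for n using mX mY by simp
  fix n
  obtain B C where BC: "\<forall>w\<in>space M. \<bar>X n w\<bar> \<le> B" "\<forall>w\<in>space M. \<bar>Y n w\<bar> \<le> C"
    using X Y unfolding Lconv_def by metis
  show "\<exists>B. \<forall>w\<in>space M. \<bar>X n w * Y n w\<bar> \<le> B"
  proof (intro exI[of _ "\<bar>B\<bar> * \<bar>C\<bar>"] ballI)
    fix w assume "w \<in> space M"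
    then show "\<bar>X n w * Y n w\<bar> \<le> \<bar>B\<bar> * \<bar>C\<bar>"
      unfolding abs_mult using BC by (intro mult_mono) (auto intro: order_trans)
  qed
next
  fix p :: nat assume p: "0 < p"
  have i: "integrable M (\<lambda>w. \<bar>X n w\<bar> ^ q)" "integrable M (\<lambda>w. \<bar>Y n w\<bar> ^ q)" for n q
    using Lconv_integrable(2)[OF M X, of n q] Lconv_integrable(2)[OF M Y, of n q] by auto
  let ?b = "\<lambda>n. (\<integral>w. \<bar>X n w\<bar> ^ (2 * p) \<partial>M) + (\<integral>w. \<bar>Y n w\<bar> ^ (2 * p) \<partial>M)"
  have "?b \<longlonglongrightarrow> (0 + 0)"
    using X Y p unfolding Lconv_def by (intro tendsto_intros) auto
  moreover have "(\<integral>w. \<bar>X n w * Y n w - 0\<bar> ^ p \<partial>M) \<le> ?b n" for n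
  proof -
    have "(\<integral>w. \<bar>X n w * Y n w - 0\<bar> ^ p \<partial>M) \<le> (\<integral>w. \<bar>X n w\<bar> ^ (2 * p) + \<bar>Y n w\<bar> ^ (2 * p) \<partial>M)"
    proof (rule integral_mono_AE')
      show "AE w in M. \<bar>X n w * Y n w - 0\<bar> ^ p \<le> \<bar>X n w\<bar> ^ (2 * p) + \<bar>Y n w\<bar> ^ (2 * p)"
      proof (intro AE_I2)
        fix w
        let ?a = "\<bar>X n w\<bar> ^ p" and ?c = "\<bar>Y n w\<bar> ^ p"
        have "0 \<le> (?a - ?c)\<^sup>2" by simp
        then have "2 * (?a * ?c) \<le> ?a\<^sup>2 + ?c\<^sup>2" by (simp add: power2_diff)
        moreover have "0 \<le> ?a * ?c" by simp
        ultimately have "?a * ?c \<le> ?a\<^sup>2 + ?c\<^sup>2" by linarith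
        then show "\<bar>X n w * Y n w - 0\<bar> ^ p \<le> \<bar>X n w\<bar> ^ (2 * p) + \<bar>Y n w\<bar> ^ (2 * p)"
          by (simp add: abs_mult power_mult_distrib mult.commute[of 2 p] power_mult)
      qed
    qed (use i in \<open>auto simp del: power_even_abs\<close>)
    also have "\<dots> = ?b n" using i[of n "2 * p"] by (rule Bochner_Integration.integral_add)
    finally show ?thesis .
  qed
  ultimately show "\<exists>b. b \<longlonglongrightarrow> 0 \<and> (\<forall>\<^sub>F n in sequentially. (\<integral>w. \<bar>X n w * Y n w - 0\<bar> ^ p \<partial>M) \<le> b n)"
    by (intro exI[of _ ?b]) simp
qed

lemma Lconv_cmult:
  assumes M: "prob_space M" and X: "Lconv M X x"
  shows "Lconv M (\<lambda>n w. k * X n w) (k * x)"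
proof (rule LconvI)
  have mX: "X n \<in> borel_measurable M" for n using X by (auto simp: Lconv_def)
  then show "(\<lambda>w. k * X n w) \<in> borel_measurable M" for n by simp
  fix n
  obtain B where B: "\<forall>w\<in>space M. \<bar>X n w\<bar> \<le> B" using X unfolding Lconv_def by metis
  show "\<exists>B. \<forall>w\<in>space M. \<bar>k * X n w\<bar> \<le> B"
    by (rule exI[of _ "\<bar>k\<bar> * B"]) (use B in \<open>auto simp: abs_mult mult_left_mono\<close>)
next
  fix p :: nat assume p: "0 < p"
  have "(\<lambda>n. \<bar>k\<bar> ^ p * (\<integral>w. \<bar>X n w - x\<bar> ^ p \<partial>M)) \<longlonglongrightarrow> \<bar>k\<bar> ^ p * 0"
    using X p unfolding Lconv_def by (intro tendsto_intros) auto
  moreover have "\<bar>k * X n w - k * x\<bar> ^ p = \<bar>k\<bar> ^ p * \<bar>X n w - x\<bar> ^ p" for n w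
  proof -
    have "k * X n w - k * x = k * (X n w - x)" by (simp add: right_diff_distrib)
    then show ?thesis by (simp only: abs_mult power_mult_distrib)
  qed
  ultimately show "\<exists>b. b \<longlonglongrightarrow> 0 \<and> (\<forall>\<^sub>F n in sequentially. (\<integral>w. \<bar>k * X n w - k * x\<bar> ^ p \<partial>M) \<le> b n)"
    by (intro exI[of _ "\<lambda>n. \<bar>k\<bar> ^ p * (\<integral>w. \<bar>X n w - x\<bar> ^ p \<partial>M)"]) simp
qed

lemma Lconv_mult:
  assumes M: "prob_space M" and X: "Lconv M X x" and Y: "Lconv M Y y"
  shows "Lconv M (\<lambda>n w. X n w * Y n w) (x * y)"
proof -
  have c: "Lconv M (\<lambda>n w. a) a" for a by (rule Lconv_const[OF tendsto_const M])
  have X0: "Lconv M (\<lambda>n w. X n w + (- x)) 0" using Lconv_add[OF M X c[of "- x"]] by simp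
  have Y0: "Lconv M (\<lambda>n w. Y n w + (- y)) 0" using Lconv_add[OF M Y c[of "- y"]] by simp
  \<comment> \<open>The product is expanded around the limits: one product of null sequences plus
    terms that are linear in X and Y.\<close>
  have "Lconv M (\<lambda>n w. (X n w + (- x)) * (Y n w + (- y)) + (y * X n w + (x * Y n w + (- (x * y))))) (0 + (y * x + (x * y + (- (x * y)))))"
    by (intro Lconv_add M Lconv_mult_null X0 Y0 Lconv_cmult X Y c)
  moreover have "(X n w + (- x)) * (Y n w + (- y)) + (y * X n w + (x * Y n w + (- (x * y)))) = X n w * Y n w" for n w
    by (simp add: algebra_simps)
  ultimately show ?thesis by (simp add: mult.commute[of y x])
qed

lemma Lconv_power:
  assumes M: "prob_space M" and X: "Lconv M X x"
  shows "Lconv M (\<lambda>n w. X n w ^ k) (x ^ k)"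
proof (induction k)
  case 0
  show ?case using Lconv_const[OF tendsto_const M, of 1] by simp
next
  case (Suc k)
  from Lconv_mult[OF M X Suc] show ?case by simp
qed

lemma Lconv_integral:
  assumes M: "prob_space M" and X: "Lconv M X x"
  shows "(\<lambda>n. \<integral>w. X n w \<partial>M) \<longlonglongrightarrow> x"
proof -
  interpret prob_space M by fact
  have iX: "integrable M (X n)" for n using Lconv_integrable(1)[OF M X, of n 1] by simp
  have "(\<lambda>n. (\<integral>w. X n w \<partial>M) - x) \<longlonglongrightarrow> 0"
  proof (rule Lim_null_comparison)
    show "(\<lambda>n. \<integral>w. \<bar>X n w - x\<bar> ^ 1 \<partial>M) \<longlonglongrightarrow> 0"
      using X unfolding Lconv_def by (elim conjE allE[of _ "1::nat"]) simp
    show "\<forall>\<^sub>F n in sequentially. norm ((\<integral>w. X n w \<partial>M) - x) \<le> (\<integral>w. \<bar>X n w - x\<bar> ^ 1 \<partial>M)"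
    proof (intro always_eventually allI)
      fix n
      have "(\<integral>w. X n w \<partial>M) - x = (\<integral>w. X n w - x \<partial>M)" using iX by (simp add: prob_space)
      also have "\<bar>\<dots>\<bar> \<le> (\<integral>w. \<bar>X n w - x\<bar> \<partial>M)" by (rule integral_abs_bound)
      finally show "norm ((\<integral>w. X n w \<partial>M) - x) \<le> (\<integral>w. \<bar>X n w - x\<bar> ^ 1 \<partial>M)" by simp
    qed
  qed
  then show ?thesis by (simp add: LIM_zero_iff)
qed

text \<open>With vanishing covariance the moment factorises: 11025 = 105^2, and 105 is the eighth
  moment of the standard normal law.\<close>

lemma Lconv_moment88:
  assumes M: "prob_space M" and U: "Lconv M U u" and V: "Lconv M V v" and R: "Lconv M R 0"
  shows "(\<lambda>n. \<integral>w. moment88 (U n w) (V n w) (R n w) \<partial>M) \<longlonglongrightarrow> 11025 * u ^ 4 * v ^ 4"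
proof -
  have "Lconv M (\<lambda>n w. moment88 (U n w) (V n w) (R n w)) (moment88 u v 0)"
    unfolding moment88_def
    by (intro Lconv_cmult Lconv_add Lconv_mult Lconv_power M U V R Lconv_const[OF tendsto_const M])
  moreover have "moment88 u v 0 = 11025 * u ^ 4 * v ^ 4" by (simp add: moment88_def)
  ultimately show ?thesis using Lconv_integral[OF M] by metis
qed

section \<open>Kernel estimates\<close>

definition vec2 :: "real \<times> real \<Rightarrow> real^2" where
  "vec2 p = (\<chi> i. if i = 1 then fst p else snd p)"

lemma vec2_nth [simp]: "vec2 p $ 1 = fst p" "vec2 p $ 2 = snd p"
  by (simp_all add: vec2_def)

lemma measurable_vec2 [measurable]: "vec2 \<in> borel \<rightarrow>\<^sub>M borel"
proof -
  have "vec2 = (\<lambda>p. fst p *\<^sub>R axis 1 1 + snd p *\<^sub>R axis 2 1)"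
    by (auto simp: fun_eq_iff vec_eq_iff forall_2 axis_def vec2_def)
  moreover have "(\<lambda>p. fst p *\<^sub>R axis 1 1 + snd p *\<^sub>R axis 2 1 :: real^2) \<in> borel_measurable borel"
    by (intro borel_measurable_continuous_onI continuous_intros)
  ultimately show ?thesis by simp
qed

lemma measurable_nth [measurable]: "(\<lambda>x::real^2. x $ i) \<in> borel_measurable borel"
  by (intro borel_measurable_continuous_onI continuous_intros)

lemma lborel_eq_distr_vec2: "(lborel :: (real^2) measure) = distr (lborel \<Otimes>\<^sub>M lborel) borel vec2"
proof (rule lborel_eqI)
  fix l u :: "real^2"
  assume le: "\<And>b. b \<in> Basis \<Longrightarrow> l \<bullet> b \<le> u \<bullet> b"
  have le': "l $ i \<le> u $ i" for i
    using le[of "axis i 1"] by (auto simp: Basis_vec_def inner_axis)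
  have [measurable]: "vec2 \<in> lborel \<Otimes>\<^sub>M lborel \<rightarrow>\<^sub>M borel"
    using measurable_vec2 by (simp add: borel_prod[symmetric])
  have pre: "vec2 -` box l u \<inter> space (lborel \<Otimes>\<^sub>M lborel) = {l$1<..<u$1} \<times> {l$2<..<u$2}"
    by (auto simp: mem_box_cart forall_2 space_pair_measure)
  have "emeasure (distr (lborel \<Otimes>\<^sub>M lborel) borel vec2) (box l u) = ennreal (u$1 - l$1) * ennreal (u$2 - l$2)"
    using le' by (simp add: emeasure_distr pre lborel.emeasure_pair_measure_Times)
  also have "\<dots> = ennreal (\<Prod>b\<in>Basis. (u - l) \<bullet> b)"
  proof -
    have B: "(Basis :: (real^2) set) = {axis 1 1, axis 2 1}"
      by (auto simp: Basis_vec_def) (metis exhaust_2)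
    have "axis 1 1 \<noteq> (axis 2 1 :: real^2)" by (simp add: axis_eq_axis)
    then show ?thesis unfolding B using le' by (simp add: inner_axis ennreal_mult[symmetric])
  qed
  finally show "emeasure (distr (lborel \<Otimes>\<^sub>M lborel) borel vec2) (box l u) = (\<Prod>b\<in>Basis. (u - l) \<bullet> b)" .
qed simp

text \<open>Transport along \<open>vec2\<close> reduces functions of product form to Fubini's
  theorem; tapers and decay bounds all have this form.\<close>

lemma
  fixes F G :: "real \<Rightarrow> real"
  assumes F: "integrable lborel F" and G: "integrable lborel G"
  shows integrable_prod2: "integrable lborel (\<lambda>x::real^2. F (x$1) * G (x$2))"
    and integral_prod2: "(\<integral>x. F (x$1) * G (x$2) \<partial>(lborel :: (real^2) measure)) = (\<integral>t. F t \<partial>lborel) * (\<integral>t. G t \<partial>lborel)"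
proof -
  note [measurable] = borel_measurable_integrable[OF F] borel_measurable_integrable[OF G]
  have [measurable]: "vec2 \<in> lborel \<Otimes>\<^sub>M lborel \<rightarrow>\<^sub>M borel"
    using measurable_vec2 by (simp add: borel_prod[symmetric])
  have i: "integrable (lborel \<Otimes>\<^sub>M lborel) (\<lambda>p. F (fst p) * G (snd p))"
  proof (rule lborel_pair.Fubini_integrable)
    have "(\<lambda>x. \<integral>y. norm (F (fst (x, y)) * G (snd (x, y))) \<partial>lborel) = (\<lambda>x. \<bar>F x\<bar> * (\<integral>y. \<bar>G y\<bar> \<partial>lborel))"
      by (simp add: abs_mult)
    then show "integrable lborel (\<lambda>x. \<integral>y. norm (F (fst (x, y)) * G (snd (x, y))) \<partial>lborel)"
      using F by simp
  qed (use G in auto)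
  show "integrable lborel (\<lambda>x::real^2. F (x$1) * G (x$2))"
    unfolding lborel_eq_distr_vec2 by (subst integrable_distr_eq) (use i in auto)
  have "(\<integral>x. F (x$1) * G (x$2) \<partial>(lborel :: (real^2) measure)) = (\<integral>p. F (fst p) * G (snd p) \<partial>(lborel \<Otimes>\<^sub>M lborel))"
    unfolding lborel_eq_distr_vec2 by (subst integral_distr) auto
  also have "\<dots> = (\<integral>x. \<integral>y. F x * G y \<partial>lborel \<partial>lborel)"
    using lborel_pair.integral_fst'[OF i] by simp
  also have "\<dots> = (\<integral>t. F t \<partial>lborel) * (\<integral>t. G t \<partial>lborel)" by simp
  finally show "(\<integral>x. F (x$1) * G (x$2) \<partial>(lborel :: (real^2) measure)) = (\<integral>t. F t \<partial>lborel) * (\<integral>t. G t \<partial>lborel)" .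
qed

section \<open>The decay profile 1/(1 + |y|)\<close>

definition phi :: "real \<Rightarrow> real" where "phi y = 1 / (1 + \<bar>y\<bar>)"

lemma phi_pos: "0 < phi y" and phi_le1: "phi y \<le> 1"
  by (simp_all add: phi_def)

lemma measurable_phi [measurable]: "phi \<in> borel_measurable borel"
  unfolding phi_def[abs_def] by measurable

text \<open>Submultiplicativity of the weight 1 + |y|, combined with |z| \<le> |x| + |x +
  z|.\<close>

lemma phi_add_le: "phi x * phi (x + z) \<le> phi z"
proof -
  have "1 + \<bar>z\<bar> \<le> (1 + \<bar>x\<bar>) * (1 + \<bar>x + z\<bar>)"
  proof -
    have "0 \<le> \<bar>x\<bar> * \<bar>x + z\<bar>" by simp
    moreover have "\<bar>z\<bar> \<le> \<bar>x\<bar> + \<bar>x + z\<bar>" by linarith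
    moreover have "(1 + \<bar>x\<bar>) * (1 + \<bar>x + z\<bar>) = 1 + \<bar>x\<bar> + \<bar>x + z\<bar> + \<bar>x\<bar> * \<bar>x + z\<bar>"
      by (simp add: algebra_simps)
    ultimately show ?thesis by linarith
  qed
  then have "1 / ((1 + \<bar>x\<bar>) * (1 + \<bar>x + z\<bar>)) \<le> 1 / (1 + \<bar>z\<bar>)"
    by (intro divide_left_mono) (auto intro!: mult_pos_pos add_pos_nonneg)
  then show ?thesis by (simp add: phi_def)
qed

lemma phi_shift_le: "\<bar>z\<bar> \<le> r \<Longrightarrow> phi (x + z) \<le> (1 + r) * phi x"
proof -
  assume z: "\<bar>z\<bar> \<le> r"
  have "phi (x + z) * phi z \<le> phi x" using phi_add_le[of z x] by (simp add: mult.commute add.commute)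
  moreover have "phi (x + z) = (1 + \<bar>z\<bar>) * (phi (x + z) * phi z)" by (simp add: phi_def)
  ultimately have "phi (x + z) \<le> (1 + \<bar>z\<bar>) * phi x" by (metis abs_ge_zero add_nonneg_nonneg mult_left_mono zero_le_one)
  also have "\<dots> \<le> (1 + r) * phi x" using z phi_pos[of x] by (intro mult_right_mono) auto
  finally show ?thesis .
qed

text \<open>The profile itself is not integrable, so exponents above 1 have to be tracked
  throughout. On the half line the antiderivative is explicit, and the other half follows by
  reflection.\<close>

lemma integrable_phi_powr:
  assumes "1 < s"
  shows "integrable lborel (\<lambda>y. phi y powr s)"
proof -
  let ?f = "\<lambda>x::real. (1 + x) powr (- s)"
  let ?F = "\<lambda>x::real. (1 + x) powr (1 - s) / (1 - s)"
  let ?g = "\<lambda>x. ?f x * indicator {0..} x"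
  have [measurable]: "?g \<in> borel_measurable borel" by measurable
  have "(\<integral>\<^sup>+x. ennreal (?f x) * indicator {0..} x \<partial>lborel) = 0 - ?F 0"
  proof (rule nn_integral_FTC_atLeast)
    fix x :: real assume x: "0 \<le> x"
    show "DERIV ?F x :> ?f x" using x assms by (auto intro!: derivative_eq_intros)
    show "0 \<le> ?f x" by simp
  next
    have "((\<lambda>x::real. (1 + x) powr (1 - s)) \<longlongrightarrow> 0) at_top"
      by (rule tendsto_neg_powr) (use assms in \<open>auto intro!: filterlim_tendsto_add_at_top[OF tendsto_const filterlim_ident]\<close>)
    then show "(?F \<longlongrightarrow> 0) at_top" by (rule tendsto_divide_zero)
  qed measurable
  then have "(\<integral>\<^sup>+x. ennreal (norm (?g x)) \<partial>lborel) < \<infinity>"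
    by (simp add: ennreal_mult' ennreal_indicator[symmetric] abs_mult split: split_indicator)
  then have g: "integrable lborel ?g" by (auto simp: integrable_iff_bounded)
  have g': "integrable lborel (\<lambda>x. ?g (- x))"
    using lborel_integrable_real_affine[OF g, of "-1" 0] by simp
  show ?thesis
  proof (rule Bochner_Integration.integrable_bound[OF Bochner_Integration.integrable_add[OF g g']])
    show "AE y in lborel. norm (phi y powr s) \<le> norm (?g y + ?g (- y))"
    proof (intro AE_I2)
      fix y :: real
      have "phi y powr s = (1 + \<bar>y\<bar>) powr (- s)" by (simp add: phi_def powr_minus powr_divide field_simps)
      also have "\<dots> \<le> ?g y + ?g (- y)" by (cases "0 \<le> y") (auto split: split_indicator)
      finally show "norm (phi y powr s) \<le> norm (?g y + ?g (- y))" by simp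
    qed
  qed measurable
qed

lemma integrable_phi2: "integrable lborel (\<lambda>y. phi y ^ 2)"
proof -
  have "phi y powr 2 = phi y ^ 2" for y using powr_realpow[OF phi_pos, of y 2] by simp
  then show ?thesis using integrable_phi_powr[of 2] by simp
qed

definition phi2int :: real where "phi2int = (\<integral>y. phi y ^ 2 \<partial>lborel)"

lemma phi2int_nonneg: "0 \<le> phi2int" by (simp add: phi2int_def)

lemma
  assumes "l > 0"
  shows integrable_phi2_scaled: "integrable lborel (\<lambda>x. l * phi (l * (x - w)) ^ 2)"
    and integral_phi2_scaled: "(\<integral>x. l * phi (l * (x - w)) ^ 2 \<partial>lborel) = phi2int"
proof -
  have eq: "- (l * w) + l * x = l * (x - w)" for x by (simp add: algebra_simps)
  show "integrable lborel (\<lambda>x. l * phi (l * (x - w)) ^ 2)"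
    using lborel_integrable_real_affine[OF integrable_phi2, of l "- (l * w)"] assms unfolding eq by simp
  show "(\<integral>x. l * phi (l * (x - w)) ^ 2 \<partial>lborel) = phi2int"
    unfolding phi2int_def
    using lborel_integral_real_affine[of l "\<lambda>y. phi y ^ 2" "- (l * w)"] assms unfolding eq by simp
qed

text \<open>The kernel l phi(l(x - w))^2 acts as an approximate identity, and convolution with it
  has to preserve the decay phi^2. If w is not much larger than x, the first factor already decays
  in w. Otherwise x - w is comparable to w, and for l \<ge> 1 the kernel itself is of order
  phi(w)^2.\<close>

lemma phi_conv_pointwise:
  assumes l: "l \<ge> 1"
  shows "phi x ^ 2 * (l * phi (l * (x - w)) ^ 2) \<le> 16 * phi w ^ 2 * (l * phi (l * (x - w)) ^ 2 + phi x ^ 2)"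
proof (cases "\<bar>w\<bar> \<le> 2 * \<bar>x\<bar> + 1")
  case True
  have "phi x \<le> 2 * phi w" using True by (simp add: phi_def field_simps)
  then have "phi x ^ 2 \<le> (2 * phi w) ^ 2" using phi_pos[of x] by (intro power_mono) auto
  also have "\<dots> \<le> 16 * phi w ^ 2" by (simp add: power_mult_distrib)
  finally have "phi x ^ 2 * (l * phi (l * (x - w)) ^ 2) \<le> 16 * phi w ^ 2 * (l * phi (l * (x - w)) ^ 2)"
    using l by (intro mult_right_mono) auto
  also have "\<dots> \<le> 16 * phi w ^ 2 * (l * phi (l * (x - w)) ^ 2 + phi x ^ 2)"
    by (intro mult_left_mono) auto
  finally show ?thesis .
next
  case False
  let ?d = "\<bar>x - w\<bar>"
  have "\<bar>w\<bar> \<le> ?d + \<bar>x\<bar>" by linarith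
  moreover have "1 + a \<le> 4 * d \<and> 0 < d" if "a \<le> d + b" "\<not> a \<le> 2 * b + 1" "0 \<le> a" "0 \<le> b" for a b d :: real
    using that by linarith
  ultimately have d: "1 + \<bar>w\<bar> \<le> 4 * ?d" "0 < ?d" using False by (meson abs_ge_zero)+
  have "l * phi (l * (x - w)) ^ 2 = l / (1 + l * ?d) ^ 2" using l by (simp add: phi_def abs_mult power_divide)
  also have "\<dots> \<le> l / (l * ?d) ^ 2"
    using l d by (intro divide_left_mono power_mono mult_pos_pos zero_less_power add_pos_nonneg) auto
  also have "\<dots> = 1 / (l * ?d ^ 2)" using l by (simp add: power2_eq_square)
  also have "\<dots> \<le> 1 / ?d ^ 2" using l d by (intro divide_left_mono) (auto simp: mult_le_cancel_right1)
  also have "\<dots> = 16 / (4 * ?d) ^ 2" by (simp add: power_mult_distrib)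
  also have "\<dots> \<le> 16 / (1 + \<bar>w\<bar>) ^ 2" using d by (intro divide_left_mono power_mono) auto
  also have "\<dots> = 16 * phi w ^ 2" by (simp add: phi_def power_divide)
  finally have "l * phi (l * (x - w)) ^ 2 \<le> 16 * phi w ^ 2" .
  then have "phi x ^ 2 * (l * phi (l * (x - w)) ^ 2) \<le> phi x ^ 2 * (16 * phi w ^ 2)"
    by (intro mult_left_mono) auto
  also have "\<dots> \<le> 16 * phi w ^ 2 * (l * phi (l * (x - w)) ^ 2 + phi x ^ 2)"
    using l by (simp add: algebra_simps)
  finally show ?thesis .
qed

lemma
  assumes l: "l \<ge> 1"
  shows integrable_phi_conv: "integrable lborel (\<lambda>x. phi x ^ 2 * (l * phi (l * (x - w)) ^ 2))"
    and integral_phi_conv: "(\<integral>x. phi x ^ 2 * (l * phi (l * (x - w)) ^ 2) \<partial>lborel) \<le> 32 * phi2int * phi w ^ 2"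
proof -
  have l0: "l > 0" using l by simp
  note i = integrable_phi2_scaled[OF l0, of w] integrable_phi2
  have i2: "integrable lborel (\<lambda>x. 16 * phi w ^ 2 * (l * phi (l * (x - w)) ^ 2 + phi x ^ 2))"
    using i by simp
  show int: "integrable lborel (\<lambda>x. phi x ^ 2 * (l * phi (l * (x - w)) ^ 2))"
    by (rule Bochner_Integration.integrable_bound[OF i2])
       (use phi_conv_pointwise[OF l, of _ w] l in \<open>auto intro!: AE_I2 order_trans[OF _ abs_ge_self]\<close>)
  have "(\<integral>x. phi x ^ 2 * (l * phi (l * (x - w)) ^ 2) \<partial>lborel) \<le> (\<integral>x. 16 * phi w ^ 2 * (l * phi (l * (x - w)) ^ 2 + phi x ^ 2) \<partial>lborel)"
    by (rule integral_mono[OF int i2 phi_conv_pointwise[OF l]])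
  also have "\<dots> = 16 * phi w ^ 2 * (phi2int + phi2int)"
    using i integral_phi2_scaled[OF l0, of w] by (simp add: phi2int_def)
  finally show "(\<integral>x. phi x ^ 2 * (l * phi (l * (x - w)) ^ 2) \<partial>lborel) \<le> 32 * phi2int * phi w ^ 2"
    by (simp add: algebra_simps)
qed

text \<open>The product A is split as A^(1/4) A^(3/4). The first factor becomes decay in the
  separation z; the second is at most the larger value to the power 3/2, which is still integrable
  because 3/2 > 1.\<close>

lemma phi_mult_shift_le:
  "phi y * phi (y + z) \<le> phi z powr (1/4) * (phi y powr (3/2) + phi (y + z) powr (3/2))"
proof -
  let ?A = "phi y * phi (y + z)" and ?m = "max (phi y) (phi (y + z))"
  have A: "0 < ?A" using phi_pos by simp
  have m: "0 < ?m" using phi_pos[of y] by (simp add: max_def)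
  have "?A = ?A powr (1/4 + 3/4)" using A by simp
  also have "\<dots> = ?A powr (1/4) * ?A powr (3/4)" by (rule powr_add)
  also have "\<dots> \<le> phi z powr (1/4) * ?m powr (3/2)"
  proof (rule mult_mono)
    show "?A powr (1/4) \<le> phi z powr (1/4)" by (rule powr_mono2) (use A phi_add_le in auto)
    have "?A powr (3/4) \<le> (?m * ?m) powr (3/4)"
      using A phi_pos by (intro powr_mono2 mult_mono) (auto simp: less_imp_le le_max_iff_disj)
    also have "\<dots> = ?m powr (3/4 + 3/4)" using m by (simp only: powr_add powr_mult)
    finally show "?A powr (3/4) \<le> ?m powr (3/2)" by simp
  qed auto
  also have "?m powr (3/2) \<le> phi y powr (3/2) + phi (y + z) powr (3/2)" by (auto simp: max_def)
  finally show ?thesis by (simp add: mult_left_mono)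
qed

definition phi32int :: real where "phi32int = (\<integral>y. phi y powr (3/2) \<partial>lborel)"

lemma phi32int_nonneg: "0 \<le> phi32int" by (simp add: phi32int_def)

text \<open>Two kernels centred at w and v interact less and less as l |w - v| grows; this is what
  decorrelates distinct frequencies.\<close>

lemma
  assumes l: "l > 0"
  shows integrable_phi_cross: "integrable lborel (\<lambda>x. l * (phi (l * (x - w)) * phi (l * (x - v))))"
    and integral_phi_cross: "(\<integral>x. l * (phi (l * (x - w)) * phi (l * (x - v))) \<partial>lborel) \<le> 2 * phi32int * phi (l * (w - v)) powr (1/4)"
proof -
  have eq: "- (l * u) + l * x = l * (x - u)" for x u by (simp add: algebra_simps)
  have i: "integrable lborel (\<lambda>x. phi (l * (x - u)) powr (3/2))" for u
    using lborel_integrable_real_affine[OF integrable_phi_powr[of "3/2"], of l "- (l * u)"] l unfolding eq by simp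
  have I: "l * (\<integral>x. phi (l * (x - u)) powr (3/2) \<partial>lborel) = phi32int" for u
    unfolding phi32int_def
    using lborel_integral_real_affine[of l "\<lambda>y. phi y powr (3/2)" "- (l * u)"] l unfolding eq by simp
  let ?R = "\<lambda>x. l * (phi (l * (w - v)) powr (1/4) * (phi (l * (x - w)) powr (3/2) + phi (l * (x - v)) powr (3/2)))"
  have le: "l * (phi (l * (x - w)) * phi (l * (x - v))) \<le> ?R x" for x
  proof -
    have "l * (x - w) + l * (w - v) = l * (x - v)" by (simp add: algebra_simps)
    then show ?thesis using phi_mult_shift_le[of "l * (x - w)" "l * (w - v)"] l by (intro mult_left_mono) auto
  qed
  have i2: "integrable lborel ?R" using i by simp
  have pos: "0 \<le> l * (phi (l * (x - w)) * phi (l * (x - v)))" for x using l phi_pos by (simp add: less_imp_le)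
  show int: "integrable lborel (\<lambda>x. l * (phi (l * (x - w)) * phi (l * (x - v))))"
  proof (rule Bochner_Integration.integrable_bound[OF i2])
    show "AE x in lborel. norm (l * (phi (l * (x - w)) * phi (l * (x - v)))) \<le> norm (?R x)"
      using le pos by (intro AE_I2) (metis abs_of_nonneg order_trans real_norm_def)
  qed measurable
  have "(\<integral>x. l * (phi (l * (x - w)) * phi (l * (x - v))) \<partial>lborel) \<le> (\<integral>x. ?R x \<partial>lborel)"
    by (rule integral_mono[OF int i2 le])
  also have "\<dots> = l * (phi (l * (w - v)) powr (1/4) * ((\<integral>x. phi (l * (x - w)) powr (3/2) \<partial>lborel) + (\<integral>x. phi (l * (x - v)) powr (3/2) \<partial>lborel)))"
    using i by simp
  also have "\<dots> = phi (l * (w - v)) powr (1/4) * (l * (\<integral>x. phi (l * (x - w)) powr (3/2) \<partial>lborel) + l * (\<integral>x. phi (l * (x - v)) powr (3/2) \<partial>lborel))"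
    by (simp add: algebra_simps)
  also have "\<dots> = 2 * phi32int * phi (l * (w - v)) powr (1/4)"
    unfolding I by simp
  finally show "(\<integral>x. l * (phi (l * (x - w)) * phi (l * (x - v))) \<partial>lborel) \<le> 2 * phi32int * phi (l * (w - v)) powr (1/4)" .
qed

section \<open>Cosine transforms of smooth functions of compact support\<close>

text \<open>Integration by parts: one derivative of \<open>g\<close> buys one order of decay.\<close>

lemma cosine_transform_decay:
  fixes g g' :: "real \<Rightarrow> real"
  assumes d: "\<And>x. (g has_real_derivative g' x) (at x)" and c: "continuous_on UNIV g'"
    and supp: "\<And>x. x \<notin> {-1/2..1/2} \<Longrightarrow> g x = 0"
  shows "\<exists>K\<ge>0. \<forall>y. \<bar>\<integral>u. g u * cos (y * u) \<partial>lborel\<bar> \<le> K * phi y"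
proof -
  have cg: "continuous_on UNIV g"
    using d by (meson DERIV_continuous_on has_field_derivative_at_within)
  have supp': "g x * k = g x * k * indicator {-1..1} x" for x k
    using supp[of x] by (auto split: split_indicator)
  have [measurable]: "g \<in> borel_measurable borel" "g' \<in> borel_measurable borel"
    using cg c by (auto intro: borel_measurable_continuous_onI)
  have ib: "integrable lborel (\<lambda>u. f u * indicator {-1..1} u)" if "continuous_on UNIV f" for f :: "real \<Rightarrow> real"
  proof -
    have "continuous_on {-1..1} f" using that continuous_on_subset by blast
    from borel_integrable_compact[OF _ this] show ?thesis
      by (simp add: mult.commute)
  qed
  have cc: "continuous_on UNIV (\<lambda>u. cos (y * u))" "continuous_on UNIV (\<lambda>u. sin (y * u))" for y :: real
    by (intro continuous_intros)+
  let ?A = "\<integral>u. \<bar>g u\<bar> * indicator {-1..1} u \<partial>lborel"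
  let ?B = "\<integral>u. \<bar>g' u\<bar> * indicator {-1..1::real} u \<partial>lborel"
  have bA: "\<bar>\<integral>u. g u * cos (y * u) \<partial>lborel\<bar> \<le> ?A" for y
  proof -
    have "\<bar>\<integral>u. g u * cos (y * u) \<partial>lborel\<bar> \<le> (\<integral>u. \<bar>g u * cos (y * u)\<bar> \<partial>lborel)" by (rule integral_abs_bound)
    also have "\<dots> \<le> ?A"
    proof (rule integral_mono_AE')
      show "integrable lborel (\<lambda>u. \<bar>g u\<bar> * indicator {-1..1} u)" by (intro ib continuous_intros cg)
      show "AE u in lborel. \<bar>g u * cos (y * u)\<bar> \<le> \<bar>g u\<bar> * indicator {-1..1} u"
      proof (intro AE_I2)
        fix u
        have "\<bar>g u * cos (y * u)\<bar> \<le> \<bar>g u\<bar> * 1" unfolding abs_mult by (intro mult_left_mono) auto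
        also have "\<dots> = \<bar>g u\<bar> * indicator {-1..1} u" using supp[of u] by (auto split: split_indicator)
        finally show "\<bar>g u * cos (y * u)\<bar> \<le> \<bar>g u\<bar> * indicator {-1..1} u" .
      qed
    qed simp
    finally show ?thesis .
  qed
  have bB: "\<bar>y\<bar> * \<bar>\<integral>u. g u * cos (y * u) \<partial>lborel\<bar> \<le> ?B" for y
  proof -
    \<comment> \<open>This is the derivative of g(u) sin(yu). The interval [-1, 1] is larger than
      the support, so the boundary terms vanish directly by \<open>supp\<close>.\<close>
    let ?f = "\<lambda>u. g' u * sin (y * u) + y * (g u * cos (y * u))"
    have "(\<integral>u. ?f u * indicator {-1..1} u \<partial>lborel) = g 1 * sin (y * 1) - g (-1) * sin (y * (-1))"
      by (rule integral_FTC_Icc_real)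
         (use c cg in \<open>auto intro!: derivative_eq_intros d continuous_intros simp: continuous_on_eq_continuous_at\<close>)
    also have "\<dots> = 0" using supp[of 1] supp[of "-1"] by simp
    also have "(\<integral>u. ?f u * indicator {-1..1} u \<partial>lborel) =
       (\<integral>u. (g' u * sin (y * u)) * indicator {-1..1} u + y * ((g u * cos (y * u)) * indicator {-1..1} u) \<partial>lborel)"
      by (intro Bochner_Integration.integral_cong) (auto simp: algebra_simps)
    also have "\<dots> = (\<integral>u. (g' u * sin (y * u)) * indicator {-1..1} u \<partial>lborel) + y * (\<integral>u. (g u * cos (y * u)) * indicator {-1..1} u \<partial>lborel)"
      using ib[of "\<lambda>u. g' u * sin (y * u)"] ib[of "\<lambda>u. g u * cos (y * u)"] c cg cc
      by (simp add: continuous_on_mult)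
    also have "(\<integral>u. (g u * cos (y * u)) * indicator {-1..1} u \<partial>lborel) = (\<integral>u. g u * cos (y * u) \<partial>lborel)"
      by (intro Bochner_Integration.integral_cong refl supp'[symmetric])
    finally have "\<bar>y * (\<integral>u. g u * cos (y * u) \<partial>lborel)\<bar> = \<bar>\<integral>u. (g' u * sin (y * u)) * indicator {-1..1} u \<partial>lborel\<bar>"
      by linarith
    also have "\<dots> \<le> (\<integral>u. \<bar>(g' u * sin (y * u)) * indicator {-1..1} u\<bar> \<partial>lborel)" by (rule integral_abs_bound)
    also have "\<dots> \<le> ?B"
    proof (rule integral_mono_AE')
      show "integrable lborel (\<lambda>u. \<bar>g' u\<bar> * indicator {-1..1::real} u)" by (intro ib continuous_intros c)
      show "AE u in lborel. \<bar>(g' u * sin (y * u)) * indicator {-1..1} u\<bar> \<le> \<bar>g' u\<bar> * indicator {-1..1} u"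
      proof (intro AE_I2)
        fix u
        have "\<bar>g' u\<bar> * \<bar>sin (y * u)\<bar> \<le> \<bar>g' u\<bar> * 1" by (intro mult_left_mono) auto
        then show "\<bar>(g' u * sin (y * u)) * indicator {-1..1} u\<bar> \<le> \<bar>g' u\<bar> * indicator {-1..1} u"
          by (auto simp: abs_mult split: split_indicator)
      qed
    qed simp
    finally show ?thesis by (simp add: abs_mult)
  qed
  show ?thesis
  proof (intro exI[of _ "?A + ?B"] conjI allI)
    show "0 \<le> ?A + ?B" by (intro add_nonneg_nonneg integral_nonneg_AE AE_I2) auto
    fix y
    have "(1 + \<bar>y\<bar>) * \<bar>\<integral>u. g u * cos (y * u) \<partial>lborel\<bar> \<le> ?A + ?B"
      using bA[of y] bB[of y] by (simp add: algebra_simps)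
    then show "\<bar>\<integral>u. g u * cos (y * u) \<partial>lborel\<bar> \<le> (?A + ?B) * phi y"
      by (simp add: phi_def field_simps)
  qed
qed

text \<open>The addition formulas turn the plane integral into products of one-dimensional
  transforms; every product with a sine transform vanishes because the factors are even.\<close>

lemma
  fixes g1 g2 :: "real \<Rightarrow> real"
  assumes i: "integrable lborel g1" "integrable lborel g2"
    and even: "\<And>x. g1 (- x) = g1 x" "\<And>x. g2 (- x) = g2 x"
  shows integral_cos_prod2: "(\<integral>s. g1 (s$1) * g2 (s$2) * cos (s \<bullet> y) \<partial>(lborel :: (real^2) measure))
      = (\<integral>u. g1 u * cos (y$1 * u) \<partial>lborel) * (\<integral>u. g2 u * cos (y$2 * u) \<partial>lborel)"
    and integral_sin_prod2: "(\<integral>s. g1 (s$1) * g2 (s$2) * sin (s \<bullet> y) \<partial>(lborel :: (real^2) measure)) = 0"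
proof -
  have ic: "integrable lborel (\<lambda>u. g u * cos (a * u))" "integrable lborel (\<lambda>u. g u * sin (a * u))"
    if "integrable lborel g" for g :: "real \<Rightarrow> real" and a
  proof -
    note [measurable] = borel_measurable_integrable[OF that]
    show "integrable lborel (\<lambda>u. g u * cos (a * u))"
      by (rule Bochner_Integration.integrable_bound[OF that]) (auto simp: abs_mult mult_left_le intro!: AE_I2)
    show "integrable lborel (\<lambda>u. g u * sin (a * u))"
      by (rule Bochner_Integration.integrable_bound[OF that]) (auto simp: abs_mult mult_left_le intro!: AE_I2)
  qed
  have odd: "(\<integral>u. g u * sin (a * u) \<partial>lborel) = 0" if "\<And>x. g (- x) = g x" for g :: "real \<Rightarrow> real" and a
    using lborel_integral_real_affine[of "-1" "\<lambda>u. g u * sin (a * u)" 0] that by simp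
  have in_: "s \<bullet> y = s$1 * y$1 + s$2 * y$2" for s :: "real^2" by (simp add: inner_vec_def sum_2)
  let ?c1 = "\<lambda>u. g1 u * cos (y$1 * u)" and ?c2 = "\<lambda>u. g2 u * cos (y$2 * u)"
  let ?s1 = "\<lambda>u. g1 u * sin (y$1 * u)" and ?s2 = "\<lambda>u. g2 u * sin (y$2 * u)"
  have "(\<integral>s. g1 (s$1) * g2 (s$2) * cos (s \<bullet> y) \<partial>(lborel :: (real^2) measure))
     = (\<integral>s. ?c1 (s$1) * ?c2 (s$2) - ?s1 (s$1) * ?s2 (s$2) \<partial>(lborel :: (real^2) measure))"
    by (intro Bochner_Integration.integral_cong refl) (simp add: in_ cos_add algebra_simps)
  also have "\<dots> = (\<integral>u. ?c1 u \<partial>lborel) * (\<integral>u. ?c2 u \<partial>lborel) - (\<integral>u. ?s1 u \<partial>lborel) * (\<integral>u. ?s2 u \<partial>lborel)"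
    by (subst Bochner_Integration.integral_diff)
       (intro integrable_prod2 ic i, intro integrable_prod2 ic i, simp only: integral_prod2[OF ic(1)[OF i(1)] ic(1)[OF i(2)]] integral_prod2[OF ic(2)[OF i(1)] ic(2)[OF i(2)]])
  finally show "(\<integral>s. g1 (s$1) * g2 (s$2) * cos (s \<bullet> y) \<partial>(lborel :: (real^2) measure))
      = (\<integral>u. ?c1 u \<partial>lborel) * (\<integral>u. ?c2 u \<partial>lborel)" using odd[of g1, OF even(1)] by simp
  have "(\<integral>s. g1 (s$1) * g2 (s$2) * sin (s \<bullet> y) \<partial>(lborel :: (real^2) measure))
     = (\<integral>s. ?s1 (s$1) * ?c2 (s$2) + ?c1 (s$1) * ?s2 (s$2) \<partial>(lborel :: (real^2) measure))"
    by (intro Bochner_Integration.integral_cong refl) (simp add: in_ sin_add algebra_simps)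
  also have "\<dots> = (\<integral>u. ?s1 u \<partial>lborel) * (\<integral>u. ?c2 u \<partial>lborel) + (\<integral>u. ?c1 u \<partial>lborel) * (\<integral>u. ?s2 u \<partial>lborel)"
    by (subst Bochner_Integration.integral_add)
       (intro integrable_prod2 ic i, intro integrable_prod2 ic i, simp only: integral_prod2[OF ic(2)[OF i(1)] ic(1)[OF i(2)]] integral_prod2[OF ic(1)[OF i(1)] ic(2)[OF i(2)]])
  finally show "(\<integral>s. g1 (s$1) * g2 (s$2) * sin (s \<bullet> y) \<partial>(lborel :: (real^2) measure)) = 0"
    using odd[of g1, OF even(1)] odd[of g2, OF even(2)] by simp
qed

section \<open>Moments of the field observed at random locations\<close>

locale sampled_gaussian_field = prob_space M for M :: "'w measure" +
  fixes G :: "'w measure" and Z :: "real^2 \<Rightarrow> 'w \<Rightarrow> real" and c :: "real^2 \<Rightarrow> real"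
    and S :: "nat \<Rightarrow> nat \<Rightarrow> 'w \<Rightarrow> real^2" and lam :: "nat \<Rightarrow> real" and cB :: real
  assumes jm: "jointly_measurable_field M G Z" and gauss: "gaussian_field M Z"
    and centered: "centered_field M Z" and stat: "second_order_stationary M Z c"
    and cb: "\<And>u. \<bar>c u\<bar> \<le> cB" and cmeas [measurable]: "c \<in> borel_measurable borel"
    and lam_pos: "\<And>n. lam n > 0" and sampling: "uniform_sampling M G lam S"
begin

definition lin :: "nat \<Rightarrow> (real^2 \<Rightarrow> real) \<Rightarrow> 'w \<Rightarrow> real" where
  "lin n \<alpha> w = (\<Sum>j=1..n. \<alpha> (S n j w) * Z (S n j w) w)"

text \<open>The covariance of \<open>lin n \<alpha>\<close> and \<open>lin n \<beta>\<close>
  conditionally on the locations.\<close>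

definition quad :: "nat \<Rightarrow> (real^2 \<Rightarrow> real) \<Rightarrow> (real^2 \<Rightarrow> real) \<Rightarrow> 'w \<Rightarrow> real" where
  "quad n \<alpha> \<beta> w = (\<Sum>i=1..n. \<Sum>j=1..n. \<alpha> (S n i w) * \<beta> (S n j w) * c (S n j w - S n i w))"

lemma S_measurable [measurable]: "j \<in> {1..n} \<Longrightarrow> S n j \<in> M \<rightarrow>\<^sub>M borel"
  using sampling unfolding uniform_sampling_def indep_vars_def by blast

lemma indep_S: "indep_vars (\<lambda>_. borel) (S n) {1..n}"
  using sampling unfolding uniform_sampling_def by blast

lemma distr_S: "j \<in> {1..n} \<Longrightarrow> distr M borel (S n j) = uniform_measure lborel (cube (lam n))"
  using sampling unfolding uniform_sampling_def by blast

lemma Z_measurable [measurable]: "Z s \<in> borel_measurable M"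
  using stat unfolding second_order_stationary_def by blast

lemma Z_square_integrable: "integrable M (\<lambda>w. (Z s w)\<^sup>2)"
  using stat unfolding second_order_stationary_def by blast

lemma Z_integrable: "integrable M (Z s)" and Z_mean: "expectation (Z s) = 0"
  using centered unfolding centered_field_def by auto

lemma ZZ_integrable: "integrable M (\<lambda>w. Z s w * Z t w)"
proof (rule Bochner_Integration.integrable_bound[OF Bochner_Integration.integrable_add[OF Z_square_integrable[of s] Z_square_integrable[of t]]])
  show "AE w in M. norm (Z s w * Z t w) \<le> norm ((Z s w)\<^sup>2 + (Z t w)\<^sup>2)"
  proof (intro AE_I2)
    fix w
    have "2 * \<bar>Z s w\<bar> * \<bar>Z t w\<bar> \<le> \<bar>Z s w\<bar>\<^sup>2 + \<bar>Z t w\<bar>\<^sup>2" by (rule sum_squares_bound)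
    then have "\<bar>Z s w\<bar> * \<bar>Z t w\<bar> \<le> (Z s w)\<^sup>2 + (Z t w)\<^sup>2" using mult_nonneg_nonneg[of "\<bar>Z s w\<bar>" "\<bar>Z t w\<bar>"] unfolding power2_abs by linarith
    then show "norm (Z s w * Z t w) \<le> norm ((Z s w)\<^sup>2 + (Z t w)\<^sup>2)" by (simp add: abs_mult)
  qed
qed measurable

lemma ZZ_expectation: "expectation (\<lambda>w. Z s w * Z t w) = c (t - s)"
proof -
  have "covariance M (Z s) (Z (s + (t - s))) = c (t - s)"
    using stat unfolding second_order_stationary_def by blast
  then show ?thesis by (simp add: covariance_def Z_mean)
qed

lemma
  fixes s :: "nat \<Rightarrow> real^2"
  shows gaussian_combination: "gaussian_rv M (\<lambda>w. \<Sum>j=1..n. x j * Z (s j) w)"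
    and combination_integrable: "integrable M (\<lambda>w. \<Sum>j=1..n. x j * Z (s j) w)"
    and combination_mean: "expectation (\<lambda>w. \<Sum>j=1..n. x j * Z (s j) w) = 0"
    and combination_cov: "expectation (\<lambda>w. (\<Sum>j=1..n. x j * Z (s j) w) * (\<Sum>j=1..n. y j * Z (s j) w))
        = (\<Sum>i=1..n. \<Sum>j=1..n. x i * y j * c (s j - s i))"
proof -
  \<comment> \<open>The points \<open>s j\<close> may coincide, whereas
    \<open>gaussian_field\<close> speaks of sums over a set of points; the weights of equal points
    are therefore added up first.\<close>
  have "(\<Sum>j=1..n. x j * Z (s j) w) = (\<Sum>t\<in>s ` {1..n}. (\<Sum>j | j \<in> {1..n} \<and> s j = t. x j) * Z t w)" for w
  proof -
    have "(\<Sum>j=1..n. x j * Z (s j) w) = (\<Sum>t\<in>s ` {1..n}. \<Sum>j | j \<in> {1..n} \<and> s j = t. x j * Z (s j) w)"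
      by (rule sum.image_gen) simp
    also have "\<dots> = (\<Sum>t\<in>s ` {1..n}. (\<Sum>j | j \<in> {1..n} \<and> s j = t. x j) * Z t w)"
      by (auto intro!: sum.cong simp: sum_distrib_right)
    finally show ?thesis .
  qed
  then show "gaussian_rv M (\<lambda>w. \<Sum>j=1..n. x j * Z (s j) w)"
    using gauss unfolding gaussian_field_def by simp
  show "integrable M (\<lambda>w. \<Sum>j=1..n. x j * Z (s j) w)" using Z_integrable by simp
  show "expectation (\<lambda>w. \<Sum>j=1..n. x j * Z (s j) w) = 0" using Z_integrable by (simp add: Z_mean)
  have "expectation (\<lambda>w. (\<Sum>j=1..n. x j * Z (s j) w) * (\<Sum>j=1..n. y j * Z (s j) w))
      = expectation (\<lambda>w. \<Sum>i=1..n. \<Sum>j=1..n. x i * y j * (Z (s i) w * Z (s j) w))"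
    by (intro Bochner_Integration.integral_cong refl) (simp add: sum_product mult_ac)
  also have "\<dots> = (\<Sum>i=1..n. \<Sum>j=1..n. x i * y j * c (s j - s i))"
    using ZZ_integrable by (simp add: ZZ_expectation)
  finally show "expectation (\<lambda>w. (\<Sum>j=1..n. x j * Z (s j) w) * (\<Sum>j=1..n. y j * Z (s j) w))
        = (\<Sum>i=1..n. \<Sum>j=1..n. x i * y j * c (s j - s i))" .
qed

lemma subalgebra_G: "subalgebra M G" and Z_joint: "(\<lambda>(s, w). Z s w) \<in> borel_measurable (borel \<Otimes>\<^sub>M G)"
  using jm unfolding jointly_measurable_field_def by auto

text \<open>This is the conditioning step: the locations may be frozen at an independent copy v
  while the field is averaged over w. The integrand has to be measurable with respect to
  \<open>G\<close> in its first argument, which joint measurability of the field provides.\<close>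

lemma nn_integral_independent_sample:
  fixes F :: "'w \<Rightarrow> (nat \<Rightarrow> real^2) \<Rightarrow> ennreal"
  assumes F: "(\<lambda>(w, s). F w s) \<in> borel_measurable (G \<Otimes>\<^sub>M Pi\<^sub>M {1..n} (\<lambda>_. borel))"
  shows "(\<integral>\<^sup>+w. F w (\<lambda>j\<in>{1..n}. S n j w) \<partial>M) = (\<integral>\<^sup>+v. \<integral>\<^sup>+w. F w (\<lambda>j\<in>{1..n}. S n j v) \<partial>M \<partial>M)"
proof -
  let ?P = "Pi\<^sub>M {1..n} (\<lambda>_. borel) :: (nat \<Rightarrow> real^2) measure"
  let ?Y = "\<lambda>w. \<lambda>j\<in>{1..n}. S n j w"
  have spG: "space G = space M" and seG: "sets G \<subseteq> sets M" using subalgebra_G by (auto simp: subalgebra_def)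
  have X[measurable]: "(\<lambda>w. w) \<in> M \<rightarrow>\<^sub>M G" using spG seG by (auto simp: measurable_def)
  have Y[measurable]: "?Y \<in> M \<rightarrow>\<^sub>M ?P" by measurable
  interpret P1: prob_space "distr M G (\<lambda>w. w)" by (rule prob_space_distr) measurable
  interpret P2: prob_space "distr M ?P ?Y" by (rule prob_space_distr) measurable
  interpret PP: pair_sigma_finite "distr M G (\<lambda>w. w)" "distr M ?P ?Y" ..
  \<comment> \<open>The identity map into the smaller sigma-algebra \<open>G\<close> stands for the
    field. Independence is exactly the product formula on rectangles.\<close>
  have D: "distr M G (\<lambda>w. w) \<Otimes>\<^sub>M distr M ?P ?Y = distr M (G \<Otimes>\<^sub>M ?P) (\<lambda>w. (w, ?Y w))"
  proof (rule pair_measure_eqI)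
    fix A B assume "A \<in> sets (distr M G (\<lambda>w. w))" "B \<in> sets (distr M ?P ?Y)"
    then have A: "A \<in> sets G" and B: "B \<in> sets ?P" by auto
    have A': "A \<inter> space M = A" using sets.sets_into_space[OF A] spG by auto
    have "prob (A \<inter> (?Y -` B \<inter> space M)) = prob A * prob (?Y -` B \<inter> space M)"
    proof (rule indep_setD)
      show "indep_set (sets G) (sets (vimage_algebra (space M) ?Y ?P))"
        using sampling by (simp add: uniform_sampling_def)
      show "?Y -` B \<inter> space M \<in> sets (vimage_algebra (space M) ?Y ?P)"
        using B by (auto simp: sets_vimage_algebra)
    qed fact
    moreover have "(\<lambda>w. (w, ?Y w)) -` (A \<times> B) \<inter> space M = A \<inter> (?Y -` B \<inter> space M)"
      using A' by auto
    moreover have "A \<times> B \<in> sets (G \<Otimes>\<^sub>M ?P)" using A B by auto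
    ultimately show "emeasure (distr M G (\<lambda>w. w)) A * emeasure (distr M ?P ?Y) B = emeasure (distr M (G \<Otimes>\<^sub>M ?P) (\<lambda>w. (w, ?Y w))) (A \<times> B)"
      using A B A' by (simp add: emeasure_distr emeasure_eq_measure ennreal_mult'' del: vimage_Int)
  next
    show "sets (distr M G (\<lambda>w. w) \<Otimes>\<^sub>M distr M ?P ?Y) = sets (distr M (G \<Otimes>\<^sub>M ?P) (\<lambda>w. (w, ?Y w)))"
      unfolding sets_distr by (rule sets_pair_measure_cong) simp_all
  qed (rule P1.sigma_finite_measure_axioms P2.sigma_finite_measure_axioms)+
  have F'[measurable]: "(\<lambda>(w, s). F w s) \<in> borel_measurable (distr M G (\<lambda>w. w) \<Otimes>\<^sub>M distr M ?P ?Y)"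
    using F unfolding measurable_cong_sets[OF sets_pair_measure_cong[OF sets_distr sets_distr] refl] .
  have "(\<integral>\<^sup>+w. F w (?Y w) \<partial>M) = (\<integral>\<^sup>+p. (\<lambda>(w, s). F w s) p \<partial>distr M (G \<Otimes>\<^sub>M ?P) (\<lambda>w. (w, ?Y w)))"
    using F by (subst nn_integral_distr) auto
  also have "\<dots> = (\<integral>\<^sup>+s. \<integral>\<^sup>+w. F w s \<partial>distr M G (\<lambda>w. w) \<partial>distr M ?P ?Y)"
    unfolding D[symmetric] using PP.nn_integral_snd[OF F'] by simp
  also have "\<dots> = (\<integral>\<^sup>+v. \<integral>\<^sup>+w. F w (?Y v) \<partial>distr M G (\<lambda>w. w) \<partial>M)"
    by (subst nn_integral_distr) (use F' in \<open>auto intro!: P1.borel_measurable_nn_integral\<close>)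
  also have "\<dots> = (\<integral>\<^sup>+v. \<integral>\<^sup>+w. F w (?Y v) \<partial>M \<partial>M)"
  proof (rule nn_integral_cong)
    fix v assume v: "v \<in> space M"
    have "?Y v \<in> space ?P" by (simp add: space_PiM)
    from measurable_compose[OF measurable_Pair2'[OF this] F]
    have "(\<lambda>w. F w (?Y v)) \<in> borel_measurable G" by simp
    then show "(\<integral>\<^sup>+w. F w (?Y v) \<partial>distr M G (\<lambda>w. w)) = (\<integral>\<^sup>+w. F w (?Y v) \<partial>M)"
      by (subst nn_integral_distr) auto
  qed
  finally show ?thesis .
qed

text \<open>A moment formula for fixed locations that depends only on the variances and the
  covariance transfers to random locations, with these replaced by the conditional ones. Nonnegative
  integrals are used because integrability of powers of \<open>lin\<close> is not yet known.\<close>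

lemma nn_integral_lin:
  fixes \<psi> :: "real \<Rightarrow> real \<Rightarrow> ennreal"
  assumes [measurable]: "\<alpha> \<in> borel_measurable borel" "\<beta> \<in> borel_measurable borel"
    and psi[measurable]: "(\<lambda>(x, y). \<psi> x y) \<in> borel_measurable (borel \<Otimes>\<^sub>M borel)"
    and fixed: "\<And>x y s. (\<integral>\<^sup>+w. \<psi> (\<Sum>j=1..n. x j * Z (s j) w) (\<Sum>j=1..n. y j * Z (s j) w) \<partial>M) =
       \<Psi> (\<Sum>i=1..n. \<Sum>j=1..n. x i * x j * c (s j - s i)) (\<Sum>i=1..n. \<Sum>j=1..n. y i * y j * c (s j - s i))
         (\<Sum>i=1..n. \<Sum>j=1..n. x i * y j * c (s j - s i))"
  shows "(\<integral>\<^sup>+w. \<psi> (lin n \<alpha> w) (lin n \<beta> w) \<partial>M) = (\<integral>\<^sup>+w. \<Psi> (quad n \<alpha> \<alpha> w) (quad n \<beta> \<beta> w) (quad n \<alpha> \<beta> w) \<partial>M)"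
proof -
  let ?P = "Pi\<^sub>M {1..n} (\<lambda>_. borel) :: (nat \<Rightarrow> real^2) measure"
  let ?F = "\<lambda>w s. \<psi> (\<Sum>j=1..n. \<alpha> (s j) * Z (s j) w) (\<Sum>j=1..n. \<beta> (s j) * Z (s j) w)"
  note [measurable] = Z_joint
  have Zj: "(\<lambda>p. Z (snd p j) (fst p)) \<in> borel_measurable (G \<Otimes>\<^sub>M ?P)" if j: "j \<in> {1..n}" for j
  proof -
    have "(\<lambda>p. (snd p j, fst p)) \<in> (G \<Otimes>\<^sub>M ?P) \<rightarrow>\<^sub>M (borel \<Otimes>\<^sub>M G)" using j by measurable
    from measurable_compose[OF this Z_joint] show ?thesis by simp
  qed
  have L: "(\<lambda>p. \<Sum>j=1..n. \<gamma> (snd p j) * Z (snd p j) (fst p)) \<in> borel_measurable (G \<Otimes>\<^sub>M ?P)"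
    if [measurable]: "\<gamma> \<in> borel_measurable borel" for \<gamma> :: "real^2 \<Rightarrow> real"
    by (intro borel_measurable_sum borel_measurable_times Zj) measurable
  have "(\<lambda>p. ((\<Sum>j=1..n. \<alpha> (snd p j) * Z (snd p j) (fst p)), (\<Sum>j=1..n. \<beta> (snd p j) * Z (snd p j) (fst p)))) \<in> (G \<Otimes>\<^sub>M ?P) \<rightarrow>\<^sub>M (borel \<Otimes>\<^sub>M borel)"
    by (intro measurable_Pair L) measurable
  from measurable_compose[OF this psi]
  have Fm: "(\<lambda>(w, s). ?F w s) \<in> borel_measurable (G \<Otimes>\<^sub>M ?P)" by (simp add: case_prod_beta)
  have "(\<integral>\<^sup>+w. \<psi> (lin n \<alpha> w) (lin n \<beta> w) \<partial>M) = (\<integral>\<^sup>+w. ?F w (\<lambda>j\<in>{1..n}. S n j w) \<partial>M)"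
    by (simp add: lin_def)
  also have "\<dots> = (\<integral>\<^sup>+v. \<integral>\<^sup>+w. ?F w (\<lambda>j\<in>{1..n}. S n j v) \<partial>M \<partial>M)"
    by (rule nn_integral_independent_sample[OF Fm])
  also have "\<dots> = (\<integral>\<^sup>+v. \<Psi> (quad n \<alpha> \<alpha> v) (quad n \<beta> \<beta> v) (quad n \<alpha> \<beta> v) \<partial>M)"
    unfolding fixed by (simp add: quad_def)
  finally show ?thesis .
qed

lemma quad_measurable [measurable]:
  assumes [measurable]: "\<alpha> \<in> borel_measurable borel" "\<beta> \<in> borel_measurable borel"
  shows "quad n \<alpha> \<beta> \<in> borel_measurable M"
  unfolding quad_def[abs_def] by measurable

text \<open>Crude in n; it serves only to make all powers of the conditional covariances
  integrable.\<close>

lemma quad_bound: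
  assumes "\<And>x. \<bar>\<alpha> x\<bar> \<le> A" "\<And>x. \<bar>\<beta> x\<bar> \<le> B"
  shows "\<bar>quad n \<alpha> \<beta> w\<bar> \<le> real n * real n * (A * B * cB)"
proof -
  have A0: "0 \<le> A" "0 \<le> B" "0 \<le> cB" using assms(1)[of 0] assms(2)[of 0] cb[of 0] by linarith+
  have "\<bar>quad n \<alpha> \<beta> w\<bar> \<le> (\<Sum>i=1..n. \<Sum>j=1..n. A * B * cB)"
    unfolding quad_def
    by (intro order_trans[OF sum_abs] sum_mono) (auto simp: abs_mult intro!: mult_mono mult_nonneg_nonneg assms cb A0)
  then show ?thesis by simp
qed

lemma lin_measurable [measurable]:
  assumes [measurable]: "\<alpha> \<in> borel_measurable borel"
  shows "lin n \<alpha> \<in> borel_measurable M"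
proof -
  have "(\<lambda>w. Z (S n j w) w) \<in> borel_measurable M" if j: "j \<in> {1..n}" for j
  proof -
    have "(\<lambda>w. w) \<in> M \<rightarrow>\<^sub>M G" using subalgebra_G by (auto simp: measurable_def subalgebra_def)
    then have "(\<lambda>w. (S n j w, w)) \<in> M \<rightarrow>\<^sub>M (borel \<Otimes>\<^sub>M G)" using j by measurable
    from measurable_compose[OF this Z_joint] show ?thesis by simp
  qed
  then show ?thesis unfolding lin_def[abs_def]
    by (intro borel_measurable_sum borel_measurable_times) measurable
qed

text \<open>It is the second moment of the linear combination with the locations frozen at
  w.\<close>

lemma quad_nonneg: "0 \<le> quad n \<alpha> \<alpha> w"
proof -
  have "0 \<le> expectation (\<lambda>v. (\<Sum>j=1..n. \<alpha> (S n j w) * Z (S n j w) v) * (\<Sum>j=1..n. \<alpha> (S n j w) * Z (S n j w) v))"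
    by (intro integral_nonneg_AE AE_I2) simp
  then show ?thesis unfolding combination_cov quad_def .
qed

lemma
  assumes [measurable]: "\<alpha> \<in> borel_measurable borel" and b: "\<And>x. \<bar>\<alpha> x\<bar> \<le> A"
  shows lin_even_integrable: "integrable M (\<lambda>w. lin n \<alpha> w ^ (2 * k))"
    and lin_even_moment: "expectation (\<lambda>w. lin n \<alpha> w ^ (2 * k)) = fact (2 * k) / (2 ^ k * fact k) * expectation (\<lambda>w. quad n \<alpha> \<alpha> w ^ k)"
proof -
  let ?C = "fact (2 * k) / (2 ^ k * fact k) :: real"
  have "(\<integral>\<^sup>+w. ennreal (lin n \<alpha> w ^ (2 * k)) \<partial>M) = (\<integral>\<^sup>+w. ennreal (?C * quad n \<alpha> \<alpha> w ^ k) \<partial>M)"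
  proof (rule nn_integral_lin[where \<psi> = "\<lambda>x y. ennreal (x ^ (2 * k))" and \<Psi> = "\<lambda>u v r. ennreal (?C * u ^ k)" and \<beta>=\<alpha>])
    fix x y :: "nat \<Rightarrow> real" and s
    let ?U = "\<lambda>w. \<Sum>j=1..n. x j * Z (s j) w"
    note m = gaussian_rv_even_moment[OF prob_space_axioms gaussian_combination combination_mean, of x s n k]
    have "(\<integral>\<^sup>+w. ennreal (?U w ^ (2 * k)) \<partial>M) = ennreal (expectation (\<lambda>w. ?U w ^ (2 * k)))"
      by (rule nn_integral_eq_integral[OF m(1)]) simp
    then show "(\<integral>\<^sup>+w. ennreal (?U w ^ (2 * k)) \<partial>M) = ennreal (?C * (\<Sum>i=1..n. \<Sum>j=1..n. x i * x j * c (s j - s i)) ^ k)"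
      unfolding m(2) power2_eq_square combination_cov .
  qed measurable
  also have "\<dots> = ennreal (expectation (\<lambda>w. ?C * quad n \<alpha> \<alpha> w ^ k))"
  proof (rule nn_integral_eq_integral)
    show "integrable M (\<lambda>w. ?C * quad n \<alpha> \<alpha> w ^ k)"
      by (intro integrable_mult_right integrable_const_bound[where B="(real n * real n * (A * A * cB)) ^ k"] AE_I2)
         (auto simp: power_abs intro!: power_mono quad_bound b)
    show "AE w in M. 0 \<le> ?C * quad n \<alpha> \<alpha> w ^ k" using quad_nonneg by simp
  qed
  finally have eq: "(\<integral>\<^sup>+w. ennreal (lin n \<alpha> w ^ (2 * k)) \<partial>M) = ennreal (expectation (\<lambda>w. ?C * quad n \<alpha> \<alpha> w ^ k))" .
  have nn: "0 \<le> expectation (\<lambda>w. ?C * quad n \<alpha> \<alpha> w ^ k)" using quad_nonneg by (intro integral_nonneg_AE) simp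
  have "has_bochner_integral M (\<lambda>w. lin n \<alpha> w ^ (2 * k)) (expectation (\<lambda>w. ?C * quad n \<alpha> \<alpha> w ^ k))"
    by (rule has_bochner_integral_nn_integral[OF _ _ nn eq]) auto
  then show "integrable M (\<lambda>w. lin n \<alpha> w ^ (2 * k))" "expectation (\<lambda>w. lin n \<alpha> w ^ (2 * k)) = ?C * expectation (\<lambda>w. quad n \<alpha> \<alpha> w ^ k)"
    by (auto simp: has_bochner_integral_iff)
qed

lemma
  assumes [measurable]: "\<alpha> \<in> borel_measurable borel" "\<beta> \<in> borel_measurable borel"
    and b: "\<And>x. \<bar>\<alpha> x\<bar> \<le> A" "\<And>x. \<bar>\<beta> x\<bar> \<le> B"
  shows lin_moment88_integrable: "integrable M (\<lambda>w. lin n \<alpha> w ^ 8 * lin n \<beta> w ^ 8)"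
    and lin_moment88: "expectation (\<lambda>w. lin n \<alpha> w ^ 8 * lin n \<beta> w ^ 8)
      = expectation (\<lambda>w. moment88 (quad n \<alpha> \<alpha> w) (quad n \<beta> \<beta> w) (quad n \<alpha> \<beta> w))"
proof -
  \<comment> \<open>The value and its nonnegativity are proved together: the polynomial
    \<open>moment88\<close> is nonnegative here only because it is an expectation of even powers,
    and \<open>ennreal\<close> would collapse a negative value to 0.\<close>
  have fixed: "(\<integral>\<^sup>+w. ennreal ((\<Sum>j=1..n. x j * Z (s j) w) ^ 8 * (\<Sum>j=1..n. y j * Z (s j) w) ^ 8) \<partial>M)
     = ennreal (moment88 (\<Sum>i=1..n. \<Sum>j=1..n. x i * x j * c (s j - s i)) (\<Sum>i=1..n. \<Sum>j=1..n. y i * y j * c (s j - s i))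
         (\<Sum>i=1..n. \<Sum>j=1..n. x i * y j * c (s j - s i)))" (is ?A)
    and pos: "0 \<le> moment88 (\<Sum>i=1..n. \<Sum>j=1..n. x i * x j * c (s j - s i)) (\<Sum>i=1..n. \<Sum>j=1..n. y i * y j * c (s j - s i))
         (\<Sum>i=1..n. \<Sum>j=1..n. x i * y j * c (s j - s i))" (is ?B) for x y :: "nat \<Rightarrow> real" and s
  proof -
    let ?U = "\<lambda>w. \<Sum>j=1..n. x j * Z (s j) w" and ?V = "\<lambda>w. \<Sum>j=1..n. y j * Z (s j) w"
    have g: "gaussian_rv M (\<lambda>w. ?U w + t * ?V w)" for t
    proof -
      have "(\<lambda>w. ?U w + t * ?V w) = (\<lambda>w. \<Sum>j=1..n. (x j + t * y j) * Z (s j) w)"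
        by (auto simp: sum.distrib sum_distrib_left algebra_simps)
      then show ?thesis using gaussian_combination by simp
    qed
    note m = gaussian_bivariate_moment88[OF prob_space_axioms g gaussian_combination combination_integrable combination_integrable combination_mean combination_mean]
    have e: "expectation (\<lambda>w. ?U w ^ 8 * ?V w ^ 8) = moment88 (\<Sum>i=1..n. \<Sum>j=1..n. x i * x j * c (s j - s i)) (\<Sum>i=1..n. \<Sum>j=1..n. y i * y j * c (s j - s i))
         (\<Sum>i=1..n. \<Sum>j=1..n. x i * y j * c (s j - s i))"
      unfolding m(2) power2_eq_square combination_cov ..
    have "(\<integral>\<^sup>+w. ennreal (?U w ^ 8 * ?V w ^ 8) \<partial>M) = ennreal (expectation (\<lambda>w. ?U w ^ 8 * ?V w ^ 8))"
      by (rule nn_integral_eq_integral[OF m(1)]) simp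
    then show ?A unfolding e .
    have "0 \<le> expectation (\<lambda>w. ?U w ^ 8 * ?V w ^ 8)" by (intro integral_nonneg_AE) simp
    then show ?B unfolding e .
  qed
  have pos': "0 \<le> moment88 (quad n \<alpha> \<alpha> w) (quad n \<beta> \<beta> w) (quad n \<alpha> \<beta> w)" for w
    unfolding quad_def by (rule pos)
  have mm[measurable]: "(\<lambda>w. moment88 (quad n \<alpha> \<alpha> w) (quad n \<beta> \<beta> w) (quad n \<alpha> \<beta> w)) \<in> borel_measurable M"
    unfolding moment88_def by measurable
  have "(\<integral>\<^sup>+w. ennreal (lin n \<alpha> w ^ 8 * lin n \<beta> w ^ 8) \<partial>M) = (\<integral>\<^sup>+w. ennreal (moment88 (quad n \<alpha> \<alpha> w) (quad n \<beta> \<beta> w) (quad n \<alpha> \<beta> w)) \<partial>M)"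
  proof (rule nn_integral_lin[where \<psi> = "\<lambda>x y. ennreal (x ^ 8 * y ^ 8)" and \<Psi> = "\<lambda>u v r. ennreal (moment88 u v r)"])
  qed (measurable, rule fixed)
  also have "\<dots> = ennreal (expectation (\<lambda>w. moment88 (quad n \<alpha> \<alpha> w) (quad n \<beta> \<beta> w) (quad n \<alpha> \<beta> w)))"
  proof (rule nn_integral_eq_integral)
    let ?D = "real n * real n * (A * A * cB) + real n * real n * (B * B * cB) + real n * real n * (A * B * cB)"
    have A0: "0 \<le> A" "0 \<le> B" "0 \<le> cB" using b(1)[of 0] b(2)[of 0] cb[of 0] by linarith+
    have D0: "0 \<le> real n * real n * (A * A * cB)" "0 \<le> real n * real n * (B * B * cB)" "0 \<le> real n * real n * (A * B * cB)"
      using A0 by auto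
    have D: "\<bar>quad n \<alpha> \<alpha> w\<bar> \<le> ?D" "\<bar>quad n \<beta> \<beta> w\<bar> \<le> ?D" "\<bar>quad n \<alpha> \<beta> w\<bar> \<le> ?D" for w
      using quad_bound[of \<alpha> A \<alpha> A n w] quad_bound[of \<beta> B \<beta> B n w] quad_bound[of \<alpha> A \<beta> B n w] b D0 by auto
    \<comment> \<open>All coefficients of \<open>moment88\<close> are positive, so the triangle
      inequality amounts to replacing the arguments by their absolute values.\<close>
    have mb: "\<bar>moment88 u v r\<bar> \<le> moment88 \<bar>u\<bar> \<bar>v\<bar> \<bar>r\<bar>" for u v r
      unfolding moment88_def abs_mult by (intro mult_mono order_trans[OF abs_triangle_ineq] add_mono) (auto simp: abs_mult power_abs)
    have mm2: "moment88 u v r \<le> moment88 D D D" if "0 \<le> u" "0 \<le> v" "0 \<le> r" "u \<le> D" "v \<le> D" "r \<le> D" for u v r D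
      unfolding moment88_def using that by (intro mult_left_mono add_mono mult_mono power_mono) auto
    show "integrable M (\<lambda>w. moment88 (quad n \<alpha> \<alpha> w) (quad n \<beta> \<beta> w) (quad n \<alpha> \<beta> w))"
      by (rule integrable_const_bound[where B="moment88 ?D ?D ?D"])
         (use D in \<open>auto intro!: AE_I2 order_trans[OF mb mm2]\<close>)
    show "AE w in M. 0 \<le> moment88 (quad n \<alpha> \<alpha> w) (quad n \<beta> \<beta> w) (quad n \<alpha> \<beta> w)" using pos' by simp
  qed
  finally have eq: "(\<integral>\<^sup>+w. ennreal (lin n \<alpha> w ^ 8 * lin n \<beta> w ^ 8) \<partial>M) = \<dots>" .
  have nn: "0 \<le> expectation (\<lambda>w. moment88 (quad n \<alpha> \<alpha> w) (quad n \<beta> \<beta> w) (quad n \<alpha> \<beta> w))" using pos' by (intro integral_nonneg_AE) simp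
  have "has_bochner_integral M (\<lambda>w. lin n \<alpha> w ^ 8 * lin n \<beta> w ^ 8) (expectation (\<lambda>w. moment88 (quad n \<alpha> \<alpha> w) (quad n \<beta> \<beta> w) (quad n \<alpha> \<beta> w)))"
    by (rule has_bochner_integral_nn_integral[OF _ _ nn eq]) auto
  then show "integrable M (\<lambda>w. lin n \<alpha> w ^ 8 * lin n \<beta> w ^ 8)" "expectation (\<lambda>w. lin n \<alpha> w ^ 8 * lin n \<beta> w ^ 8)
      = expectation (\<lambda>w. moment88 (quad n \<alpha> \<alpha> w) (quad n \<beta> \<beta> w) (quad n \<alpha> \<beta> w))"
    by (auto simp: has_bochner_integral_iff)
qed

end

section \<open>The spectral representation and concentration\<close>

lemma
  assumes "l > 0"
  shows prob_space_cube: "prob_space (uniform_measure lborel (cube l))"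
    and emeasure_cube: "emeasure lborel (cube l) = ennreal (l\<^sup>2)"
proof -
  have B: "(Basis :: (real^2) set) = {axis 1 1, axis 2 1}"
    by (auto simp: Basis_vec_def) (metis exhaust_2)
  have ne: "axis 1 1 \<noteq> (axis 2 1 :: real^2)" by (simp add: axis_eq_axis)
  have "emeasure lborel (cube l) = ennreal (\<Prod>b\<in>Basis. ((\<chi> i. l / 2) - (\<chi> i. - l / 2) :: real^2) \<bullet> b)"
    unfolding cube_def using assms by (intro emeasure_lborel_cbox) (auto simp: B inner_axis)
  also have "\<dots> = ennreal (l\<^sup>2)" using ne by (simp add: B inner_axis power2_eq_square)
  finally show e: "emeasure lborel (cube l) = ennreal (l\<^sup>2)" .
  show "prob_space (uniform_measure lborel (cube l))"
    using assms by (intro prob_space_uniform_measure) (simp_all add: e)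
qed

lemma (in prob_space) Fubini_weighted:
  fixes g :: "'b::euclidean_space \<Rightarrow> real" and Y :: "'a \<Rightarrow> 'b \<Rightarrow> real"
  assumes g: "integrable lborel g" and Y: "(\<lambda>(w, x). Y w x) \<in> borel_measurable (M \<Otimes>\<^sub>M lborel)"
    and b: "\<And>w x. \<bar>Y w x\<bar> \<le> B"
  shows "integrable M (\<lambda>w. \<integral>x. g x * Y w x \<partial>lborel)"
    and "(\<integral>w. \<integral>x. g x * Y w x \<partial>lborel \<partial>M) = (\<integral>x. g x * (\<integral>w. Y w x \<partial>M) \<partial>lborel)"
proof -
  interpret pair_sigma_finite M lborel ..
  note [measurable] = borel_measurable_integrable[OF g] Y
  have g2: "integrable (M \<Otimes>\<^sub>M lborel) (\<lambda>(w, x). B * g x)"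
  proof (rule Fubini_integrable)
    show "integrable M (\<lambda>w. \<integral>x. norm ((\<lambda>(w, x). B * g x) (w, x)) \<partial>lborel)" by simp
    show "AE w in M. integrable lborel (\<lambda>x. (\<lambda>(w, x). B * g x) (w, x))" using g by simp
  qed measurable
  have i: "integrable (M \<Otimes>\<^sub>M lborel) (\<lambda>(w, x). g x * Y w x)"
  proof (rule Bochner_Integration.integrable_bound[OF g2])
    show "AE p in M \<Otimes>\<^sub>M lborel. norm ((\<lambda>(w, x). g x * Y w x) p) \<le> norm ((\<lambda>(w, x). B * g x) p)"
    proof (intro AE_I2, clarify)
      fix w x
      have "\<bar>Y w x\<bar> \<le> \<bar>B\<bar>" using b[of w x] by linarith
      then show "norm (g x * Y w x) \<le> norm (B * g x)" by (simp add: abs_mult mult.commute[of "\<bar>B\<bar>"] mult_left_mono)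
    qed
  qed measurable
  show "integrable M (\<lambda>w. \<integral>x. g x * Y w x \<partial>lborel)" using integrable_fst[OF i] .
  show "(\<integral>w. \<integral>x. g x * Y w x \<partial>lborel \<partial>M) = (\<integral>x. g x * (\<integral>w. Y w x \<partial>M) \<partial>lborel)"
    using Fubini_integral[OF i] by simp
qed

locale sampled_spectral_field = sampled_gaussian_field +
  fixes f :: "real^2 \<Rightarrow> real"
  assumes spectral: "spectral_density c f"
begin

lemma f_integrable: "integrable lborel f" and c_integrable: "integrable lborel c"
  using spectral unfolding spectral_density_def by auto

lemma f_measurable [measurable]: "f \<in> borel_measurable borel"
  using borel_measurable_integrable[OF f_integrable] by simp

lemma trig_weighted_integrable:
  fixes g :: "real^2 \<Rightarrow> real"
  assumes "integrable lborel g"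
  shows "integrable lborel (\<lambda>x. g x * cos (x \<bullet> u))" "integrable lborel (\<lambda>x. g x * sin (x \<bullet> u))"
proof -
  note [measurable] = borel_measurable_integrable[OF assms]
  show "integrable lborel (\<lambda>x. g x * cos (x \<bullet> u))"
    by (rule Bochner_Integration.integrable_bound[OF assms]) (auto simp: abs_mult mult_left_le intro!: AE_I2)
  show "integrable lborel (\<lambda>x. g x * sin (x \<bullet> u))"
    by (rule Bochner_Integration.integrable_bound[OF assms]) (auto simp: abs_mult mult_left_le intro!: AE_I2)
qed

lemma exp_weighted_integral:
  fixes g :: "real^2 \<Rightarrow> real"
  assumes "integrable lborel g"
  shows "(LINT x|lborel. exp (\<i> * complex_of_real (x \<bullet> u)) * complex_of_real (g x))
    = Complex (\<integral>x. g x * cos (x \<bullet> u) \<partial>lborel) (\<integral>x. g x * sin (x \<bullet> u) \<partial>lborel)"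
proof -
  have e: "exp (\<i> * complex_of_real (x \<bullet> u)) * complex_of_real (g x)
     = complex_of_real (g x * cos (x \<bullet> u)) + \<i> * complex_of_real (g x * sin (x \<bullet> u))" for x
    by (simp add: exp_Euler algebra_simps flip: cos_of_real sin_of_real)
  have i: "integrable lborel (\<lambda>x. complex_of_real (g x * cos (x \<bullet> u)))" "integrable lborel (\<lambda>x. \<i> * complex_of_real (g x * sin (x \<bullet> u)))"
    using trig_weighted_integrable[OF assms] by (auto simp del: of_real_mult)
  have "(LINT x|lborel. exp (\<i> * complex_of_real (x \<bullet> u)) * complex_of_real (g x))
     = (LINT x|lborel. complex_of_real (g x * cos (x \<bullet> u))) + (LINT x|lborel. \<i> * complex_of_real (g x * sin (x \<bullet> u)))"
    unfolding e by (rule Bochner_Integration.integral_add[OF i])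
  also have "\<dots> = Complex (\<integral>x. g x * cos (x \<bullet> u) \<partial>lborel) (\<integral>x. g x * sin (x \<bullet> u) \<partial>lborel)"
    by (simp only: integral_mult_right_zero integral_complex_of_real Complex_eq)
  finally show ?thesis .
qed

text \<open>Real and imaginary parts of the inversion formula; the sine integral vanishes because c
  is real.\<close>

lemma c_eq: "c u = (\<integral>x. f x * cos (x \<bullet> u) \<partial>lborel) / (2 * pi)\<^sup>2"
  and f_sin: "(\<integral>x. f x * sin (x \<bullet> u) \<partial>lborel) = 0"
proof -
  let ?a = "\<integral>x. f x * cos (x \<bullet> u) \<partial>lborel" and ?b = "\<integral>x. f x * sin (x \<bullet> u) \<partial>lborel"
  have "complex_of_real (c u) = (LINT \<omega>|lborel. exp (\<i> * complex_of_real (\<omega> \<bullet> u)) * complex_of_real (f \<omega>)) / (2 * pi)\<^sup>2"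
    using spectral unfolding spectral_density_def by blast
  then have E: "complex_of_real (c u) = Complex ?a ?b / (2 * pi)\<^sup>2"
    unfolding exp_weighted_integral[OF f_integrable] .
  have "complex_of_real ((2 * pi)\<^sup>2 * c u) = Complex ?a ?b"
    by (simp add: E)
  then have "Re (complex_of_real ((2 * pi)\<^sup>2 * c u)) = ?a" "Im (complex_of_real ((2 * pi)\<^sup>2 * c u)) = ?b"
    by (simp_all only: complex.sel)
  then have "(2 * pi)\<^sup>2 * c u = ?a" "?b = 0" by (simp_all only: Re_complex_of_real Im_complex_of_real)
  moreover have "c u = (2 * pi)\<^sup>2 * c u / (2 * pi)\<^sup>2" by simp
  ultimately show "c u = ?a / (2 * pi)\<^sup>2" "?b = 0" by simp_all
qed

lemma f_eq: "f \<omega> = (\<integral>u. c u * cos (u \<bullet> \<omega>) \<partial>lborel)"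
proof -
  have "complex_of_real (f \<omega>) = (LINT u|lborel. exp (- (\<i> * complex_of_real (\<omega> \<bullet> u))) * complex_of_real (c u))"
    using spectral unfolding spectral_density_def by blast
  also have "\<dots> = (LINT u|lborel. exp (\<i> * complex_of_real (u \<bullet> (- \<omega>))) * complex_of_real (c u))"
    by (intro Bochner_Integration.integral_cong refl) (simp add: inner_commute)
  also have "\<dots> = Complex (\<integral>x. c x * cos (x \<bullet> - \<omega>) \<partial>lborel) (\<integral>x. c x * sin (x \<bullet> - \<omega>) \<partial>lborel)"
    by (rule exp_weighted_integral[OF c_integrable])
  finally show ?thesis by (simp add: complex_eq_iff)
qed

lemma f_even: "f (- \<omega>) = f \<omega>"
  unfolding f_eq by simp

lemma f_bounded: "\<bar>f \<omega>\<bar> \<le> (\<integral>u. \<bar>c u\<bar> \<partial>lborel)"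
proof -
  have "\<bar>f \<omega>\<bar> \<le> (\<integral>u. \<bar>c u * cos (u \<bullet> \<omega>)\<bar> \<partial>lborel)" unfolding f_eq by (rule integral_abs_bound)
  also have "\<dots> \<le> (\<integral>u. \<bar>c u\<bar> \<partial>lborel)"
    by (rule integral_mono_AE') (use c_integrable in \<open>auto simp: abs_mult mult_left_le\<close>)
  finally show ?thesis .
qed

section \<open>Mean and fluctuation of the empirical transforms\<close>

definition unif :: "nat \<Rightarrow> (real^2) measure" where "unif n = uniform_measure lborel (cube (lam n))"

lemma prob_space_unif: "prob_space (unif n)" and sets_unif [measurable_cong, simp]: "sets (unif n) = sets borel"
  using prob_space_cube[OF lam_pos] by (auto simp: unif_def)

definition mcos :: "nat \<Rightarrow> (real^2 \<Rightarrow> real) \<Rightarrow> real^2 \<Rightarrow> real" where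
  "mcos n \<alpha> x = (\<integral>s. \<alpha> s * cos (x \<bullet> s) \<partial>unif n)"

definition msin :: "nat \<Rightarrow> (real^2 \<Rightarrow> real) \<Rightarrow> real^2 \<Rightarrow> real" where
  "msin n \<alpha> x = (\<integral>s. \<alpha> s * sin (x \<bullet> s) \<partial>unif n)"

text \<open>The deviation of the empirical cosine transform from its mean, so
  \<open>mcos n \<alpha> x + dcos n \<alpha> w x\<close> is the empirical transform itself;
  \<open>dsin\<close> is its sine counterpart.\<close>

definition dcos :: "nat \<Rightarrow> (real^2 \<Rightarrow> real) \<Rightarrow> 'a \<Rightarrow> real^2 \<Rightarrow> real" where
  "dcos n \<alpha> w x = (\<Sum>j=1..n. \<alpha> (S n j w) * cos (x \<bullet> S n j w)) / real n - mcos n \<alpha> x"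

definition dsin :: "nat \<Rightarrow> (real^2 \<Rightarrow> real) \<Rightarrow> 'a \<Rightarrow> real^2 \<Rightarrow> real" where
  "dsin n \<alpha> w x = (\<Sum>j=1..n. \<alpha> (S n j w) * sin (x \<bullet> S n j w)) / real n - msin n \<alpha> x"

text \<open>The energy of the mean transform, weighted by the absolute spectral density;
  \<open>dmass\<close> is the same energy for the fluctuation. For tapered waves the former is of
  order lam^(-2), the latter of order 1/n in every moment.\<close>

definition mass :: "nat \<Rightarrow> (real^2 \<Rightarrow> real) \<Rightarrow> real" where
  "mass n \<alpha> = (\<integral>x. \<bar>f x\<bar> * ((mcos n \<alpha> x)\<^sup>2 + (msin n \<alpha> x)\<^sup>2) \<partial>lborel)"

definition dmass :: "nat \<Rightarrow> (real^2 \<Rightarrow> real) \<Rightarrow> 'a \<Rightarrow> real" where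
  "dmass n \<alpha> w = (\<integral>x. \<bar>f x\<bar> * ((dcos n \<alpha> w x)\<^sup>2 + (dsin n \<alpha> w x)\<^sup>2) \<partial>lborel)"

text \<open>\<open>quad\<close> divided by n^2 with the empirical transforms replaced by their
  means. It is not the exact expectation: the diagonal terms i = j account for a difference of order
  1/n.\<close>

definition qbar :: "nat \<Rightarrow> (real^2 \<Rightarrow> real) \<Rightarrow> (real^2 \<Rightarrow> real) \<Rightarrow> real" where
  "qbar n \<alpha> \<beta> = (\<integral>x. f x * (mcos n \<alpha> x * mcos n \<beta> x + msin n \<alpha> x * msin n \<beta> x) \<partial>lborel) / (2 * pi)\<^sup>2"

text \<open>The first two factors come from Jensen's inequality and the final integration against
  |f|, the power of 2 from splitting a power of a sum, and 4 = 2 + 2 from the Hoeffding constants of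
  the cosine and the sine part.\<close>

definition dmassK :: "real \<Rightarrow> nat \<Rightarrow> real" where
  "dmassK A p = (\<integral>x. \<bar>f x\<bar> \<partial>lborel) ^ p * (\<integral>x. \<bar>f x\<bar> \<partial>lborel) * (2 ^ Suc p * (4 * fact (2 * Suc p) * exp (A\<^sup>2 / 2)))"

context
  fixes \<alpha> :: "real^2 \<Rightarrow> real" and A :: real
  assumes alpha_meas [measurable]: "\<alpha> \<in> borel_measurable borel" and alpha_b: "\<And>x. \<bar>\<alpha> x\<bar> \<le> A"
begin

lemma A_nonneg: "0 \<le> A" using alpha_b[of 0] by linarith

lemma trig_b: "\<bar>\<alpha> s * cos t\<bar> \<le> A" "\<bar>\<alpha> s * sin t\<bar> \<le> A"
proof -
  have "\<bar>\<alpha> s\<bar> * \<bar>cos t\<bar> \<le> A * 1" "\<bar>\<alpha> s\<bar> * \<bar>sin t\<bar> \<le> A * 1"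
    by (intro mult_mono alpha_b A_nonneg; simp)+
  then show "\<bar>\<alpha> s * cos t\<bar> \<le> A" "\<bar>\<alpha> s * sin t\<bar> \<le> A" by (simp_all add: abs_mult)
qed

lemma mtrig_measurable [measurable]: "mcos n \<alpha> \<in> borel_measurable borel" "msin n \<alpha> \<in> borel_measurable borel"
proof -
  interpret U: prob_space "unif n" by (rule prob_space_unif)
  show "mcos n \<alpha> \<in> borel_measurable borel" unfolding mcos_def[abs_def] by measurable
  show "msin n \<alpha> \<in> borel_measurable borel" unfolding msin_def[abs_def] by measurable
qed

lemma mtrig_b: "\<bar>mcos n \<alpha> x\<bar> \<le> A" "\<bar>msin n \<alpha> x\<bar> \<le> A"
proof -
  interpret U: prob_space "unif n" by (rule prob_space_unif)
  have i: "integrable (unif n) (\<lambda>s. \<alpha> s * cos (x \<bullet> s))" "integrable (unif n) (\<lambda>s. \<alpha> s * sin (x \<bullet> s))"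
    by (rule U.integrable_const_bound[where B=A]; (use trig_b in simp)?; measurable)+
  show "\<bar>mcos n \<alpha> x\<bar> \<le> A" "\<bar>msin n \<alpha> x\<bar> \<le> A"
    unfolding mcos_def msin_def
    by (rule order_trans[OF integral_abs_bound], rule U.integral_le_const, use i trig_b in auto)+
qed

lemma dtrig_measurable [measurable]:
  "(\<lambda>(w, x). dcos n \<alpha> w x) \<in> borel_measurable (M \<Otimes>\<^sub>M lborel)"
  "(\<lambda>(w, x). dsin n \<alpha> w x) \<in> borel_measurable (M \<Otimes>\<^sub>M lborel)"
  "(\<lambda>x. dcos n \<alpha> w x) \<in> borel_measurable borel" "(\<lambda>x. dsin n \<alpha> w x) \<in> borel_measurable borel"
  unfolding dcos_def[abs_def] dsin_def[abs_def] by measurable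

lemma sample_trig_b:
  "\<bar>(\<Sum>j=1..n. \<alpha> (S n j w) * cos (x \<bullet> S n j w)) / real n\<bar> \<le> A"
  "\<bar>(\<Sum>j=1..n. \<alpha> (S n j w) * sin (x \<bullet> S n j w)) / real n\<bar> \<le> A"
proof -
  have "\<bar>\<Sum>j=1..n. \<alpha> (S n j w) * cos (x \<bullet> S n j w)\<bar> \<le> (\<Sum>j=1..n. A)" "\<bar>\<Sum>j=1..n. \<alpha> (S n j w) * sin (x \<bullet> S n j w)\<bar> \<le> (\<Sum>j=1..n. A)"
    by (rule order_trans[OF sum_abs], rule sum_mono, rule trig_b)+
  then show "\<bar>(\<Sum>j=1..n. \<alpha> (S n j w) * cos (x \<bullet> S n j w)) / real n\<bar> \<le> A"
    "\<bar>(\<Sum>j=1..n. \<alpha> (S n j w) * sin (x \<bullet> S n j w)) / real n\<bar> \<le> A"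
    using A_nonneg by (cases "n = 0"; simp add: abs_divide divide_le_eq mult.commute)+
qed

lemma dtrig_b: "\<bar>dcos n \<alpha> w x\<bar> \<le> 2 * A" "\<bar>dsin n \<alpha> w x\<bar> \<le> 2 * A"
  using sample_trig_b[of n w x] mtrig_b[of n x] unfolding dcos_def dsin_def by linarith+

lemma dtrig_moment:
  assumes n: "1 \<le> n"
  shows "expectation (\<lambda>w. dcos n \<alpha> w x ^ (2 * p)) \<le> 2 * fact (2 * p) * exp (A\<^sup>2 / 2) / real n ^ p"
    and "expectation (\<lambda>w. dsin n \<alpha> w x ^ (2 * p)) \<le> 2 * fact (2 * p) * exp (A\<^sup>2 / 2) / real n ^ p"
proof -
  have *: "expectation (\<lambda>w. g (S n j w)) = (\<integral>s. g s \<partial>unif n)"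
    if j: "j \<in> {1..n}" and [measurable]: "g \<in> borel_measurable borel" for g :: "real^2 \<Rightarrow> real" and j
    unfolding unif_def distr_S[OF j, symmetric] using j by (subst integral_distr) auto
  have "indep_vars (\<lambda>_. borel) (\<lambda>j w. \<alpha> (S n j w) * cos (x \<bullet> S n j w)) {1..n}"
    by (rule indep_vars_compose2[OF indep_S]) measurable
  then show "expectation (\<lambda>w. dcos n \<alpha> w x ^ (2 * p)) \<le> 2 * fact (2 * p) * exp (A\<^sup>2 / 2) / real n ^ p"
    unfolding dcos_def
  proof (rule sample_mean_moment_bound[OF _ n])
    show "expectation (\<lambda>w. \<alpha> (S n j w) * cos (x \<bullet> S n j w)) = mcos n \<alpha> x" if "j \<in> {1..n}" for j
      unfolding mcos_def by (rule *[OF that]) measurable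
  qed (rule trig_b)
  have "indep_vars (\<lambda>_. borel) (\<lambda>j w. \<alpha> (S n j w) * sin (x \<bullet> S n j w)) {1..n}"
    by (rule indep_vars_compose2[OF indep_S]) measurable
  then show "expectation (\<lambda>w. dsin n \<alpha> w x ^ (2 * p)) \<le> 2 * fact (2 * p) * exp (A\<^sup>2 / 2) / real n ^ p"
    unfolding dsin_def
  proof (rule sample_mean_moment_bound[OF _ n])
    show "expectation (\<lambda>w. \<alpha> (S n j w) * sin (x \<bullet> S n j w)) = msin n \<alpha> x" if "j \<in> {1..n}" for j
      unfolding msin_def by (rule *[OF that]) measurable
  qed (rule trig_b)
qed

lemma dtrig_square_b: "(dcos n \<alpha> w x)\<^sup>2 + (dsin n \<alpha> w x)\<^sup>2 \<le> 8 * A\<^sup>2"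
proof -
  have "(dcos n \<alpha> w x)\<^sup>2 \<le> (2 * A)\<^sup>2" "(dsin n \<alpha> w x)\<^sup>2 \<le> (2 * A)\<^sup>2"
    using power_mono[OF dtrig_b(1)[of n w x] abs_ge_zero, of 2] power_mono[OF dtrig_b(2)[of n w x] abs_ge_zero, of 2] by simp_all
  then show ?thesis by (simp add: power_mult_distrib)
qed

lemma mtrig_square_b: "(mcos n \<alpha> x)\<^sup>2 + (msin n \<alpha> x)\<^sup>2 \<le> 8 * A\<^sup>2"
proof -
  have "(mcos n \<alpha> x)\<^sup>2 \<le> A\<^sup>2" "(msin n \<alpha> x)\<^sup>2 \<le> A\<^sup>2"
    using power_mono[OF mtrig_b(1)[of n x] abs_ge_zero, of 2] power_mono[OF mtrig_b(2)[of n x] abs_ge_zero, of 2] by simp_all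
  moreover have "0 \<le> A\<^sup>2" by simp
  ultimately show ?thesis by linarith
qed

lemma weighted_integrable:
  assumes [measurable]: "Y \<in> borel_measurable borel" and b: "\<And>x. \<bar>Y x\<bar> \<le> B"
  shows "integrable lborel (\<lambda>x. \<bar>f x\<bar> * Y x)" "integrable lborel (\<lambda>x. f x * Y x)"
proof -
  have i: "integrable lborel (\<lambda>x. B * \<bar>f x\<bar>)" using f_integrable by simp
  have *: "\<bar>f x\<bar> * \<bar>Y x\<bar> \<le> \<bar>B\<bar> * \<bar>f x\<bar>" for x
  proof -
    have "\<bar>Y x\<bar> \<le> \<bar>B\<bar>" using b[of x] by linarith
    then show ?thesis by (subst mult.commute) (rule mult_right_mono, simp_all)
  qed
  show "integrable lborel (\<lambda>x. \<bar>f x\<bar> * Y x)"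
    by (rule Bochner_Integration.integrable_bound[OF i]) (use * in \<open>auto simp: abs_mult intro!: AE_I2\<close>)
  show "integrable lborel (\<lambda>x. f x * Y x)"
    by (rule Bochner_Integration.integrable_bound[OF i]) (use * in \<open>auto simp: abs_mult intro!: AE_I2\<close>)
qed

lemma mass_integrable: "integrable lborel (\<lambda>x. \<bar>f x\<bar> * ((mcos n \<alpha> x)\<^sup>2 + (msin n \<alpha> x)\<^sup>2))"
  using mtrig_square_b by (intro weighted_integrable(1)[where B="8 * A\<^sup>2"]) auto

lemma dmass_integrable: "integrable lborel (\<lambda>x. \<bar>f x\<bar> * ((dcos n \<alpha> w x)\<^sup>2 + (dsin n \<alpha> w x)\<^sup>2))"
  using dtrig_square_b by (intro weighted_integrable(1)[where B="8 * A\<^sup>2"]) auto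

lemma dmass_nonneg: "0 \<le> dmass n \<alpha> w" and mass_nonneg: "0 \<le> mass n \<alpha>"
  unfolding dmass_def mass_def by (intro integral_nonneg_AE AE_I2; simp)+

lemma dmass_measurable [measurable]: "dmass n \<alpha> \<in> borel_measurable M"
proof -
  have "integrable M (\<lambda>w. \<integral>x. \<bar>f x\<bar> * ((dcos n \<alpha> w x)\<^sup>2 + (dsin n \<alpha> w x)\<^sup>2) \<partial>lborel)"
    by (rule Fubini_weighted(1)[where B="8 * A\<^sup>2"]) (use f_integrable dtrig_square_b in auto)
  then show ?thesis unfolding dmass_def[abs_def] by (rule borel_measurable_integrable)
qed

text \<open>Jensen's inequality with weight |f| moves the power inside the frequency integral, and
  Fubini's theorem then moves the expectation inside. The remaining pointwise deviation moments are
  of order n^(-p-1) uniformly in the frequency.\<close>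

lemma dmass_moment:
  assumes n: "1 \<le> n"
  shows "integrable M (\<lambda>w. dmass n \<alpha> w ^ q)"
    and "expectation (\<lambda>w. dmass n \<alpha> w ^ Suc p) \<le> dmassK A p / real n ^ Suc p"
proof -
  have af: "integrable lborel (\<lambda>x. \<bar>f x\<bar>)" using f_integrable by simp
  let ?F = "\<integral>x. \<bar>f x\<bar> \<partial>lborel"
  have dm_b: "dmass n \<alpha> w \<le> 8 * A\<^sup>2 * ?F" for w
  proof -
    have "dmass n \<alpha> w \<le> (\<integral>x. 8 * A\<^sup>2 * \<bar>f x\<bar> \<partial>lborel)"
      unfolding dmass_def
      by (rule integral_mono[OF dmass_integrable]) (use af dtrig_square_b in \<open>auto simp: mult.commute mult_left_mono\<close>)
    then show ?thesis by simp
  qed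
  show i: "integrable M (\<lambda>w. dmass n \<alpha> w ^ q)" for q
    by (rule integrable_const_bound[where B="(8 * A\<^sup>2 * ?F) ^ q"])
       (use dm_b dmass_nonneg in \<open>auto intro!: AE_I2 power_mono simp: power_abs\<close>)
  let ?Y = "\<lambda>w x. dcos n \<alpha> w x ^ (2 * Suc p) + dsin n \<alpha> w x ^ (2 * Suc p)"
  have pb: "\<bar>?Y w x\<bar> \<le> (2 * A) ^ (2 * Suc p) + (2 * A) ^ (2 * Suc p)" for w x
    by (rule order_trans[OF abs_triangle_ineq add_mono]) (auto simp only: power_abs intro!: power_mono dtrig_b abs_ge_zero)
  have Ym: "(\<lambda>(w, x). ?Y w x) \<in> borel_measurable (M \<Otimes>\<^sub>M lborel)" by measurable
  have pw: "dmass n \<alpha> w ^ Suc p \<le> ?F ^ p * 2 ^ Suc p * (\<integral>x. \<bar>f x\<bar> * ?Y w x \<partial>lborel)" for w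
  proof -
    have 1: "dmass n \<alpha> w ^ Suc p \<le> ?F ^ p * (\<integral>x. \<bar>f x\<bar> * ((dcos n \<alpha> w x)\<^sup>2 + (dsin n \<alpha> w x)\<^sup>2) ^ Suc p \<partial>lborel)"
      unfolding dmass_def by (rule jensen_power[OF af, where B="8 * A\<^sup>2"]) (use dtrig_square_b in auto)
    have "(\<integral>x. \<bar>f x\<bar> * ((dcos n \<alpha> w x)\<^sup>2 + (dsin n \<alpha> w x)\<^sup>2) ^ Suc p \<partial>lborel) \<le> (\<integral>x. 2 ^ Suc p * (\<bar>f x\<bar> * ?Y w x) \<partial>lborel)"
    proof (rule integral_mono_AE')
      show "integrable lborel (\<lambda>x. 2 ^ Suc p * (\<bar>f x\<bar> * ?Y w x))"
        by (rule integrable_mult_right, rule weighted_integrable(1)[OF _ pb]) measurable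
      show "AE x in lborel. \<bar>f x\<bar> * ((dcos n \<alpha> w x)\<^sup>2 + (dsin n \<alpha> w x)\<^sup>2) ^ Suc p \<le> 2 ^ Suc p * (\<bar>f x\<bar> * ?Y w x)"
      proof (intro AE_I2)
        fix x
        have "((dcos n \<alpha> w x)\<^sup>2 + (dsin n \<alpha> w x)\<^sup>2) ^ Suc p \<le> 2 ^ Suc p * (((dcos n \<alpha> w x)\<^sup>2) ^ Suc p + ((dsin n \<alpha> w x)\<^sup>2) ^ Suc p)"
          by (rule power_add_le) auto
        also have "\<dots> = 2 ^ Suc p * ?Y w x" by (simp only: power_mult)
        finally have "\<bar>f x\<bar> * ((dcos n \<alpha> w x)\<^sup>2 + (dsin n \<alpha> w x)\<^sup>2) ^ Suc p \<le> \<bar>f x\<bar> * (2 ^ Suc p * ?Y w x)"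
          by (rule mult_left_mono) simp
        then show "\<bar>f x\<bar> * ((dcos n \<alpha> w x)\<^sup>2 + (dsin n \<alpha> w x)\<^sup>2) ^ Suc p \<le> 2 ^ Suc p * (\<bar>f x\<bar> * ?Y w x)"
          by (simp only: mult.left_commute)
      qed
      show "AE x in lborel. 0 \<le> 2 ^ Suc p * (\<bar>f x\<bar> * ?Y w x)"
        by (intro AE_I2 mult_nonneg_nonneg add_nonneg_nonneg zero_le_even_power' zero_le_power abs_ge_zero) simp
    qed
    also have "\<dots> = 2 ^ Suc p * (\<integral>x. \<bar>f x\<bar> * ?Y w x \<partial>lborel)" by (rule integral_mult_right_zero)
    finally have "?F ^ p * (\<integral>x. \<bar>f x\<bar> * ((dcos n \<alpha> w x)\<^sup>2 + (dsin n \<alpha> w x)\<^sup>2) ^ Suc p \<partial>lborel)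
        \<le> ?F ^ p * (2 ^ Suc p * (\<integral>x. \<bar>f x\<bar> * ?Y w x \<partial>lborel))"
      by (rule mult_left_mono) simp
    with 1 show ?thesis unfolding mult.assoc by (rule order_trans)
  qed
  have "expectation (\<lambda>w. dmass n \<alpha> w ^ Suc p) \<le> expectation (\<lambda>w. ?F ^ p * 2 ^ Suc p * (\<integral>x. \<bar>f x\<bar> * ?Y w x \<partial>lborel))"
    by (rule integral_mono[OF i _ pw], rule integrable_mult_right, rule Fubini_weighted(1)[OF af Ym pb])
  also have "\<dots> = ?F ^ p * 2 ^ Suc p * (\<integral>x. \<bar>f x\<bar> * expectation (\<lambda>w. ?Y w x) \<partial>lborel)"
    by (simp only: integral_mult_right_zero Fubini_weighted(2)[OF af Ym pb])
  finally have 2: "expectation (\<lambda>w. dmass n \<alpha> w ^ Suc p) \<le> ?F ^ p * 2 ^ Suc p * (\<integral>x. \<bar>f x\<bar> * expectation (\<lambda>w. ?Y w x) \<partial>lborel)" .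
  have "(\<integral>x. \<bar>f x\<bar> * expectation (\<lambda>w. ?Y w x) \<partial>lborel) \<le> (\<integral>x. (4 * fact (2 * Suc p) * exp (A\<^sup>2 / 2) / real n ^ Suc p) * \<bar>f x\<bar> \<partial>lborel)"
  proof (rule integral_mono_AE')
    show "integrable lborel (\<lambda>x. (4 * fact (2 * Suc p) * exp (A\<^sup>2 / 2) / real n ^ Suc p) * \<bar>f x\<bar>)" using af by simp
    have e: "expectation (\<lambda>w. ?Y w x) = expectation (\<lambda>w. dcos n \<alpha> w x ^ (2 * Suc p)) + expectation (\<lambda>w. dsin n \<alpha> w x ^ (2 * Suc p))" for x
    proof (rule Bochner_Integration.integral_add)
      have [measurable]: "(\<lambda>w. dcos n \<alpha> w x) \<in> borel_measurable M" "(\<lambda>w. dsin n \<alpha> w x) \<in> borel_measurable M"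
        unfolding dcos_def dsin_def by measurable
      show "integrable M (\<lambda>w. dcos n \<alpha> w x ^ (2 * Suc p))"
        by (rule integrable_const_bound[where B="(2 * A) ^ (2 * Suc p)"]) (auto simp only: power_abs real_norm_def intro!: AE_I2 power_mono dtrig_b abs_ge_zero, measurable)
      show "integrable M (\<lambda>w. dsin n \<alpha> w x ^ (2 * Suc p))"
        by (rule integrable_const_bound[where B="(2 * A) ^ (2 * Suc p)"]) (auto simp only: power_abs real_norm_def intro!: AE_I2 power_mono dtrig_b abs_ge_zero, measurable)
    qed
    show "AE x in lborel. \<bar>f x\<bar> * expectation (\<lambda>w. ?Y w x) \<le> (4 * fact (2 * Suc p) * exp (A\<^sup>2 / 2) / real n ^ Suc p) * \<bar>f x\<bar>"
    proof (intro AE_I2)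
      fix x
      have "expectation (\<lambda>w. ?Y w x) \<le> 4 * fact (2 * Suc p) * exp (A\<^sup>2 / 2) / real n ^ Suc p"
      proof -
        have "2 * F * E / N + 2 * F * E / N = 4 * F * E / N" for F E N :: real by simp
        then show ?thesis unfolding e using add_mono[OF dtrig_moment[OF n, of x "Suc p"]] by (simp only:)
      qed
      then show "\<bar>f x\<bar> * expectation (\<lambda>w. ?Y w x) \<le> (4 * fact (2 * Suc p) * exp (A\<^sup>2 / 2) / real n ^ Suc p) * \<bar>f x\<bar>"
        by (subst mult.commute) (rule mult_right_mono, simp_all)
    qed
    show "AE x in lborel. 0 \<le> (4 * fact (2 * Suc p) * exp (A\<^sup>2 / 2) / real n ^ Suc p) * \<bar>f x\<bar>"
      by simp
  qed
  also have "\<dots> = (4 * fact (2 * Suc p) * exp (A\<^sup>2 / 2) / real n ^ Suc p) * ?F" by (rule integral_mult_right_zero)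
  finally have "?F ^ p * 2 ^ Suc p * (\<integral>x. \<bar>f x\<bar> * expectation (\<lambda>w. ?Y w x) \<partial>lborel)
      \<le> ?F ^ p * 2 ^ Suc p * ((4 * fact (2 * Suc p) * exp (A\<^sup>2 / 2) / real n ^ Suc p) * ?F)"
    by (rule mult_left_mono) simp
  also have "\<dots> = dmassK A p / real n ^ Suc p" unfolding dmassK_def by (simp only: times_divide_eq_left times_divide_eq_right mult_ac)
  finally show "expectation (\<lambda>w. dmass n \<alpha> w ^ Suc p) \<le> dmassK A p / real n ^ Suc p" using 2 by linarith
qed

end


section \<open>Conditional covariances in the frequency domain\<close>

text \<open>Writing c(s_j - s_i) as a cosine integral of f separates the two locations, since cos(x
  s_j - x s_i) splits into a product of cosines plus a product of sines. The double sum thereby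
  becomes an integral of products of empirical transforms.\<close>

lemma quad_spectral:
  assumes n: "1 \<le> n" and [measurable]: "\<alpha> \<in> borel_measurable borel" "\<beta> \<in> borel_measurable borel"
  shows "quad n \<alpha> \<beta> w / (real n)\<^sup>2 =
    (\<integral>x. f x * ((mcos n \<alpha> x + dcos n \<alpha> w x) * (mcos n \<beta> x + dcos n \<beta> w x)
       + (msin n \<alpha> x + dsin n \<alpha> w x) * (msin n \<beta> x + dsin n \<beta> w x)) \<partial>lborel) / (2 * pi)\<^sup>2"
proof -
  let ?s = "\<lambda>j. S n j w"
  have pw: "f x * ((mcos n \<alpha> x + dcos n \<alpha> w x) * (mcos n \<beta> x + dcos n \<beta> w x)
       + (msin n \<alpha> x + dsin n \<alpha> w x) * (msin n \<beta> x + dsin n \<beta> w x))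
     = (\<Sum>i=1..n. \<Sum>j=1..n. \<alpha> (?s i) * \<beta> (?s j) / (real n)\<^sup>2 * (f x * cos (x \<bullet> (?s j - ?s i))))" (is "?L = ?R") for x
  proof -
    let ?a = "\<lambda>j. \<alpha> (?s j)" and ?b = "\<lambda>j. \<beta> (?s j)" and ?t = "\<lambda>j. x \<bullet> ?s j"
    have "?L = f x * ((\<Sum>i=1..n. ?a i * cos (?t i)) / real n * ((\<Sum>j=1..n. ?b j * cos (?t j)) / real n)
      + (\<Sum>i=1..n. ?a i * sin (?t i)) / real n * ((\<Sum>j=1..n. ?b j * sin (?t j)) / real n))"
      by (simp add: dcos_def dsin_def)
    also have "\<dots> = f x / (real n)\<^sup>2 * ((\<Sum>i=1..n. ?a i * cos (?t i)) * (\<Sum>j=1..n. ?b j * cos (?t j))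
      + (\<Sum>i=1..n. ?a i * sin (?t i)) * (\<Sum>j=1..n. ?b j * sin (?t j)))"
      by (simp add: power2_eq_square flip: add_divide_distrib)
    also have "\<dots> = f x / (real n)\<^sup>2 * (\<Sum>i=1..n. \<Sum>j=1..n. ?a i * ?b j * cos (?t j - ?t i))"
      unfolding sum_product sum.distrib[symmetric]
      by (intro arg_cong[where f="\<lambda>y. f x / (real n)\<^sup>2 * y"] sum.cong refl) (simp add: cos_diff algebra_simps)
    also have "\<dots> = ?R"
      unfolding sum_distrib_left by (intro sum.cong refl) (simp add: inner_diff_right)
    finally show ?thesis .
  qed
  have "(\<integral>x. (\<Sum>i=1..n. \<Sum>j=1..n. \<alpha> (?s i) * \<beta> (?s j) / (real n)\<^sup>2 * (f x * cos (x \<bullet> (?s j - ?s i)))) \<partial>lborel)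
     = (\<Sum>i=1..n. \<Sum>j=1..n. \<alpha> (?s i) * \<beta> (?s j) / (real n)\<^sup>2 * (\<integral>x. f x * cos (x \<bullet> (?s j - ?s i)) \<partial>lborel))"
    using trig_weighted_integrable(1)[OF f_integrable] by simp
  also have "\<dots> = (\<Sum>i=1..n. \<Sum>j=1..n. \<alpha> (?s i) * \<beta> (?s j) / (real n)\<^sup>2 * ((2 * pi)\<^sup>2 * c (?s j - ?s i)))"
    by (simp add: c_eq)
  also have "\<dots> = (2 * pi)\<^sup>2 * (quad n \<alpha> \<beta> w / (real n)\<^sup>2)"
    unfolding quad_def sum_divide_distrib sum_distrib_left by (intro sum.cong refl) simp
  finally show ?thesis unfolding pw by simp
qed

text \<open>The arithmetic-geometric inequality with a free weight t for the two cross terms, and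
  with weight 1 for the product of the deviations.\<close>

lemma deviation_pointwise:
  fixes a b x y t :: real
  assumes t: "0 < t"
  shows "\<bar>(a + x) * (b + y) - a * b\<bar> \<le> (t * (a\<^sup>2 + b\<^sup>2) + (1 / t + 1) * (x\<^sup>2 + y\<^sup>2)) / 2"
proof -
  have am: "\<bar>p * q\<bar> \<le> (t * p\<^sup>2 + q\<^sup>2 / t) / 2" for p q
  proof -
    have "0 \<le> (t * \<bar>p\<bar> - \<bar>q\<bar>)\<^sup>2 / t" using t by simp
    also have "(t * \<bar>p\<bar> - \<bar>q\<bar>)\<^sup>2 / t = t * p\<^sup>2 + q\<^sup>2 / t - 2 * \<bar>p * q\<bar>"
      using t by (simp add: power2_diff power_mult_distrib abs_mult field_simps power2_eq_square)
    finally show ?thesis by simp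
  qed
  have xy: "\<bar>x * y\<bar> \<le> (x\<^sup>2 + y\<^sup>2) / 2"
    using sum_squares_bound[of "\<bar>x\<bar>" "\<bar>y\<bar>"] by (simp add: abs_mult)
  have "(a + x) * (b + y) - a * b = a * y + b * x + x * y" by (simp add: algebra_simps)
  also have "\<bar>\<dots>\<bar> \<le> \<bar>a * y\<bar> + \<bar>b * x\<bar> + \<bar>x * y\<bar>" by linarith
  also have "\<dots> \<le> (t * a\<^sup>2 + y\<^sup>2 / t) / 2 + (t * b\<^sup>2 + x\<^sup>2 / t) / 2 + (x\<^sup>2 + y\<^sup>2) / 2"
    by (intro add_mono am xy)
  also have "\<dots> = (t * (a\<^sup>2 + b\<^sup>2) + (1 / t + 1) * (x\<^sup>2 + y\<^sup>2)) / 2"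
    by (simp add: field_simps)
  finally show ?thesis .
qed

lemma two_pi_square_ge_1: "1 \<le> (2 * pi)\<^sup>2"
proof -
  have "1 \<le> 2 * pi" using pi_gt3 by linarith
  then show ?thesis by (rule one_le_power)
qed

text \<open>The free weight t replaces the square roots of a Cauchy-Schwarz bound and keeps the
  estimate linear in \<open>mass\<close> and \<open>dmass\<close>. A fixed t gives a uniform bound;
  letting t tend to 0 with n gives convergence. The factor (2 pi)^(-2) is estimated by 1.\<close>

lemma quad_deviation:
  assumes n: "1 \<le> n" and t: "0 < t"
    and a[measurable]: "\<alpha> \<in> borel_measurable borel" and ab: "\<And>x. \<bar>\<alpha> x\<bar> \<le> A"
    and b[measurable]: "\<beta> \<in> borel_measurable borel" and bb: "\<And>x. \<bar>\<beta> x\<bar> \<le> A"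
  shows "\<bar>quad n \<alpha> \<beta> w / (real n)\<^sup>2 - qbar n \<alpha> \<beta>\<bar> \<le>
    t * (mass n \<alpha> + mass n \<beta>) + (1 / t + 1) * (dmass n \<alpha> w + dmass n \<beta> w)"
proof -
  note [measurable] = mtrig_measurable[OF a ab] mtrig_measurable[OF b bb] dtrig_measurable[OF a ab] dtrig_measurable[OF b bb]
  let ?P = "\<lambda>x. (mcos n \<alpha> x + dcos n \<alpha> w x) * (mcos n \<beta> x + dcos n \<beta> w x)
       + (msin n \<alpha> x + dsin n \<alpha> w x) * (msin n \<beta> x + dsin n \<beta> w x)"
  let ?Q = "\<lambda>x. mcos n \<alpha> x * mcos n \<beta> x + msin n \<alpha> x * msin n \<beta> x"
  let ?m = "\<lambda>\<alpha> x. \<bar>f x\<bar> * ((mcos n \<alpha> x)\<^sup>2 + (msin n \<alpha> x)\<^sup>2)"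
  let ?d = "\<lambda>\<alpha> x. \<bar>f x\<bar> * ((dcos n \<alpha> w x)\<^sup>2 + (dsin n \<alpha> w x)\<^sup>2)"
  have A0: "0 \<le> A" using ab[of 0] by linarith
  have mul: "\<bar>p * q\<bar> \<le> K * K" if "\<bar>p\<bar> \<le> K" "\<bar>q\<bar> \<le> K" for p q K :: real
    unfolding abs_mult using that by (intro mult_mono) auto
  have m3: "\<bar>p + q\<bar> \<le> 3 * A" if "\<bar>p\<bar> \<le> A" "\<bar>q\<bar> \<le> 2 * A" for p q using that by linarith
  have iP: "integrable lborel (\<lambda>x. f x * ?P x)"
  proof (rule weighted_integrable(2)[OF a ab, where B="3*A*(3*A) + 3*A*(3*A)"])
    show "\<bar>?P x\<bar> \<le> 3*A*(3*A) + 3*A*(3*A)" for x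
      by (rule order_trans[OF abs_triangle_ineq], intro add_mono mul m3 mtrig_b[OF a ab] mtrig_b[OF b bb] dtrig_b[OF a ab] dtrig_b[OF b bb])
  qed measurable
  have iQ: "integrable lborel (\<lambda>x. f x * ?Q x)"
  proof (rule weighted_integrable(2)[OF a ab, where B="A*A + A*A"])
    show "\<bar>?Q x\<bar> \<le> A*A + A*A" for x
      by (rule order_trans[OF abs_triangle_ineq], intro add_mono mul mtrig_b[OF a ab] mtrig_b[OF b bb])
  qed measurable
  note im = mass_integrable[OF a ab, of n] mass_integrable[OF b bb, of n] dmass_integrable[OF a ab, of n w] dmass_integrable[OF b bb, of n w]
  have dist: "F * ((t * (a1 + b1) + k * (c1 + d1)) / 2 + (t * (a2 + b2) + k * (c2 + d2)) / 2)
     = (t * (F * (a1 + a2) + F * (b1 + b2)) + k * (F * (c1 + c2) + F * (d1 + d2))) / 2" for F k a1 a2 b1 b2 c1 c2 d1 d2 :: real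
    by (simp add: algebra_simps add_divide_distrib)
  let ?R = "\<lambda>x. (t * (?m \<alpha> x + ?m \<beta> x) + (1 / t + 1) * (?d \<alpha> x + ?d \<beta> x)) / 2"
  have iR: "integrable lborel ?R" using im by simp
  have e: "quad n \<alpha> \<beta> w / (real n)\<^sup>2 - qbar n \<alpha> \<beta> = (\<integral>x. f x * ?P x - f x * ?Q x \<partial>lborel) / (2 * pi)\<^sup>2"
    unfolding quad_spectral[OF n a b] qbar_def using iP iQ by (simp add: diff_divide_distrib)
  have "\<bar>quad n \<alpha> \<beta> w / (real n)\<^sup>2 - qbar n \<alpha> \<beta>\<bar> \<le> \<bar>\<integral>x. f x * ?P x - f x * ?Q x \<partial>lborel\<bar> / 1"
    unfolding e abs_divide by (rule divide_left_mono) (use two_pi_square_ge_1 in auto)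
  also have "\<dots> \<le> (\<integral>x. \<bar>f x * ?P x - f x * ?Q x\<bar> \<partial>lborel)"
    unfolding div_by_1 by (rule integral_abs_bound)
  also have "\<dots> \<le> (\<integral>x. ?R x \<partial>lborel)"
  proof (rule integral_mono)
    show "integrable lborel (\<lambda>x. \<bar>f x * ?P x - f x * ?Q x\<bar>)" using iP iQ by simp
    fix x
    have "\<bar>?P x - ?Q x\<bar> \<le> \<bar>(mcos n \<alpha> x + dcos n \<alpha> w x) * (mcos n \<beta> x + dcos n \<beta> w x) - mcos n \<alpha> x * mcos n \<beta> x\<bar>
       + \<bar>(msin n \<alpha> x + dsin n \<alpha> w x) * (msin n \<beta> x + dsin n \<beta> w x) - msin n \<alpha> x * msin n \<beta> x\<bar>" by linarith
    also have "\<dots> \<le> (t * ((mcos n \<alpha> x)\<^sup>2 + (mcos n \<beta> x)\<^sup>2) + (1 / t + 1) * ((dcos n \<alpha> w x)\<^sup>2 + (dcos n \<beta> w x)\<^sup>2)) / 2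
      + (t * ((msin n \<alpha> x)\<^sup>2 + (msin n \<beta> x)\<^sup>2) + (1 / t + 1) * ((dsin n \<alpha> w x)\<^sup>2 + (dsin n \<beta> w x)\<^sup>2)) / 2" (is "_ \<le> ?r")
      by (intro add_mono deviation_pointwise t)
    finally have "\<bar>f x\<bar> * \<bar>?P x - ?Q x\<bar> \<le> \<bar>f x\<bar> * ?r" by (rule mult_left_mono) simp
    moreover have "\<bar>f x * ?P x - f x * ?Q x\<bar> = \<bar>f x\<bar> * \<bar>?P x - ?Q x\<bar>"
      by (simp only: right_diff_distrib[symmetric] abs_mult)
    moreover have "\<bar>f x\<bar> * ?r = ?R x" by (rule dist)
    ultimately show "\<bar>f x * ?P x - f x * ?Q x\<bar> \<le> ?R x" by linarith
  qed (rule iR)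
  also have "\<dots> = (t * (mass n \<alpha> + mass n \<beta>) + (1 / t + 1) * (dmass n \<alpha> w + dmass n \<beta> w)) / 2"
    unfolding mass_def dmass_def using im by simp
  also have "\<dots> \<le> t * (mass n \<alpha> + mass n \<beta>) + (1 / t + 1) * (dmass n \<alpha> w + dmass n \<beta> w)"
  proof -
    have "0 \<le> t * (mass n \<alpha> + mass n \<beta>) + (1 / t + 1) * (dmass n \<alpha> w + dmass n \<beta> w)"
      using t by (intro add_nonneg_nonneg mult_nonneg_nonneg mass_nonneg[OF a ab] mass_nonneg[OF b bb] dmass_nonneg[OF a ab] dmass_nonneg[OF b bb]) auto
    then show ?thesis by simp
  qed
  finally show ?thesis .
qed

lemma qbar_le_mass:
  assumes a[measurable]: "\<alpha> \<in> borel_measurable borel" and ab: "\<And>x. \<bar>\<alpha> x\<bar> \<le> A"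
  shows "\<bar>qbar n \<alpha> \<alpha>\<bar> \<le> mass n \<alpha>"
proof -
  have "\<bar>qbar n \<alpha> \<alpha>\<bar> \<le> \<bar>\<integral>x. f x * (mcos n \<alpha> x * mcos n \<alpha> x + msin n \<alpha> x * msin n \<alpha> x) \<partial>lborel\<bar> / 1"
    unfolding qbar_def abs_divide by (rule divide_left_mono) (use two_pi_square_ge_1 in auto)
  also have "\<dots> \<le> (\<integral>x. \<bar>f x * (mcos n \<alpha> x * mcos n \<alpha> x + msin n \<alpha> x * msin n \<alpha> x)\<bar> \<partial>lborel)"
    using integral_abs_bound by simp
  also have "\<dots> = mass n \<alpha>" unfolding mass_def
    by (intro Bochner_Integration.integral_cong refl) (simp add: abs_mult power2_eq_square)
  finally show ?thesis .
qed

text \<open>Here the weight is 1, since only a bound is wanted. The first term will carry the decay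
  in frequency; the second is the sampling noise, of the same size at all frequencies.\<close>

lemma quad_moment_bound:
  assumes n: "1 \<le> n"
    and a[measurable]: "\<alpha> \<in> borel_measurable borel" and ab: "\<And>x. \<bar>\<alpha> x\<bar> \<le> A"
  shows "expectation (\<lambda>w. ((lam n)\<^sup>2 / (real n)\<^sup>2 * quad n \<alpha> \<alpha> w) ^ Suc p)
     \<le> 8 ^ Suc p * (((lam n)\<^sup>2 * mass n \<alpha>) ^ Suc p + dmassK A p * ((lam n)\<^sup>2 / real n) ^ Suc p)"
proof -
  note dm = dmass_moment[OF a ab n]
  note m0 = mass_nonneg[OF a ab] dmass_nonneg[OF a ab]
  let ?L = "(lam n)\<^sup>2"
  have pw: "?L / (real n)\<^sup>2 * quad n \<alpha> \<alpha> w \<le> ?L * (4 * mass n \<alpha> + 4 * dmass n \<alpha> w)" for w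
  proof -
    have "\<bar>quad n \<alpha> \<alpha> w / (real n)\<^sup>2 - qbar n \<alpha> \<alpha>\<bar> \<le> 2 * mass n \<alpha> + 4 * dmass n \<alpha> w"
      using quad_deviation[OF n zero_less_one a ab a ab, of w] by simp
    moreover note qbar_le_mass[OF a ab, of n]
    ultimately have "quad n \<alpha> \<alpha> w / (real n)\<^sup>2 \<le> 4 * mass n \<alpha> + 4 * dmass n \<alpha> w"
      using m0(1)[of n] by linarith
    from mult_left_mono[OF this, of ?L] show ?thesis by simp
  qed
  have pw2: "(?L / (real n)\<^sup>2 * quad n \<alpha> \<alpha> w) ^ Suc p \<le> 8 ^ Suc p * ((?L * mass n \<alpha>) ^ Suc p + ?L ^ Suc p * dmass n \<alpha> w ^ Suc p)" for w
  proof -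
    have "(?L / (real n)\<^sup>2 * quad n \<alpha> \<alpha> w) ^ Suc p \<le> (?L * (4 * mass n \<alpha> + 4 * dmass n \<alpha> w)) ^ Suc p"
      by (intro power_mono pw mult_nonneg_nonneg divide_nonneg_nonneg quad_nonneg) auto
    also have "\<dots> = (4 * (?L * mass n \<alpha>) + 4 * (?L * dmass n \<alpha> w)) ^ Suc p"
      by (simp only: distrib_left mult.left_commute)
    also have "\<dots> \<le> 2 ^ Suc p * ((4 * (?L * mass n \<alpha>)) ^ Suc p + (4 * (?L * dmass n \<alpha> w)) ^ Suc p)"
      by (rule power_add_le) (use m0 in auto)
    also have "\<dots> = (2 ^ Suc p * 4 ^ Suc p) * ((?L * mass n \<alpha>) ^ Suc p + ?L ^ Suc p * dmass n \<alpha> w ^ Suc p)"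
      by (simp only: power_mult_distrib distrib_left mult.assoc)
    also have "2 ^ Suc p * 4 ^ Suc p = (8::real) ^ Suc p" by (simp only: power_mult_distrib[symmetric], simp)
    finally show ?thesis .
  qed
  have "expectation (\<lambda>w. (?L / (real n)\<^sup>2 * quad n \<alpha> \<alpha> w) ^ Suc p)
     \<le> expectation (\<lambda>w. 8 ^ Suc p * ((?L * mass n \<alpha>) ^ Suc p + ?L ^ Suc p * dmass n \<alpha> w ^ Suc p))"
  proof (rule integral_mono_AE')
    show "integrable M (\<lambda>w. 8 ^ Suc p * ((?L * mass n \<alpha>) ^ Suc p + ?L ^ Suc p * dmass n \<alpha> w ^ Suc p))"
      using dm(1)[of "Suc p"] by (intro integrable_mult_right Bochner_Integration.integrable_add) auto
    show "AE w in M. (?L / (real n)\<^sup>2 * quad n \<alpha> \<alpha> w) ^ Suc p \<le> 8 ^ Suc p * ((?L * mass n \<alpha>) ^ Suc p + ?L ^ Suc p * dmass n \<alpha> w ^ Suc p)"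
      by (intro AE_I2 pw2)
    show "AE w in M. 0 \<le> 8 ^ Suc p * ((?L * mass n \<alpha>) ^ Suc p + ?L ^ Suc p * dmass n \<alpha> w ^ Suc p)"
      by (intro AE_I2 mult_nonneg_nonneg add_nonneg_nonneg zero_le_power zero_le_power2 m0) simp
  qed
  also have "\<dots> = 8 ^ Suc p * ((?L * mass n \<alpha>) ^ Suc p + ?L ^ Suc p * expectation (\<lambda>w. dmass n \<alpha> w ^ Suc p))"
    using dm(1)[of "Suc p"] by (simp add: prob_space del: power_Suc)
  also have "\<dots> \<le> 8 ^ Suc p * ((?L * mass n \<alpha>) ^ Suc p + ?L ^ Suc p * (dmassK A p / real n ^ Suc p))"
    by (intro mult_left_mono add_left_mono dm(2)) auto
  also have "?L ^ Suc p * (dmassK A p / real n ^ Suc p) = dmassK A p * (?L / real n) ^ Suc p"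
    by (simp only: power_divide times_divide_eq_right mult.commute)
  finally show ?thesis .
qed

text \<open>After multiplication by lam^2 the mass stays bounded and the fluctuation is of order
  lam^2/n in every moment, so the distance to the mean form is of order sqrt(lam^2/n). The weights
  may change with n, as the grid frequencies do.\<close>

lemma Lconv_quad:
  fixes \<alpha> \<beta> :: "nat \<Rightarrow> real^2 \<Rightarrow> real"
  assumes a[measurable]: "\<And>n. \<alpha> n \<in> borel_measurable borel" and ab: "\<And>n x. \<bar>\<alpha> n x\<bar> \<le> A"
    and b[measurable]: "\<And>n. \<beta> n \<in> borel_measurable borel" and bb: "\<And>n x. \<bar>\<beta> n x\<bar> \<le> A"
    and ma: "\<forall>\<^sub>F n in sequentially. (lam n)\<^sup>2 * mass n (\<alpha> n) \<le> D" and mb: "\<forall>\<^sub>F n in sequentially. (lam n)\<^sup>2 * mass n (\<beta> n) \<le> D"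
    and rho: "(\<lambda>n. (lam n)\<^sup>2 / real n) \<longlonglongrightarrow> 0"
    and q: "(\<lambda>n. (lam n)\<^sup>2 * qbar n (\<alpha> n) (\<beta> n)) \<longlonglongrightarrow> q"
  shows "Lconv M (\<lambda>n w. (lam n)\<^sup>2 / (real n)\<^sup>2 * quad n (\<alpha> n) (\<beta> n) w) q"
proof -
  let ?L = "\<lambda>n. (lam n)\<^sup>2" and ?r = "\<lambda>n. (lam n)\<^sup>2 / real n"
  let ?X = "\<lambda>n w. ?L n / (real n)\<^sup>2 * quad n (\<alpha> n) (\<beta> n) w + (- (?L n * qbar n (\<alpha> n) (\<beta> n)))"
  have "Lconv M ?X 0"
  proof (rule LconvI)
    fix n
    show "?X n \<in> borel_measurable M" by measurable
    show "\<exists>B. \<forall>w\<in>space M. \<bar>?X n w\<bar> \<le> B"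
    proof (intro exI ballI)
      fix w
      have "\<bar>?L n / (real n)\<^sup>2 * quad n (\<alpha> n) (\<beta> n) w\<bar> \<le> ?L n / (real n)\<^sup>2 * (real n * real n * (A * A * cB))"
        unfolding abs_mult by (intro mult_mono quad_bound ab bb) auto
      then show "\<bar>?X n w\<bar> \<le> ?L n / (real n)\<^sup>2 * (real n * real n * (A * A * cB)) + \<bar>?L n * qbar n (\<alpha> n) (\<beta> n)\<bar>"
        by linarith
    qed
  next
    fix p' :: nat assume "0 < p'"
    then obtain p where p: "p' = Suc p" by (cases p') auto
    \<comment> \<open>\<open>quad_deviation\<close> is used with the parameter \<open>sqrt (lam\<^sup>2 / n)\<close>, which balances its two terms.\<close>
    let ?K = "dmassK A p"
    let ?b = "\<lambda>n. 2 ^ Suc p * ((2 * D * sqrt (?r n)) ^ Suc p + 2 ^ Suc p * (sqrt (?r n) + ?r n) ^ Suc p * (2 * ?K))"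
    have "?b \<longlonglongrightarrow> 2 ^ Suc p * ((2 * D * sqrt 0) ^ Suc p + 2 ^ Suc p * (sqrt 0 + 0) ^ Suc p * (2 * ?K))"
      by (intro tendsto_intros rho)
    then have b0: "?b \<longlonglongrightarrow> 0" by simp
    have "\<forall>\<^sub>F n in sequentially. expectation (\<lambda>w. \<bar>?X n w - 0\<bar> ^ p') \<le> ?b n"
      using ma mb eventually_ge_at_top[of 1]
    proof eventually_elim
      case (elim n)
      have n: "1 \<le> n" using elim by simp
      let ?t = "sqrt (?r n)"
      have r0: "0 < ?r n" using n lam_pos[of n] by simp
      then have t0: "0 < ?t" by simp
      note dma = dmass_moment[OF a ab n, of n] and dmb = dmass_moment[OF b bb n, of n]
      note m0 = mass_nonneg[OF a ab, of n n] mass_nonneg[OF b bb, of n n] 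
      note d0 = dmass_nonneg[OF a ab, of n n] dmass_nonneg[OF b bb, of n n]
      let ?da = "\<lambda>w. dmass n (\<alpha> n) w" and ?db = "\<lambda>w. dmass n (\<beta> n) w"
      let ?R = "\<lambda>w. 2 ^ Suc p * ((2 * D * ?t) ^ Suc p + 2 ^ Suc p * (?L n * (1 / ?t + 1)) ^ Suc p * (?da w ^ Suc p + ?db w ^ Suc p))"
      have pw: "\<bar>?X n w - 0\<bar> ^ p' \<le> ?R w" for w
      proof -
        have D0: "0 \<le> D" using elim(1) m0(1) by (meson mult_nonneg_nonneg order_trans zero_le_power2)
        have "\<bar>?X n w - 0\<bar> = ?L n * \<bar>quad n (\<alpha> n) (\<beta> n) w / (real n)\<^sup>2 - qbar n (\<alpha> n) (\<beta> n)\<bar>"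
          by (simp add: abs_mult[symmetric, of "?L n", simplified] right_diff_distrib flip: abs_mult)
        also have "\<dots> \<le> ?L n * (?t * (mass n (\<alpha> n) + mass n (\<beta> n)) + (1 / ?t + 1) * (?da w + ?db w))"
          by (intro mult_left_mono quad_deviation[OF n t0 a ab b bb]) auto
        also have "\<dots> = ?t * (?L n * mass n (\<alpha> n) + ?L n * mass n (\<beta> n)) + ?L n * (1 / ?t + 1) * (?da w + ?db w)"
          by (simp only: distrib_left distrib_right mult_ac)
        also have "\<dots> \<le> ?t * (D + D) + ?L n * (1 / ?t + 1) * (?da w + ?db w)"
          using elim t0 by (intro add_right_mono mult_left_mono add_mono) auto
        finally have "\<bar>?X n w - 0\<bar> \<le> 2 * D * ?t + ?L n * (1 / ?t + 1) * (?da w + ?db w)" by (simp add: mult.commute)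
        then have "\<bar>?X n w - 0\<bar> ^ Suc p \<le> (2 * D * ?t + ?L n * (1 / ?t + 1) * (?da w + ?db w)) ^ Suc p"
          by (intro power_mono) auto
        also have "\<dots> \<le> 2 ^ Suc p * ((2 * D * ?t) ^ Suc p + (?L n * (1 / ?t + 1) * (?da w + ?db w)) ^ Suc p)"
          using D0 t0 d0[of w] by (intro power_add_le mult_nonneg_nonneg add_nonneg_nonneg) auto
        also have "(?L n * (1 / ?t + 1) * (?da w + ?db w)) ^ Suc p = (?L n * (1 / ?t + 1)) ^ Suc p * (?da w + ?db w) ^ Suc p"
          by (rule power_mult_distrib)
        finally have 1: "\<bar>?X n w - 0\<bar> ^ Suc p \<le> 2 ^ Suc p * ((2 * D * ?t) ^ Suc p + (?L n * (1 / ?t + 1)) ^ Suc p * (?da w + ?db w) ^ Suc p)" .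
        have "(?da w + ?db w) ^ Suc p \<le> 2 ^ Suc p * (?da w ^ Suc p + ?db w ^ Suc p)"
          by (intro power_add_le d0)
        then have "(?L n * (1 / ?t + 1)) ^ Suc p * (?da w + ?db w) ^ Suc p \<le> (?L n * (1 / ?t + 1)) ^ Suc p * (2 ^ Suc p * (?da w ^ Suc p + ?db w ^ Suc p))"
          by (rule mult_left_mono) (use t0 in \<open>simp del: power_Suc\<close>)
        then have "2 ^ Suc p * ((2 * D * ?t) ^ Suc p + (?L n * (1 / ?t + 1)) ^ Suc p * (?da w + ?db w) ^ Suc p)
           \<le> 2 ^ Suc p * ((2 * D * ?t) ^ Suc p + (?L n * (1 / ?t + 1)) ^ Suc p * (2 ^ Suc p * (?da w ^ Suc p + ?db w ^ Suc p)))"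
          by (rule mult_left_mono[OF add_left_mono]) simp
        also have "\<dots> = ?R w" by (simp only: mult_ac)
        finally show ?thesis using 1 unfolding p by linarith
      qed
      have iR: "integrable M ?R"
        by (intro integrable_mult_right Bochner_Integration.integrable_add integrable_const dma(1) dmb(1))
      have "expectation (\<lambda>w. \<bar>?X n w - 0\<bar> ^ p') \<le> expectation ?R"
      proof (rule integral_mono_AE'[OF iR])
        show "AE w in M. \<bar>?X n w - 0\<bar> ^ p' \<le> ?R w" by (intro AE_I2 pw)
        show "AE w in M. 0 \<le> ?R w" by (intro AE_I2 order_trans[OF _ pw]) simp
      qed
      also have "expectation ?R = 2 ^ Suc p * ((2 * D * ?t) ^ Suc p + 2 ^ Suc p * (?L n * (1 / ?t + 1)) ^ Suc p * (expectation (\<lambda>w. ?da w ^ Suc p) + expectation (\<lambda>w. ?db w ^ Suc p)))"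
        using dma(1)[of "Suc p"] dmb(1)[of "Suc p"] by (simp add: prob_space del: power_Suc)
      also have "\<dots> \<le> 2 ^ Suc p * ((2 * D * ?t) ^ Suc p + 2 ^ Suc p * (?L n * (1 / ?t + 1)) ^ Suc p * (?K / real n ^ Suc p + ?K / real n ^ Suc p))"
        using t0 by (intro mult_left_mono add_left_mono add_mono dma(2) dmb(2)) (auto simp del: power_Suc)
      also have "\<dots> = 2 ^ Suc p * ((2 * D * ?t) ^ Suc p + 2 ^ Suc p * ((?L n * (1 / ?t + 1)) ^ Suc p / real n ^ Suc p) * (2 * ?K))"
        by (simp add: algebra_simps del: power_Suc)
      also have "(?L n * (1 / ?t + 1)) ^ Suc p / real n ^ Suc p = (?r n * (1 / ?t + 1)) ^ Suc p"
        unfolding power_divide[symmetric] by simp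
      \<comment> \<open>Balancing: with r = t^2 the quotient r/t is again t.\<close>
      also have "?r n * (1 / ?t + 1) = ?t + ?r n"
      proof -
        have "?r n = ?t * ?t" using r0 by simp
        then have "?r n * (1 / ?t) = ?t" using t0 by (metis (no_types) nonzero_mult_div_cancel_right less_irrefl mult.right_neutral times_divide_eq_right)
        then show ?thesis by (simp only: distrib_left mult_1_right)
      qed
      finally show ?case .
    qed
    with b0 show "\<exists>b. b \<longlonglongrightarrow> 0 \<and> (\<forall>\<^sub>F n in sequentially. expectation (\<lambda>w. \<bar>?X n w - 0\<bar> ^ p') \<le> b n)"
      by blast
  qed
  from Lconv_add[OF prob_space_axioms this Lconv_const[OF q prob_space_axioms]] show ?thesis by simp
qed

end

section \<open>The taper and its transform\<close>

lemma lborel_integral_affine2: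
  fixes F :: "real^2 \<Rightarrow> real"
  assumes [measurable]: "F \<in> borel_measurable borel" and c: "c \<noteq> 0"
  shows "(\<integral>x. F x \<partial>lborel) = c\<^sup>2 * (\<integral>x. F (t + c *\<^sub>R x) \<partial>lborel)"
proof -
  have "(\<integral>x. F x \<partial>lborel) = (\<integral>x. F x \<partial>density (distr lborel borel (\<lambda>x. t + c *\<^sub>R x)) (\<lambda>_. ennreal (c\<^sup>2)))"
    using lborel_affine[OF c, of t] by simp
  also have "\<dots> = (\<integral>x. c\<^sup>2 *\<^sub>R F x \<partial>distr lborel borel (\<lambda>x. t + c *\<^sub>R x))"
    by (rule integral_density) auto
  also have "\<dots> = (\<integral>x. c\<^sup>2 *\<^sub>R F (t + c *\<^sub>R x) \<partial>lborel)"
    by (rule integral_distr) auto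
  finally show ?thesis by simp
qed

lemma Fubini_kernel:
  fixes F :: "'a::euclidean_space \<Rightarrow> real" and H :: "'b::euclidean_space \<Rightarrow> real"
  assumes F: "integrable lborel F" and H: "integrable lborel H"
    and k[measurable]: "(\<lambda>(x, p). k x p) \<in> borel_measurable (borel \<Otimes>\<^sub>M borel)" and b: "\<And>x p. \<bar>k x p\<bar> \<le> (1::real)"
  shows "(\<integral>x. F x * (\<integral>p. H p * k x p \<partial>lborel) \<partial>lborel) = (\<integral>p. H p * (\<integral>x. F x * k x p \<partial>lborel) \<partial>lborel)"
    and "integrable lborel (\<lambda>x. F x * (\<integral>p. H p * k x p \<partial>lborel))"
    and "integrable (lborel \<Otimes>\<^sub>M lborel) (\<lambda>(x, p). F x * H p * k x p)"
proof -
  note [measurable] = borel_measurable_integrable[OF F] borel_measurable_integrable[OF H]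
  have g: "integrable (lborel \<Otimes>\<^sub>M lborel) (\<lambda>(x, p). F x * H p)"
  proof (rule lborel_pair.Fubini_integrable)
    show "integrable lborel (\<lambda>x. \<integral>p. norm ((\<lambda>(x, p). F x * H p) (x, p)) \<partial>lborel)"
      using F by (simp add: abs_mult)
    show "AE x in lborel. integrable lborel (\<lambda>p. (\<lambda>(x, p). F x * H p) (x, p))" using H by simp
  qed measurable
  show i: "integrable (lborel \<Otimes>\<^sub>M lborel) (\<lambda>(x, p). F x * H p * k x p)"
  proof (rule Bochner_Integration.integrable_bound[OF g])
    show "AE z in lborel \<Otimes>\<^sub>M lborel. norm ((\<lambda>(x, p). F x * H p * k x p) z) \<le> norm ((\<lambda>(x, p). F x * H p) z)"
    proof (intro AE_I2, clarify)
      fix x p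
      have "\<bar>F x * H p\<bar> * \<bar>k x p\<bar> \<le> \<bar>F x * H p\<bar> * 1" by (intro mult_left_mono b) simp
      then show "norm (F x * H p * k x p) \<le> norm (F x * H p)" by (simp add: abs_mult)
    qed
  qed measurable
  have "(\<integral>x. F x * (\<integral>p. H p * k x p \<partial>lborel) \<partial>lborel) = (\<integral>x. \<integral>p. F x * H p * k x p \<partial>lborel \<partial>lborel)"
    by (simp add: mult.assoc)
  also have "\<dots> = (\<integral>p. \<integral>x. F x * H p * k x p \<partial>lborel \<partial>lborel)"
    using lborel_pair.Fubini_integral[OF i] by simp
  also have "\<dots> = (\<integral>p. H p * (\<integral>x. F x * k x p \<partial>lborel) \<partial>lborel)"
  proof -
    have "F x * H p * k x p = H p * (F x * k x p)" for x p by (simp add: mult_ac)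
    then show ?thesis by (simp only: integral_mult_right_zero)
  qed
  finally show "(\<integral>x. F x * (\<integral>p. H p * k x p \<partial>lborel) \<partial>lborel) = (\<integral>p. H p * (\<integral>x. F x * k x p \<partial>lborel) \<partial>lborel)" .
  show "integrable lborel (\<lambda>x. F x * (\<integral>p. H p * k x p \<partial>lborel))"
    using lborel_pair.integrable_fst[OF i] by (simp add: mult.assoc)
qed

lemma taper1_facts:
  assumes "taper1 g"
  shows "continuous_on UNIV g" "\<And>x. (g has_real_derivative deriv g x) (at x)" "continuous_on UNIV (deriv g)"
    and "\<exists>B. \<forall>x. \<bar>g x\<bar> \<le> B" "integrable lborel g" "integrable lborel (\<lambda>x. (g x)\<^sup>2)"
proof -
  show c: "continuous_on UNIV g" and c': "continuous_on UNIV (deriv g)"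
    using assms unfolding taper1_def
    by (simp_all add: continuous_at_imp_continuous_on differentiable_imp_continuous_within)
  show "(g has_real_derivative deriv g x) (at x)" for x
    using assms unfolding taper1_def by (meson DERIV_deriv_iff_real_differentiable)
  have z: "g x = 0" if "x \<notin> {-1/2..1/2}" for x using assms that unfolding taper1_def by auto
  have "bounded (g ` {-1/2..1/2})"
    by (intro compact_imp_bounded compact_continuous_image continuous_on_subset[OF c]) auto
  then obtain B where B: "\<forall>y\<in>g ` {-1/2..1/2}. norm y \<le> B" unfolding bounded_iff by blast
  show bd: "\<exists>B. \<forall>x. \<bar>g x\<bar> \<le> B"
  proof (intro exI allI)
    fix x show "\<bar>g x\<bar> \<le> \<bar>B\<bar>"
    proof (cases "x \<in> {-1/2..1/2}")
      case True
      then have "norm (g x) \<le> B" using B by blast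
      then show ?thesis by simp
    qed (simp add: z)
  qed
  have int: "integrable lborel k" if "continuous_on UNIV k" "\<And>x. x \<notin> {-1/2..1/2} \<Longrightarrow> k x = 0" for k :: "real \<Rightarrow> real"
  proof -
    have "integrable lborel (\<lambda>x. indicator {-1/2..1/2} x *\<^sub>R k x)"
      by (rule borel_integrable_compact) (use that in \<open>auto intro: continuous_on_subset\<close>)
    moreover have "(\<lambda>x. indicator {-1/2..1/2} x *\<^sub>R k x) = k"
      using that(2) by (intro ext) (auto split: split_indicator)
    ultimately show ?thesis by (simp only:)
  qed
  show "integrable lborel g" by (rule int[OF c z])
  show "integrable lborel (\<lambda>x. (g x)\<^sup>2)" by (rule int) (use c z in \<open>auto intro!: continuous_intros\<close>)
qed

locale tapered_sample = sampled_spectral_field +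
  fixes h :: "real^2 \<Rightarrow> real" and h1 h2 :: "real \<Rightarrow> real"
  assumes t1: "taper1 h1" and t2: "taper1 h2" and h_eq: "\<And>s. h s = h1 (s $ 1) * h2 (s $ 2)" and h_nz: "\<exists>s. h s \<noteq> 0"
    and lam_top: "filterlim lam at_top sequentially" and rho: "(\<lambda>n. (lam n)\<^sup>2 / real n) \<longlonglongrightarrow> 0"
begin

lemma h_continuous: "continuous_on UNIV h"
proof -
  have "continuous_on UNIV (\<lambda>s :: real^2. h1 (s $ 1) * h2 (s $ 2))"
    by (intro continuous_on_mult continuous_on_compose2[OF taper1_facts(1)[OF t1]]
          continuous_on_compose2[OF taper1_facts(1)[OF t2]] continuous_on_component
          continuous_on_id subset_UNIV)
  moreover have "h = (\<lambda>s. h1 (s $ 1) * h2 (s $ 2))" by (rule ext) (rule h_eq)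
  ultimately show ?thesis by simp
qed

lemma h_measurable [measurable]: "h \<in> borel_measurable borel"
  using h_continuous by (rule borel_measurable_continuous_onI)

lemma h_outside: "s \<notin> cube 1 \<Longrightarrow> h s = 0"
  using t1 t2 unfolding h_eq cube_def mem_box_cart forall_2 taper1_def by auto

lemma h_bounded: "\<exists>B>0. \<forall>s. \<bar>h s\<bar> \<le> B"
proof -
  obtain B1 B2 where b: "\<forall>x. \<bar>h1 x\<bar> \<le> B1" "\<forall>x. \<bar>h2 x\<bar> \<le> B2" using taper1_facts(4)[OF t1] taper1_facts(4)[OF t2] by blast
  have "\<bar>h s\<bar> \<le> \<bar>B1\<bar> * \<bar>B2\<bar> + 1" for s
  proof -
    have "\<bar>h1 (s$1)\<bar> \<le> \<bar>B1\<bar>" "\<bar>h2 (s$2)\<bar> \<le> \<bar>B2\<bar>" using b by (meson abs_ge_self order_trans)+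
    then have "\<bar>h1 (s$1)\<bar> * \<bar>h2 (s$2)\<bar> \<le> \<bar>B1\<bar> * \<bar>B2\<bar>" by (intro mult_mono) auto
    then show ?thesis by (simp add: h_eq abs_mult)
  qed
  then show ?thesis by (intro exI[of _ "\<bar>B1\<bar> * \<bar>B2\<bar> + 1"]) (auto intro: add_nonneg_pos)
qed

definition hB :: real where "hB = (SOME B. B > 0 \<and> (\<forall>s. \<bar>h s\<bar> \<le> B))"

lemma hB: "0 < hB" "\<bar>h s\<bar> \<le> hB"
  using someI_ex[OF h_bounded[unfolded Bex_def]] unfolding hB_def by auto

lemma h_integrable: "integrable lborel h"
  using integrable_prod2[OF taper1_facts(5)[OF t1] taper1_facts(5)[OF t2]] by (simp add: h_eq[abs_def])

lemma h2_integrable: "integrable lborel (\<lambda>s. (h s)\<^sup>2)"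
  using integrable_prod2[OF taper1_facts(6)[OF t1] taper1_facts(6)[OF t2]] by (simp add: h_eq[abs_def] power_mult_distrib)

definition H0 :: real where "H0 = (\<integral>s. (h s)\<^sup>2 \<partial>lborel)"

text \<open>By continuity the square of h stays away from 0 on a ball, and a ball has positive
  measure.\<close>

lemma H0_pos: "0 < H0"
proof -
  obtain s0 where s0: "h s0 \<noteq> 0" using h_nz by blast
  have "isCont h s0" using h_continuous by (simp add: continuous_on_eq_continuous_at)
  then have "isCont (\<lambda>s. (h s)\<^sup>2) s0" by (intro continuous_intros)
  then have "((\<lambda>s. (h s)\<^sup>2) \<longlongrightarrow> (h s0)\<^sup>2) (nhds s0)"
    using tendsto_at_iff_tendsto_nhds[of "\<lambda>s. (h s)\<^sup>2" s0] by (simp add: isCont_def)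
  then have "\<forall>\<^sub>F s in nhds s0. (h s)\<^sup>2 > (h s0)\<^sup>2 / 2"
    by (rule order_tendstoD(1)) (use s0 in simp)
  then obtain d where d: "d > 0" "\<And>s. dist s s0 < d \<Longrightarrow> (h s)\<^sup>2 > (h s0)\<^sup>2 / 2"
    unfolding eventually_nhds_metric by auto
  have "H0 \<noteq> 0"
  proof
    assume "H0 = 0"
    then have "AE s in lborel. (h s)\<^sup>2 = 0"
      unfolding H0_def using integral_nonneg_eq_0_iff_AE[OF h2_integrable] by simp
    then have "AE s in lborel. s \<notin> ball s0 d"
    proof eventually_elim
      case (elim s)
      then show ?case using d(2)[of s] by (auto simp: dist_commute)
    qed
    then have "emeasure lborel (ball s0 d) = 0"
      by (subst (asm) AE_iff_measurable[where N="ball s0 d"]) auto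
    then have "measure lborel (ball s0 d) = 0" by (simp add: measure_def)
    then show False using content_ball_pos[OF d(1), of s0] by simp
  qed
  moreover have "0 \<le> H0" unfolding H0_def by simp
  ultimately show ?thesis by simp
qed

section \<open>The transform of the taper and of tapered waves\<close>

definition mh :: "real^2 \<Rightarrow> real" where "mh y = (\<integral>u. h u * cos (u \<bullet> y) \<partial>lborel)"

lemma h_even1: "h1 (- x) = h1 x" and h_even2: "h2 (- x) = h2 x"
  using t1 t2 unfolding taper1_def by auto

lemma mh_sin: "(\<integral>u. h u * sin (u \<bullet> y) \<partial>lborel) = 0"
  using integral_sin_prod2[OF taper1_facts(5)[OF t1] taper1_facts(5)[OF t2] h_even1 h_even2, of y] by (simp add: h_eq)

lemma mh_decay: "\<exists>K>0. \<forall>y. \<bar>mh y\<bar> \<le> K * (phi (y$1) * phi (y$2))"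
proof -
  have z: "g x = 0" if "taper1 g" "x \<notin> {-1/2..1/2}" for g x using that unfolding taper1_def by auto
  obtain K1 where K1: "K1 \<ge> 0" "\<forall>y. \<bar>\<integral>u. h1 u * cos (y * u) \<partial>lborel\<bar> \<le> K1 * phi y"
    using cosine_transform_decay[OF taper1_facts(2)[OF t1] taper1_facts(3)[OF t1] z[OF t1]] by blast
  obtain K2 where K2: "K2 \<ge> 0" "\<forall>y. \<bar>\<integral>u. h2 u * cos (y * u) \<partial>lborel\<bar> \<le> K2 * phi y"
    using cosine_transform_decay[OF taper1_facts(2)[OF t2] taper1_facts(3)[OF t2] z[OF t2]] by blast
  have "\<bar>mh y\<bar> \<le> (K1 * K2 + 1) * (phi (y$1) * phi (y$2))" for y
  proof -
    have "mh y = (\<integral>u. h1 u * cos (y$1 * u) \<partial>lborel) * (\<integral>u. h2 u * cos (y$2 * u) \<partial>lborel)"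
      unfolding mh_def h_eq by (rule integral_cos_prod2[OF taper1_facts(5)[OF t1] taper1_facts(5)[OF t2] h_even1 h_even2])
    also have "\<bar>\<dots>\<bar> \<le> (K1 * phi (y$1)) * (K2 * phi (y$2))"
      unfolding abs_mult using K1 K2 phi_pos by (intro mult_mono) (auto intro!: mult_nonneg_nonneg intro: less_imp_le)
    also have "\<dots> \<le> (K1 * K2 + 1) * (phi (y$1) * phi (y$2))" using phi_pos by (simp add: algebra_simps less_imp_le)
    finally show ?thesis .
  qed
  then show ?thesis using K1(1) K2(1) by (intro exI[of _ "K1 * K2 + 1"]) (auto intro: add_nonneg_pos)
qed

definition mK :: real where "mK = (SOME K. K > 0 \<and> (\<forall>y. \<bar>mh y\<bar> \<le> K * (phi (y$1) * phi (y$2))))"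

lemma mK: "0 < mK" "\<bar>mh y\<bar> \<le> mK * (phi (y$1) * phi (y$2))"
  using someI_ex[OF mh_decay[unfolded Bex_def]] unfolding mK_def by auto

lemma mh_measurable [measurable]: "mh \<in> borel_measurable borel"
  unfolding mh_def[abs_def] by measurable

text \<open>The weights whose \<open>lin\<close> is the real part (e true) or the imaginary part (e
  false) of the discrete Fourier transform at \<omega>.\<close>

definition wv :: "bool \<Rightarrow> nat \<Rightarrow> real^2 \<Rightarrow> real^2 \<Rightarrow> real" where
  "wv e n \<omega> s = h ((1 / lam n) *\<^sub>R s) * (if e then cos (s \<bullet> \<omega>) else sin (s \<bullet> \<omega>))"

lemma wv_measurable [measurable]: "wv e n \<omega> \<in> borel_measurable borel"
  unfolding wv_def[abs_def] by measurable

lemma wv_bounded: "\<bar>wv e n \<omega> s\<bar> \<le> hB"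
proof -
  have "\<bar>h ((1 / lam n) *\<^sub>R s)\<bar> * \<bar>if e then cos (s \<bullet> \<omega>) else sin (s \<bullet> \<omega>)\<bar> \<le> hB * 1"
    using hB by (intro mult_mono) (auto intro: less_imp_le)
  then show ?thesis by (simp add: wv_def abs_mult)
qed

text \<open>The substitution s = lam u: the Jacobian lam^2 cancels the density of the uniform law,
  and the support of h makes the restriction to the cube immaterial.\<close>

lemma unif_taper_integral:
  assumes [measurable]: "k \<in> borel_measurable borel"
  shows "(\<integral>s. h ((1 / lam n) *\<^sub>R s) * k s \<partial>unif n) = (\<integral>u. h u * k (lam n *\<^sub>R u) \<partial>lborel)"
proof -
  let ?l = "lam n"
  have l: "?l > 0" by (rule lam_pos)
  have cm: "cube ?l \<in> sets borel" by (simp add: cube_def)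
  have out: "h ((1 / ?l) *\<^sub>R s) = 0" if "s \<notin> cube ?l" for s
  proof (rule h_outside)
    show "(1 / ?l) *\<^sub>R s \<notin> cube 1" using that l
      by (auto simp: cube_def mem_box_cart forall_2 field_simps)
  qed
  have "(\<integral>s. h ((1 / ?l) *\<^sub>R s) * k s \<partial>unif n) = (\<integral>s. h ((1 / ?l) *\<^sub>R s) * k s \<partial>density lborel (\<lambda>s. ennreal (indicator (cube ?l) s / ?l\<^sup>2)))"
    unfolding unif_def uniform_measure_def emeasure_cube[OF l]
    by (intro arg_cong[where f="\<lambda>m. integral\<^sup>L m _"] density_cong) (use cm l in \<open>auto simp: divide_ennreal ennreal_indicator[symmetric] simp del: ennreal_indicator\<close>)
  also have "\<dots> = (\<integral>s. (indicator (cube ?l) s / ?l\<^sup>2) *\<^sub>R (h ((1 / ?l) *\<^sub>R s) * k s) \<partial>lborel)"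
    by (rule integral_density) (use cm in auto)
  also have "\<dots> = (\<integral>s. h ((1 / ?l) *\<^sub>R s) * k s / ?l\<^sup>2 \<partial>lborel)"
    by (intro Bochner_Integration.integral_cong refl) (use out in \<open>auto split: split_indicator\<close>)
  also have "\<dots> = ?l\<^sup>2 * (\<integral>u. h ((1 / ?l) *\<^sub>R (0 + ?l *\<^sub>R u)) * k (0 + ?l *\<^sub>R u) / ?l\<^sup>2 \<partial>lborel)"
    by (rule lborel_integral_affine2) (use l in auto)
  also have "\<dots> = (\<integral>u. h u * k (?l *\<^sub>R u) \<partial>lborel)" using l by simp
  finally show ?thesis .
qed

lemma h_trig_integrable: "integrable lborel (\<lambda>u. h u * cos (u \<bullet> y))" "integrable lborel (\<lambda>u. h u * sin (u \<bullet> y))"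
  by (rule trig_weighted_integrable[OF h_integrable])+

abbreviation (input) ms :: "nat \<Rightarrow> real^2 \<Rightarrow> real" where "ms n y \<equiv> mh (lam n *\<^sub>R y)"

text \<open>Modulation moves the taper transform to \<omega> and -\<omega>. As the taper is even, a
  cosine wave has no mean sine transform and a sine wave no mean cosine transform.\<close>

lemma
  shows mcos_cos: "mcos n (wv True n \<omega>) x = (ms n (x - \<omega>) + ms n (x + \<omega>)) / 2"
    and msin_cos: "msin n (wv True n \<omega>) x = 0"
    and mcos_sin: "mcos n (wv False n \<omega>) x = 0"
    and msin_sin: "msin n (wv False n \<omega>) x = (ms n (x - \<omega>) - ms n (x + \<omega>)) / 2"
proof -
  let ?l = "lam n"
  have b: "(\<integral>s. wv e n \<omega> s * k s \<partial>unif n) = (\<integral>u. h u * ((if e then cos (?l *\<^sub>R u \<bullet> \<omega>) else sin (?l *\<^sub>R u \<bullet> \<omega>)) * k (?l *\<^sub>R u)) \<partial>lborel)"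
    if [measurable]: "k \<in> borel_measurable borel" for e k
    unfolding wv_def mult.assoc by (rule unif_taper_integral) measurable
  have i: "u \<bullet> (?l *\<^sub>R (x - \<omega>)) = ?l *\<^sub>R u \<bullet> x - ?l *\<^sub>R u \<bullet> \<omega>" "u \<bullet> (?l *\<^sub>R (x + \<omega>)) = ?l *\<^sub>R u \<bullet> x + ?l *\<^sub>R u \<bullet> \<omega>" for u
    by (simp_all add: inner_diff_right inner_add_right algebra_simps)
  have "mcos n (wv True n \<omega>) x = (\<integral>u. (h u * cos (u \<bullet> (?l *\<^sub>R (x - \<omega>))) + h u * cos (u \<bullet> (?l *\<^sub>R (x + \<omega>)))) / 2 \<partial>lborel)"
    unfolding mcos_def
    by (subst b, measurable, intro Bochner_Integration.integral_cong refl) (simp only: i cos_add cos_diff if_True, simp add: inner_commute field_simps)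
  also have "\<dots> = (ms n (x - \<omega>) + ms n (x + \<omega>)) / 2"
    by (simp only: integral_divide_zero Bochner_Integration.integral_add[OF h_trig_integrable(1) h_trig_integrable(1)] mh_def)
  finally show "mcos n (wv True n \<omega>) x = (ms n (x - \<omega>) + ms n (x + \<omega>)) / 2" .
  have "msin n (wv True n \<omega>) x = (\<integral>u. (h u * sin (u \<bullet> (?l *\<^sub>R (x + \<omega>))) + h u * sin (u \<bullet> (?l *\<^sub>R (x - \<omega>)))) / 2 \<partial>lborel)"
    unfolding msin_def
    by (subst b, measurable, intro Bochner_Integration.integral_cong refl) (simp only: i sin_add sin_diff if_True, simp add: inner_commute field_simps)
  also have "\<dots> = 0" by (simp add: Bochner_Integration.integral_add[OF h_trig_integrable(2) h_trig_integrable(2)] mh_sin del: inner_scaleR_right)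
  finally show "msin n (wv True n \<omega>) x = 0" .
  have "mcos n (wv False n \<omega>) x = (\<integral>u. (h u * sin (u \<bullet> (?l *\<^sub>R (x + \<omega>))) - h u * sin (u \<bullet> (?l *\<^sub>R (x - \<omega>)))) / 2 \<partial>lborel)"
    unfolding mcos_def
    by (subst b, measurable, intro Bochner_Integration.integral_cong refl) (simp only: i sin_add sin_diff if_False, simp add: inner_commute field_simps)
  also have "\<dots> = 0" by (simp add: Bochner_Integration.integral_diff[OF h_trig_integrable(2) h_trig_integrable(2)] mh_sin del: inner_scaleR_right)
  finally show "mcos n (wv False n \<omega>) x = 0" .
  have "msin n (wv False n \<omega>) x = (\<integral>u. (h u * cos (u \<bullet> (?l *\<^sub>R (x - \<omega>))) - h u * cos (u \<bullet> (?l *\<^sub>R (x + \<omega>)))) / 2 \<partial>lborel)"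
    unfolding msin_def
    by (subst b, measurable, intro Bochner_Integration.integral_cong refl) (simp only: i cos_add cos_diff if_False, simp add: inner_commute field_simps)
  also have "\<dots> = (ms n (x - \<omega>) - ms n (x + \<omega>)) / 2"
    by (simp only: integral_divide_zero Bochner_Integration.integral_diff[OF h_trig_integrable(1) h_trig_integrable(1)] mh_def)
  finally show "msin n (wv False n \<omega>) x = (ms n (x - \<omega>) - ms n (x + \<omega>)) / 2" .
qed

section \<open>Limits of the kernel integrals\<close>

definition fB :: real where "fB = (\<integral>u. \<bar>c u\<bar> \<partial>lborel)"

text \<open>The spectral density smoothed by the taper kernels at \<omega> and \<omega>'. All mean
  covariances of tapered waves are combinations of such terms.\<close>

definition TT :: "nat \<Rightarrow> real^2 \<Rightarrow> real^2 \<Rightarrow> real" where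
  "TT n \<omega> \<omega>' = (lam n)\<^sup>2 * (\<integral>x. f x * (ms n (x - \<omega>) * ms n (x - \<omega>')) \<partial>lborel)"

lemma
  shows kernel_cross_integrable: "integrable lborel (\<lambda>x. \<bar>f x\<bar> * (\<bar>ms n (x - \<omega>)\<bar> * \<bar>ms n (x - \<omega>')\<bar>))"
    and kernel_cross_bound: "(lam n)\<^sup>2 * (\<integral>x. \<bar>f x\<bar> * (\<bar>ms n (x - \<omega>)\<bar> * \<bar>ms n (x - \<omega>')\<bar>) \<partial>lborel)
      \<le> fB * mK\<^sup>2 * (2 * phi32int)\<^sup>2 * (phi (lam n * (\<omega>$1 - \<omega>'$1)) powr (1/4) * phi (lam n * (\<omega>$2 - \<omega>'$2)) powr (1/4))"
proof -
  let ?l = "lam n"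
  have l: "?l > 0" by (rule lam_pos)
  let ?g = "\<lambda>i t. ?l * (phi (?l * (t - \<omega>$i)) * phi (?l * (t - \<omega>'$i)))"
  note ig = integrable_phi_cross[OF l, of "\<omega>$1" "\<omega>'$1"] integrable_phi_cross[OF l, of "\<omega>$2" "\<omega>'$2"]
  have iR: "integrable lborel (\<lambda>x::real^2. fB * mK\<^sup>2 * (?g 1 (x$1) * ?g 2 (x$2)))"
    by (intro integrable_mult_right integrable_prod2 ig)
  have le: "?l\<^sup>2 * (\<bar>f x\<bar> * (\<bar>ms n (x - \<omega>)\<bar> * \<bar>ms n (x - \<omega>')\<bar>)) \<le> fB * mK\<^sup>2 * (?g 1 (x$1) * ?g 2 (x$2))" for x
  proof -
    have p0: "0 \<le> phi y" for y using phi_pos[of y] by simp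
    have "\<bar>f x\<bar> * (\<bar>ms n (x - \<omega>)\<bar> * \<bar>ms n (x - \<omega>')\<bar>) \<le> fB * ((mK * (phi (?l * (x$1 - \<omega>$1)) * phi (?l * (x$2 - \<omega>$2)))) * (mK * (phi (?l * (x$1 - \<omega>'$1)) * phi (?l * (x$2 - \<omega>'$2)))))"
      using mK(2)[of "?l *\<^sub>R (x - \<omega>)"] mK(2)[of "?l *\<^sub>R (x - \<omega>')"] mK(1) p0 f_bounded[of x]
      by (intro mult_mono) (auto simp: fB_def intro!: mult_nonneg_nonneg)
    then have "?l\<^sup>2 * (\<bar>f x\<bar> * (\<bar>ms n (x - \<omega>)\<bar> * \<bar>ms n (x - \<omega>')\<bar>)) \<le> ?l\<^sup>2 * (fB * ((mK * (phi (?l * (x$1 - \<omega>$1)) * phi (?l * (x$2 - \<omega>$2)))) * (mK * (phi (?l * (x$1 - \<omega>'$1)) * phi (?l * (x$2 - \<omega>'$2))))))"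
      by (rule mult_left_mono) simp
    also have "\<dots> = fB * mK\<^sup>2 * (?g 1 (x$1) * ?g 2 (x$2))" by (simp only: power2_eq_square mult_ac)
    finally show ?thesis .
  qed
  have int: "integrable lborel (\<lambda>x. ?l\<^sup>2 * (\<bar>f x\<bar> * (\<bar>ms n (x - \<omega>)\<bar> * \<bar>ms n (x - \<omega>')\<bar>)))"
  proof (rule Bochner_Integration.integrable_bound[OF iR])
    show "AE x in lborel. norm (?l\<^sup>2 * (\<bar>f x\<bar> * (\<bar>ms n (x - \<omega>)\<bar> * \<bar>ms n (x - \<omega>')\<bar>))) \<le> norm (fB * mK\<^sup>2 * (?g 1 (x$1) * ?g 2 (x$2)))"
    proof (intro AE_I2)
      fix x
      have "norm (?l\<^sup>2 * (\<bar>f x\<bar> * (\<bar>ms n (x - \<omega>)\<bar> * \<bar>ms n (x - \<omega>')\<bar>))) = ?l\<^sup>2 * (\<bar>f x\<bar> * (\<bar>ms n (x - \<omega>)\<bar> * \<bar>ms n (x - \<omega>')\<bar>))"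
        by (simp add: abs_mult)
      also note le[of x]
      also have "fB * mK\<^sup>2 * (?g 1 (x$1) * ?g 2 (x$2)) \<le> norm (fB * mK\<^sup>2 * (?g 1 (x$1) * ?g 2 (x$2)))" by simp
      finally show "norm (?l\<^sup>2 * (\<bar>f x\<bar> * (\<bar>ms n (x - \<omega>)\<bar> * \<bar>ms n (x - \<omega>')\<bar>))) \<le> norm (fB * mK\<^sup>2 * (?g 1 (x$1) * ?g 2 (x$2)))" .
    qed
  qed measurable
  have "integrable lborel (\<lambda>x. (1 / ?l\<^sup>2) * (?l\<^sup>2 * (\<bar>f x\<bar> * (\<bar>ms n (x - \<omega>)\<bar> * \<bar>ms n (x - \<omega>')\<bar>))))"
    by (rule integrable_mult_right[OF int])
  then show "integrable lborel (\<lambda>x. \<bar>f x\<bar> * (\<bar>ms n (x - \<omega>)\<bar> * \<bar>ms n (x - \<omega>')\<bar>))" using l by simp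
  have "?l\<^sup>2 * (\<integral>x. \<bar>f x\<bar> * (\<bar>ms n (x - \<omega>)\<bar> * \<bar>ms n (x - \<omega>')\<bar>) \<partial>lborel) \<le> (\<integral>x. fB * mK\<^sup>2 * (?g 1 (x$1) * ?g 2 (x$2)) \<partial>(lborel :: (real^2) measure))"
    unfolding integral_mult_right_zero[symmetric] by (rule integral_mono[OF int]) (use iR le in \<open>simp_all only:\<close>)
  also have "\<dots> = fB * mK\<^sup>2 * ((\<integral>t. ?g 1 t \<partial>lborel) * (\<integral>t. ?g 2 t \<partial>lborel))"
    by (simp only: integral_mult_right_zero integral_prod2[OF ig])
  also have "\<dots> \<le> fB * mK\<^sup>2 * ((2 * phi32int * phi (?l * (\<omega>$1 - \<omega>'$1)) powr (1/4)) * (2 * phi32int * phi (?l * (\<omega>$2 - \<omega>'$2)) powr (1/4)))"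
  proof (intro mult_left_mono mult_mono integral_phi_cross l)
    show "0 \<le> 2 * phi32int * phi (?l * (\<omega>$1 - \<omega>'$1)) powr (1/4)" using phi32int_nonneg by simp
    show "0 \<le> (\<integral>t. ?g 2 t \<partial>lborel)" using l phi_pos by (intro integral_nonneg_AE AE_I2) (simp add: less_imp_le)
    show "0 \<le> fB * mK\<^sup>2" by (simp add: fB_def)
  qed
  also have "\<dots> = fB * mK\<^sup>2 * (2 * phi32int)\<^sup>2 * (phi (?l * (\<omega>$1 - \<omega>'$1)) powr (1/4) * phi (?l * (\<omega>$2 - \<omega>'$2)) powr (1/4))"
    by (simp only: power2_eq_square mult_ac)
  finally show "(lam n)\<^sup>2 * (\<integral>x. \<bar>f x\<bar> * (\<bar>ms n (x - \<omega>)\<bar> * \<bar>ms n (x - \<omega>')\<bar>) \<partial>lborel)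
      \<le> fB * mK\<^sup>2 * (2 * phi32int)\<^sup>2 * (phi (lam n * (\<omega>$1 - \<omega>'$1)) powr (1/4) * phi (lam n * (\<omega>$2 - \<omega>'$2)) powr (1/4))" .
qed

lemma TT_integrable: "integrable lborel (\<lambda>x. f x * (ms n (x - \<omega>) * ms n (x - \<omega>')))"
  by (rule Bochner_Integration.integrable_bound[OF kernel_cross_integrable[of n \<omega> \<omega>']]) (auto simp: abs_mult)

lemma TT_abs_le: "\<bar>TT n \<omega> \<omega>'\<bar> \<le> (lam n)\<^sup>2 * (\<integral>x. \<bar>f x\<bar> * (\<bar>ms n (x - \<omega>)\<bar> * \<bar>ms n (x - \<omega>')\<bar>) \<partial>lborel)"
proof -
  have "\<bar>\<integral>x. f x * (ms n (x - \<omega>) * ms n (x - \<omega>')) \<partial>lborel\<bar> \<le> (\<integral>x. \<bar>f x * (ms n (x - \<omega>) * ms n (x - \<omega>'))\<bar> \<partial>lborel)"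
    by (rule integral_abs_bound)
  then have "(lam n)\<^sup>2 * \<bar>\<integral>x. f x * (ms n (x - \<omega>) * ms n (x - \<omega>')) \<partial>lborel\<bar> \<le> (lam n)\<^sup>2 * (\<integral>x. \<bar>f x * (ms n (x - \<omega>) * ms n (x - \<omega>'))\<bar> \<partial>lborel)"
    by (rule mult_left_mono) simp
  then show ?thesis by (simp add: TT_def abs_mult)
qed

text \<open>In some coordinate the separation of the two centres, measured in units of 1/lam, tends
  to infinity, so the cross bound for the kernels tends to 0; the other coordinate contributes a
  factor at most 1.\<close>

lemma TT_null:
  assumes w: "w \<longlonglongrightarrow> \<omega>" and v: "v \<longlonglongrightarrow> \<omega>'" and ne: "\<omega> \<noteq> \<omega>'"
  shows "(\<lambda>n. TT n (w n) (v n)) \<longlonglongrightarrow> 0"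
proof -
  obtain i where i: "\<omega> $ i \<noteq> \<omega>' $ i" using ne by (auto simp: vec_eq_iff)
  define C where "C = fB * mK\<^sup>2 * (2 * phi32int)\<^sup>2"
  have C0: "0 \<le> C" by (simp add: C_def fB_def)
  have lim: "(\<lambda>n. phi (lam n * (w n $ i - v n $ i)) powr (1/4)) \<longlonglongrightarrow> 0"
  proof -
    have "(\<lambda>n. \<bar>w n $ i - v n $ i\<bar>) \<longlonglongrightarrow> \<bar>\<omega> $ i - \<omega>' $ i\<bar>" by (intro tendsto_intros tendsto_vec_nth w v)
    then have "filterlim (\<lambda>n. \<bar>w n $ i - v n $ i\<bar> * lam n) at_top sequentially"
      by (rule filterlim_tendsto_pos_mult_at_top) (use i lam_top in auto)
    then have "filterlim (\<lambda>n. 1 + \<bar>w n $ i - v n $ i\<bar> * lam n) at_top sequentially"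
      by (rule filterlim_tendsto_add_at_top[OF tendsto_const])
    then have "(\<lambda>n. (1 + \<bar>w n $ i - v n $ i\<bar> * lam n) powr (- (1/4))) \<longlonglongrightarrow> 0"
      by (rule tendsto_neg_powr[rotated]) simp
    moreover have "phi (lam n * (w n $ i - v n $ i)) powr (1/4) = (1 + \<bar>w n $ i - v n $ i\<bar> * lam n) powr (- (1/4))" for n
    proof -
      have "\<bar>lam n * (w n $ i - v n $ i)\<bar> = \<bar>w n $ i - v n $ i\<bar> * lam n"
        using lam_pos[of n] by (simp add: abs_mult)
      then show ?thesis unfolding phi_def by (simp add: powr_divide powr_minus_divide)
    qed
    ultimately show ?thesis by simp
  qed
  have le1: "phi y powr (1/4) \<le> 1" for y
    using phi_pos[of y] phi_le1[of y] by (intro powr_le1) auto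
  have bnd: "\<bar>TT n (w n) (v n)\<bar> \<le> C * phi (lam n * (w n $ i - v n $ i)) powr (1/4)" for n
  proof -
    let ?p = "\<lambda>j. phi (lam n * (w n $ j - v n $ j)) powr (1/4)"
    have "\<bar>TT n (w n) (v n)\<bar> \<le> C * (?p 1 * ?p 2)"
      unfolding C_def by (rule order_trans[OF TT_abs_le kernel_cross_bound])
    also have "?p 1 * ?p 2 \<le> ?p i"
      using le1 exhaust_2[of i] by (auto intro: mult_left_le mult_left_le_one_le)
    finally show ?thesis using C0 by (simp add: mult_left_mono)
  qed
  have "(\<lambda>n. C * phi (lam n * (w n $ i - v n $ i)) powr (1/4)) \<longlonglongrightarrow> C * 0"
    by (intro tendsto_mult tendsto_const lim)
  then have L: "(\<lambda>n. C * phi (lam n * (w n $ i - v n $ i)) powr (1/4)) \<longlonglongrightarrow> 0" by simp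
  show ?thesis
    by (rule Lim_null_comparison[OF _ L], rule always_eventually, rule allI) (simp only: real_norm_def bnd)
qed

text \<open>The limit is easier in the space domain. The square of \<open>mh\<close> is the
  transform of the autocorrelation of the taper, the integral against f turns the cosine back into
  c, and the rescaled lag z = lam (v - u) absorbs lam^2.\<close>

lemma TT_kernel:
  "(lam n)\<^sup>2 * (\<integral>x. f x * (ms n (x - \<omega>) * ms n (x - \<omega>)) \<partial>lborel)
    = (2 * pi)\<^sup>2 * (\<integral>p. h (fst p) * h (fst p - (1 / lam n) *\<^sub>R snd p) * (c (snd p) * cos (snd p \<bullet> \<omega>)) \<partial>(lborel \<Otimes>\<^sub>M lborel))" (is "?lhs = _")
proof -
  let ?l = "lam n"
  have l: "?l > 0" by (rule lam_pos)
  let ?H = "\<lambda>p::(real^2) \<times> (real^2). h (fst p) * h (snd p)"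
  let ?D = "\<lambda>p::(real^2) \<times> (real^2). ?l *\<^sub>R (fst p - snd p)"
  have lp: "(lborel :: ((real^2) \<times> (real^2)) measure) = lborel \<Otimes>\<^sub>M lborel" by (rule lborel_prod[symmetric])
  have one: "\<bar>1::real\<bar> \<le> 1" by simp
  have HH: "integrable lborel ?H"
    unfolding lp using Fubini_kernel(3)[OF h_integrable h_integrable _ one] by (simp add: case_prod_beta')
  \<comment> \<open>The sine terms of the addition formula drop out by \<open>mh_sin\<close>, which
    leaves the transform of the taper autocorrelation.\<close>
  have sq: "mh Y * mh Y = (\<integral>v. h v * (\<integral>u. h u * cos ((v - u) \<bullet> Y) \<partial>lborel) \<partial>lborel)" for Y
  proof -
    have "(\<integral>u. h u * cos ((v - u) \<bullet> Y) \<partial>lborel) = cos (v \<bullet> Y) * mh Y" for v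
    proof -
      have "(\<integral>u. h u * cos ((v - u) \<bullet> Y) \<partial>lborel) = (\<integral>u. cos (v \<bullet> Y) * (h u * cos (u \<bullet> Y)) + sin (v \<bullet> Y) * (h u * sin (u \<bullet> Y)) \<partial>lborel)"
        by (intro Bochner_Integration.integral_cong refl) (simp add: inner_diff_left cos_diff algebra_simps)
      also have "\<dots> = cos (v \<bullet> Y) * mh Y + sin (v \<bullet> Y) * 0"
        using h_trig_integrable[of Y] mh_sin[of Y] by (simp add: mh_def)
      finally show ?thesis by simp
    qed
    then have "(\<integral>v. h v * (\<integral>u. h u * cos ((v - u) \<bullet> Y) \<partial>lborel) \<partial>lborel) = (\<integral>v. (h v * cos (v \<bullet> Y)) * mh Y \<partial>lborel)"
      by (simp add: mult.assoc)
    also have "\<dots> = mh Y * mh Y" using h_trig_integrable(1)[of Y] by (simp add: mh_def)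
    finally show ?thesis by simp
  qed
  have iter: "(\<integral>p. ?H p * k p \<partial>lborel) = (\<integral>v. h v * (\<integral>u. h u * k (v, u) \<partial>lborel) \<partial>lborel)"
    if [measurable]: "k \<in> borel_measurable borel" and kb: "\<And>p. \<bar>k p\<bar> \<le> K" for k :: "(real^2) \<times> (real^2) \<Rightarrow> real" and K
  proof -
    have km: "k \<in> borel_measurable (lborel \<Otimes>\<^sub>M lborel)" using that(1) by (simp add: borel_prod[symmetric])
    have i: "integrable (lborel \<Otimes>\<^sub>M lborel) (\<lambda>p. ?H p * k p)"
    proof (rule Bochner_Integration.integrable_bound)
      show "integrable (lborel \<Otimes>\<^sub>M lborel) (\<lambda>p. K * ?H p)" using HH unfolding lp by simp
      show "AE p in lborel \<Otimes>\<^sub>M lborel. norm (?H p * k p) \<le> norm (K * ?H p)"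
      proof (intro AE_I2)
        fix p
        have "\<bar>?H p\<bar> * \<bar>k p\<bar> \<le> \<bar>?H p\<bar> * \<bar>K\<bar>" using kb[of p] by (intro mult_left_mono) linarith+
        then show "norm (?H p * k p) \<le> norm (K * ?H p)" by (simp add: abs_mult mult_ac)
      qed
      show "(\<lambda>p. ?H p * k p) \<in> borel_measurable (lborel \<Otimes>\<^sub>M lborel)" using km by measurable
    qed
    show ?thesis unfolding lp using lborel_pair.integral_fst'[OF i] by (simp add: mult.assoc)
  qed
  have inner: "(\<integral>x. f x * cos (?D p \<bullet> (x - \<omega>)) \<partial>lborel) = (2 * pi)\<^sup>2 * (c (?D p) * cos (?D p \<bullet> \<omega>))" for p
  proof -
    let ?d = "?D p"
    have "(\<integral>x. f x * cos (?d \<bullet> (x - \<omega>)) \<partial>lborel) = (\<integral>x. cos (?d \<bullet> \<omega>) * (f x * cos (x \<bullet> ?d)) + sin (?d \<bullet> \<omega>) * (f x * sin (x \<bullet> ?d)) \<partial>lborel)"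
    proof (intro Bochner_Integration.integral_cong refl)
      fix x
      have "?d \<bullet> (x - \<omega>) = x \<bullet> ?d - ?d \<bullet> \<omega>" by (simp only: inner_diff_right inner_commute[of ?d x])
      then show "f x * cos (?d \<bullet> (x - \<omega>)) = cos (?d \<bullet> \<omega>) * (f x * cos (x \<bullet> ?d)) + sin (?d \<bullet> \<omega>) * (f x * sin (x \<bullet> ?d))"
        by (simp only: cos_diff distrib_left mult_ac)
    qed
    also have "\<dots> = cos (?d \<bullet> \<omega>) * (\<integral>x. f x * cos (x \<bullet> ?d) \<partial>lborel) + sin (?d \<bullet> \<omega>) * (\<integral>x. f x * sin (x \<bullet> ?d) \<partial>lborel)"
      by (subst Bochner_Integration.integral_add) (intro integrable_mult_right trig_weighted_integrable f_integrable, intro integrable_mult_right trig_weighted_integrable f_integrable, simp only: integral_mult_right_zero)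
    also have "\<dots> = (2 * pi)\<^sup>2 * (c ?d * cos (?d \<bullet> \<omega>))" unfolding f_sin c_eq by simp
    finally show ?thesis .
  qed
  have km: "(\<lambda>(x, p). cos (?D p \<bullet> (x - \<omega>))) \<in> borel_measurable (borel \<Otimes>\<^sub>M borel)"
    unfolding borel_prod by (simp add: case_prod_beta', intro borel_measurable_continuous_onI continuous_intros)
  have fm: "f x * (ms n (x - \<omega>) * ms n (x - \<omega>)) = f x * (\<integral>p. ?H p * cos (?D p \<bullet> (x - \<omega>)) \<partial>lborel)" for x
  proof -
    have "(\<integral>p. ?H p * cos (?D p \<bullet> (x - \<omega>)) \<partial>lborel) = (\<integral>v. h v * (\<integral>u. h u * cos (?D (v, u) \<bullet> (x - \<omega>)) \<partial>lborel) \<partial>lborel)"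
    proof (rule iter)
      show "(\<lambda>p. cos (?D p \<bullet> (x - \<omega>))) \<in> borel_measurable borel"
        by (intro borel_measurable_continuous_onI continuous_intros)
      show "\<bar>cos (?D p \<bullet> (x - \<omega>))\<bar> \<le> 1" for p by simp
    qed
    also have "\<dots> = mh (?l *\<^sub>R (x - \<omega>)) * mh (?l *\<^sub>R (x - \<omega>))" unfolding sq by simp
    finally show ?thesis by simp
  qed
  \<comment> \<open>The affine substitution u = v - z/lam, whose Jacobian is lam^(-2).\<close>
  have sub: "(\<integral>u. h u * (c (?D (v, u)) * cos (?D (v, u) \<bullet> \<omega>)) \<partial>lborel) = (1 / ?l\<^sup>2) * (\<integral>z. h (v - (1 / ?l) *\<^sub>R z) * (c z * cos (z \<bullet> \<omega>)) \<partial>lborel)" for v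
  proof -
    let ?u = "\<lambda>z. v + (- (1 / ?l)) *\<^sub>R z"
    have z: "?l *\<^sub>R (v - ?u z) = z" for z using l by simp
    have "(\<integral>u. h u * (c (?l *\<^sub>R (v - u)) * cos (?l *\<^sub>R (v - u) \<bullet> \<omega>)) \<partial>lborel)
       = (- (1 / ?l))\<^sup>2 * (\<integral>z. h (?u z) * (c (?l *\<^sub>R (v - ?u z)) * cos (?l *\<^sub>R (v - ?u z) \<bullet> \<omega>)) \<partial>lborel)"
      by (rule lborel_integral_affine2) (use l in auto)
    then show ?thesis unfolding z fst_conv snd_conv by (simp add: power_divide)
  qed
  have "(\<integral>x. f x * (ms n (x - \<omega>) * ms n (x - \<omega>)) \<partial>lborel) = (\<integral>p. ?H p * (\<integral>x. f x * cos (?D p \<bullet> (x - \<omega>)) \<partial>lborel) \<partial>lborel)"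
    unfolding fm by (rule Fubini_kernel(1)[OF f_integrable HH km]) simp
  also have "\<dots> = (2 * pi)\<^sup>2 * (\<integral>p. ?H p * (c (?D p) * cos (?D p \<bullet> \<omega>)) \<partial>lborel)"
    unfolding inner by (simp only: mult.left_commute[of "?H _"] integral_mult_right_zero)
  also have "(\<integral>p. ?H p * (c (?D p) * cos (?D p \<bullet> \<omega>)) \<partial>lborel) = (\<integral>v. h v * (\<integral>u. h u * (c (?D (v, u)) * cos (?D (v, u) \<bullet> \<omega>)) \<partial>lborel) \<partial>lborel)"
  proof (rule iter)
    have "?D \<in> borel_measurable borel" by (intro borel_measurable_continuous_onI continuous_intros)
    then have [measurable]: "?D \<in> borel \<rightarrow>\<^sub>M borel" .
    show "(\<lambda>p. c (?D p) * cos (?D p \<bullet> \<omega>)) \<in> borel_measurable borel" by measurable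
    fix p
    have "\<bar>c (?D p)\<bar> * \<bar>cos (?D p \<bullet> \<omega>)\<bar> \<le> cB * 1" using cb[of 0] by (intro mult_mono cb) auto
    then show "\<bar>c (?D p) * cos (?D p \<bullet> \<omega>)\<bar> \<le> cB" by (simp only: abs_mult mult_1_right)
  qed
  also have "\<dots> = (\<integral>v. h v * ((1 / ?l\<^sup>2) * (\<integral>z. h (v - (1 / ?l) *\<^sub>R z) * (c z * cos (z \<bullet> \<omega>)) \<partial>lborel)) \<partial>lborel)"
    unfolding sub ..
  also have "\<dots> = (1 / ?l\<^sup>2) * (\<integral>v. h v * (\<integral>z. h (v - (1 / ?l) *\<^sub>R z) * (c z * cos (z \<bullet> \<omega>)) \<partial>lborel) \<partial>lborel)"
    by (simp only: mult.left_commute[of "h _"] integral_mult_right_zero)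
  finally have eq: "(\<integral>x. f x * (ms n (x - \<omega>) * ms n (x - \<omega>)) \<partial>lborel) = (2 * pi)\<^sup>2 * ((1 / ?l\<^sup>2) * (\<integral>v. h v * (\<integral>z. h (v - (1 / ?l) *\<^sub>R z) * (c z * cos (z \<bullet> \<omega>)) \<partial>lborel) \<partial>lborel))" .
  have dom: "integrable (lborel \<Otimes>\<^sub>M lborel) (\<lambda>p. hB * (h (fst p) * c (snd p)))"
    using Fubini_kernel(3)[OF h_integrable c_integrable _ one] by (intro integrable_mult_right) (simp add: case_prod_beta')
  have int: "integrable (lborel \<Otimes>\<^sub>M lborel) (\<lambda>p. h (fst p) * h (fst p - (1 / lam n) *\<^sub>R snd p) * (c (snd p) * cos (snd p \<bullet> \<omega>)))"
  proof (rule Bochner_Integration.integrable_bound[OF dom])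
    show "AE p in lborel \<Otimes>\<^sub>M lborel. norm (h (fst p) * h (fst p - (1 / lam n) *\<^sub>R snd p) * (c (snd p) * cos (snd p \<bullet> \<omega>))) \<le> norm (hB * (h (fst p) * c (snd p)))"
    proof (intro AE_I2)
      fix p
      have "\<bar>h (fst p)\<bar> * \<bar>h (fst p - (1 / lam n) *\<^sub>R snd p)\<bar> * (\<bar>c (snd p)\<bar> * \<bar>cos (snd p \<bullet> \<omega>)\<bar>) \<le> \<bar>h (fst p)\<bar> * hB * (\<bar>c (snd p)\<bar> * 1)"
        using hB by (intro mult_mono) (auto intro: less_imp_le)
      then show "norm (h (fst p) * h (fst p - (1 / lam n) *\<^sub>R snd p) * (c (snd p) * cos (snd p \<bullet> \<omega>))) \<le> norm (hB * (h (fst p) * c (snd p)))"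
        using hB(1) by (simp only: real_norm_def abs_mult abs_of_pos) (simp only: mult_ac mult_1_left)
    qed
  qed measurable
  show "?lhs = (2 * pi)\<^sup>2 * (\<integral>p. h (fst p) * h (fst p - (1 / lam n) *\<^sub>R snd p) * (c (snd p) * cos (snd p \<bullet> \<omega>)) \<partial>(lborel \<Otimes>\<^sub>M lborel))"
    using lborel_pair.integral_fst'[OF int] l unfolding eq by (simp add: mult.assoc)
qed

text \<open>As lam grows the shift z/lam vanishes, so h(v) h(v - z/lam) tends to h(v)^2 by
  continuity, under the integrable bound \<open>hB * \<bar>h (fst p) * c (snd p)\<bar>\<close>. What
  remains is H0 times the cosine transform of c, which is f. The frequency may vary with n.\<close>

lemma TT_diag:
  assumes w: "w \<longlonglongrightarrow> \<omega>"
  shows "(\<lambda>n. TT n (w n) (w n)) \<longlonglongrightarrow> (2 * pi)\<^sup>2 * (H0 * f \<omega>)"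
proof -
  let ?F = "\<lambda>n p. h (fst p) * h (fst p - (1 / lam n) *\<^sub>R snd p) * (c (snd p) * cos (snd p \<bullet> w n))"
  let ?G = "\<lambda>p. (h (fst p))\<^sup>2 * (c (snd p) * cos (snd p \<bullet> \<omega>))"
  have one: "\<bar>1::real\<bar> \<le> 1" by simp
  have inv: "(\<lambda>n. 1 / lam n) \<longlonglongrightarrow> 0"
    using tendsto_inverse_0_at_top[OF lam_top] by (simp add: inverse_eq_divide)
  have hc: "(\<lambda>n. h (v - (1 / lam n) *\<^sub>R z)) \<longlonglongrightarrow> h v" for v z
  proof -
    have "isCont h v" using h_continuous by (simp add: continuous_on_eq_continuous_at)
    moreover have "(\<lambda>n. v - (1 / lam n) *\<^sub>R z) \<longlonglongrightarrow> v - 0 *\<^sub>R z" by (intro tendsto_intros inv)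
    ultimately show ?thesis by (intro isCont_tendsto_compose[of v h]) simp_all
  qed
  have cint: "integrable lborel (\<lambda>z. c z * cos (z \<bullet> \<omega>))" by (rule trig_weighted_integrable(1)[OF c_integrable])
  have iG: "integrable (lborel \<Otimes>\<^sub>M lborel) ?G"
    using Fubini_kernel(3)[OF h2_integrable cint _ one] by (simp add: case_prod_beta')
  have "(\<lambda>n. \<integral>p. ?F n p \<partial>(lborel \<Otimes>\<^sub>M lborel)) \<longlonglongrightarrow> (\<integral>p. ?G p \<partial>(lborel \<Otimes>\<^sub>M lborel))"
  proof (rule integral_dominated_convergence[where w="\<lambda>p. hB * \<bar>h (fst p) * c (snd p)\<bar>"])
    show "?G \<in> borel_measurable (lborel \<Otimes>\<^sub>M lborel)" by measurable
    show "?F n \<in> borel_measurable (lborel \<Otimes>\<^sub>M lborel)" for n by measurable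
    show "integrable (lborel \<Otimes>\<^sub>M lborel) (\<lambda>p. hB * \<bar>h (fst p) * c (snd p)\<bar>)"
      using Fubini_kernel(3)[OF h_integrable c_integrable _ one] by (intro integrable_mult_right integrable_abs) (simp add: case_prod_beta')
    show "AE p in lborel \<Otimes>\<^sub>M lborel. (\<lambda>n. ?F n p) \<longlonglongrightarrow> ?G p"
    proof (intro AE_I2)
      fix p
      have "(\<lambda>n. ?F n p) \<longlonglongrightarrow> h (fst p) * h (fst p) * (c (snd p) * cos (snd p \<bullet> \<omega>))"
        by (intro tendsto_intros hc w)
      then show "(\<lambda>n. ?F n p) \<longlonglongrightarrow> ?G p" by (simp add: power2_eq_square)
    qed
    show "AE p in lborel \<Otimes>\<^sub>M lborel. norm (?F n p) \<le> hB * \<bar>h (fst p) * c (snd p)\<bar>" for n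
    proof (intro AE_I2)
      fix p
      have "\<bar>h (fst p)\<bar> * \<bar>h (fst p - (1 / lam n) *\<^sub>R snd p)\<bar> * (\<bar>c (snd p)\<bar> * \<bar>cos (snd p \<bullet> w n)\<bar>) \<le> \<bar>h (fst p)\<bar> * hB * (\<bar>c (snd p)\<bar> * 1)"
        using hB by (intro mult_mono) (auto intro: less_imp_le)
      then show "norm (?F n p) \<le> hB * \<bar>h (fst p) * c (snd p)\<bar>"
        by (simp only: real_norm_def abs_mult) (simp only: mult_ac mult_1_left)
    qed
  qed
  also have "(\<integral>p. ?G p \<partial>(lborel \<Otimes>\<^sub>M lborel)) = H0 * f \<omega>"
    using lborel_pair.integral_fst'[OF iG] by (simp add: H0_def f_eq)
  finally have "(\<lambda>n. (2 * pi)\<^sup>2 * (\<integral>p. ?F n p \<partial>(lborel \<Otimes>\<^sub>M lborel))) \<longlonglongrightarrow> (2 * pi)\<^sup>2 * (H0 * f \<omega>)"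
    by (rule tendsto_mult_left)
  then show ?thesis unfolding TT_def TT_kernel .
qed

text \<open>A product of two waves gives four kernel terms, with the sign of the cross terms
  distinguishing cosine from sine. The mixed form vanishes exactly, not only in the limit, because
  of the symmetry of the taper.\<close>

lemma qbar_wave:
  "(lam n)\<^sup>2 * qbar n (wv e n \<omega>) (wv e n \<omega>') =
     (TT n \<omega> \<omega>' + (if e then 1 else -1) * (TT n \<omega> (- \<omega>') + TT n (- \<omega>) \<omega>') + TT n (- \<omega>) (- \<omega>')) / (4 * (2 * pi)\<^sup>2)"
  and qbar_wave_mixed: "e \<noteq> e' \<Longrightarrow> qbar n (wv e n \<omega>) (wv e' n \<omega>') = 0"
proof -
  let ?m = "\<lambda>a x. ms n (x - a)"
  have p: "ms n (x + a) = ?m (- a) x" for x a by simp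
  let ?s = "if e then 1 else - 1 :: real"
  have prod: "mcos n (wv e n \<omega>) x * mcos n (wv e n \<omega>') x + msin n (wv e n \<omega>) x * msin n (wv e n \<omega>') x
    = (?m \<omega> x * ?m \<omega>' x + ?s * (?m \<omega> x * ?m (- \<omega>') x + ?m (- \<omega>) x * ?m \<omega>' x) + ?m (- \<omega>) x * ?m (- \<omega>') x) / 4" for x
    by (cases e) (simp_all only: mcos_cos msin_cos mcos_sin msin_sin p, simp_all add: field_simps)
  note i = TT_integrable
  have "(\<integral>x. f x * (mcos n (wv e n \<omega>) x * mcos n (wv e n \<omega>') x + msin n (wv e n \<omega>) x * msin n (wv e n \<omega>') x) \<partial>lborel)
    = (\<integral>x. (f x * (?m \<omega> x * ?m \<omega>' x) + ?s * (f x * (?m \<omega> x * ?m (- \<omega>') x) + f x * (?m (- \<omega>) x * ?m \<omega>' x)) + f x * (?m (- \<omega>) x * ?m (- \<omega>') x)) / 4 \<partial>lborel)"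
    unfolding prod by (intro Bochner_Integration.integral_cong refl) (simp only: distrib_left times_divide_eq_right mult.left_commute)
  also have "\<dots> = ((\<integral>x. f x * (?m \<omega> x * ?m \<omega>' x) \<partial>lborel) + ?s * ((\<integral>x. f x * (?m \<omega> x * ?m (- \<omega>') x) \<partial>lborel) + (\<integral>x. f x * (?m (- \<omega>) x * ?m \<omega>' x) \<partial>lborel)) + (\<integral>x. f x * (?m (- \<omega>) x * ?m (- \<omega>') x) \<partial>lborel)) / 4"
    by (simp only: integral_divide_zero integral_mult_right_zero
       Bochner_Integration.integral_add Bochner_Integration.integrable_add integrable_mult_right i)
  finally have eq: "(\<integral>x. f x * (mcos n (wv e n \<omega>) x * mcos n (wv e n \<omega>') x + msin n (wv e n \<omega>) x * msin n (wv e n \<omega>') x) \<partial>lborel) = \<dots>" .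
  have gen: "L * ((A + s * (B + C) + D) / 4 / P) = (L * A + s * (L * B + L * C) + L * D) / (4 * P)" for L A B C D s P :: real
    by (simp add: algebra_simps add_divide_distrib)
  show "(lam n)\<^sup>2 * qbar n (wv e n \<omega>) (wv e n \<omega>') =
     (TT n \<omega> \<omega>' + ?s * (TT n \<omega> (- \<omega>') + TT n (- \<omega>) \<omega>') + TT n (- \<omega>) (- \<omega>')) / (4 * (2 * pi)\<^sup>2)"
    unfolding qbar_def TT_def eq by (rule gen)
  show "qbar n (wv e n \<omega>) (wv e' n \<omega>') = 0" if "e \<noteq> e'"
    using that by (cases e; cases e') (simp_all add: qbar_def mcos_cos msin_cos mcos_sin msin_sin)
qed

definition TA :: "nat \<Rightarrow> real^2 \<Rightarrow> real" where
  "TA n \<omega> = (lam n)\<^sup>2 * (\<integral>x. \<bar>f x\<bar> * (\<bar>ms n (x - \<omega>)\<bar> * \<bar>ms n (x - \<omega>)\<bar>) \<partial>lborel)"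

lemma mass_wave: "(lam n)\<^sup>2 * mass n (wv e n \<omega>) \<le> (TA n \<omega> + TA n (- \<omega>)) / 2"
proof -
  let ?m = "\<lambda>a x. \<bar>f x\<bar> * (\<bar>ms n (x - a)\<bar> * \<bar>ms n (x - a)\<bar>)"
  note i = kernel_cross_integrable[of n]
  have sq: "((a + b) / 2)\<^sup>2 \<le> (a * a + b * b) / 2" "((a - b) / 2)\<^sup>2 \<le> (a * a + b * b) / 2" for a b :: real
  proof -
    have "0 \<le> (a - b)\<^sup>2" "0 \<le> (a + b)\<^sup>2" by simp_all
    then show "((a + b) / 2)\<^sup>2 \<le> (a * a + b * b) / 2" "((a - b) / 2)\<^sup>2 \<le> (a * a + b * b) / 2"
      by (simp_all add: power2_eq_square field_simps)
  qed
  have "(mcos n (wv e n \<omega>) x)\<^sup>2 + (msin n (wv e n \<omega>) x)\<^sup>2 \<le> (ms n (x - \<omega>) * ms n (x - \<omega>) + ms n (x - (- \<omega>)) * ms n (x - (- \<omega>))) / 2" for x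
    using sq[of "ms n (x - \<omega>)" "ms n (x + \<omega>)"] by (cases e) (simp_all add: mcos_cos msin_cos mcos_sin msin_sin)
  from mult_left_mono[OF this abs_ge_zero]
  have le: "\<bar>f x\<bar> * ((mcos n (wv e n \<omega>) x)\<^sup>2 + (msin n (wv e n \<omega>) x)\<^sup>2) \<le> (?m \<omega> x + ?m (- \<omega>) x) / 2" for x
    by (simp add: distrib_left)
  have "mass n (wv e n \<omega>) \<le> (\<integral>x. (?m \<omega> x + ?m (- \<omega>) x) / 2 \<partial>lborel)"
    unfolding mass_def
  proof (rule integral_mono[OF mass_integrable[OF wv_measurable wv_bounded] _ le])
    show "integrable lborel (\<lambda>x. (?m \<omega> x + ?m (- \<omega>) x) / 2)"
      by (intro integrable_divide Bochner_Integration.integrable_add i)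
  qed
  also have "\<dots> = ((\<integral>x. ?m \<omega> x \<partial>lborel) + (\<integral>x. ?m (- \<omega>) x \<partial>lborel)) / 2"
    by (simp only: integral_divide_zero Bochner_Integration.integral_add i)
  finally have "(lam n)\<^sup>2 * mass n (wv e n \<omega>) \<le> (lam n)\<^sup>2 * (((\<integral>x. ?m \<omega> x \<partial>lborel) + (\<integral>x. ?m (- \<omega>) x \<partial>lborel)) / 2)"
    by (rule mult_left_mono) simp
  then show ?thesis unfolding TA_def by (simp only: distrib_left times_divide_eq_right)
qed

text \<open>The value of \<open>kernel_cross_bound\<close> at coinciding frequencies, where both
  profiles equal 1.\<close>

definition D0 :: real where "D0 = fB * mK\<^sup>2 * (2 * phi32int)\<^sup>2"

lemma mass_wave_bounded: "(lam n)\<^sup>2 * mass n (wv e n \<omega>) \<le> D0"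
proof -
  have "TA n \<omega> \<le> D0" for \<omega>
    using kernel_cross_bound[of n \<omega> \<omega>] by (simp add: TA_def D0_def phi_def)
  then have "(TA n \<omega> + TA n (- \<omega>)) / 2 \<le> (D0 + D0) / 2" by (intro divide_right_mono add_mono) auto
  then show ?thesis using order_trans[OF mass_wave] by simp
qed

text \<open>The conditional covariance in the normalisation of the periodogram.\<close>

definition Q :: "nat \<Rightarrow> (real^2 \<Rightarrow> real) \<Rightarrow> (real^2 \<Rightarrow> real) \<Rightarrow> 'a \<Rightarrow> real" where
  "Q n \<alpha> \<beta> w = (lam n)\<^sup>2 / ((real n)\<^sup>2 * H0) * quad n \<alpha> \<beta> w"

lemma Lconv_Q_wave:
  assumes "(\<lambda>n. (lam n)\<^sup>2 * qbar n (wv e n (w n)) (wv e' n (v n))) \<longlonglongrightarrow> H0 * q"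
  shows "Lconv M (\<lambda>n. Q n (wv e n (w n)) (wv e' n (v n))) q"
proof -
  have "Lconv M (\<lambda>n x. (lam n)\<^sup>2 / (real n)\<^sup>2 * quad n (wv e n (w n)) (wv e' n (v n)) x) (H0 * q)"
    by (rule Lconv_quad[OF wv_measurable wv_bounded wv_measurable wv_bounded _ _ rho assms, where D=D0])
       (use mass_wave_bounded in auto)
  from Lconv_cmult[OF prob_space_axioms this, of "1 / H0"] show ?thesis
    using H0_pos by (simp add: Q_def[abs_def] mult.commute[of H0])
qed

text \<open>The kernel terms at \<omega> and at -\<omega> both tend to (2 pi)^2 H0 f(\<omega>), the
  second by evenness of f, while the cross terms vanish; dividing by 4 (2 pi)^2 H0 leaves
  f(\<omega>)/2. At \<omega> = 0 the cross terms are diagonal as well, hence the exclusion.\<close>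

lemma Lconv_Q_diag:
  assumes w: "w \<longlonglongrightarrow> \<omega>" and ne: "\<omega> \<noteq> 0"
  shows "Lconv M (\<lambda>n. Q n (wv e n (w n)) (wv e' n (w n))) (if e = e' then f \<omega> / 2 else 0)"
proof (cases "e = e'")
  case True
  have nw: "(\<lambda>n. - w n) \<longlonglongrightarrow> - \<omega>" by (intro tendsto_intros w)
  have ne': "\<omega> \<noteq> - \<omega>"
  proof
    assume "\<omega> = - \<omega>"
    then have "2 *\<^sub>R \<omega> = 0" by (simp add: scaleR_2 eq_neg_iff_add_eq_0)
    then show False using ne by simp
  qed
  have "(\<lambda>n. (lam n)\<^sup>2 * qbar n (wv e n (w n)) (wv e n (w n))) \<longlonglongrightarrow>
    ((2 * pi)\<^sup>2 * (H0 * f \<omega>) + (if e then 1 else -1) * (0 + 0) + (2 * pi)\<^sup>2 * (H0 * f (- \<omega>))) / (4 * (2 * pi)\<^sup>2)"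
    unfolding qbar_wave
    by (intro tendsto_divide tendsto_add tendsto_mult tendsto_const TT_diag[OF w] TT_diag[OF nw] TT_null[OF w nw ne'] TT_null[OF nw w ne'[symmetric]]) simp
  also have "((2 * pi)\<^sup>2 * (H0 * f \<omega>) + (if e then 1 else -1) * (0 + 0) + (2 * pi)\<^sup>2 * (H0 * f (- \<omega>))) / (4 * (2 * pi)\<^sup>2) = H0 * (f \<omega> / 2)"
    by (simp add: f_even field_simps)
  finally show ?thesis using True Lconv_Q_wave by simp
next
  case False
  then show ?thesis using Lconv_Q_wave[of e w e' w 0] by (simp add: qbar_wave_mixed)
qed

lemma Lconv_Q_off:
  assumes w: "w \<longlonglongrightarrow> \<omega>" and v: "v \<longlonglongrightarrow> \<omega>'" and ne: "\<omega> \<noteq> \<omega>'" "\<omega> \<noteq> - \<omega>'"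
  shows "Lconv M (\<lambda>n. Q n (wv e n (w n)) (wv e' n (v n))) 0"
proof (cases "e = e'")
  case True
  have nw: "(\<lambda>n. - w n) \<longlonglongrightarrow> - \<omega>" "(\<lambda>n. - v n) \<longlonglongrightarrow> - \<omega>'" by (intro tendsto_intros w v)+
  have "(\<lambda>n. (lam n)\<^sup>2 * qbar n (wv e n (w n)) (wv e n (v n))) \<longlonglongrightarrow>
    (0 + (if e then 1 else -1) * (0 + 0) + 0) / (4 * (2 * pi)\<^sup>2)"
    unfolding qbar_wave
    by (intro tendsto_divide tendsto_add tendsto_mult tendsto_const TT_null[OF w v] TT_null[OF w nw(2)] TT_null[OF nw(1) v] TT_null[OF nw])
       (use ne in \<open>auto simp: minus_equation_iff\<close>)
  then show ?thesis using True Lconv_Q_wave[of e w e v 0] by simp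
next
  case False
  then show ?thesis using Lconv_Q_wave[of e w e' v 0] by (simp add: qbar_wave_mixed)
qed

text \<open>Nonnegativity of \<open>f\<close> is not assumed: the conditional variances are nonnegative and
  converge to \<open>f \<omega> / 2\<close>.\<close>

lemma f_nonneg_nonzero: "\<omega> \<noteq> 0 \<Longrightarrow> 0 \<le> f \<omega>"
proof -
  assume ne: "\<omega> \<noteq> 0"
  have "Lconv M (\<lambda>n. Q n (wv True n \<omega>) (wv True n \<omega>)) (f \<omega> / 2)"
    using Lconv_Q_diag[OF tendsto_const ne, of True True] by simp
  from Lconv_integral[OF prob_space_axioms this] have "0 \<le> f \<omega> / 2"
  proof (rule LIMSEQ_le_const, intro exI allI impI)
    show "0 \<le> expectation (Q n (wv True n \<omega>) (wv True n \<omega>))" for n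
      unfolding Q_def using H0_pos quad_nonneg by (intro integral_nonneg_AE AE_I2) simp
  qed
  then show ?thesis by simp
qed

end

section \<open>Moments of the periodogram\<close>

text \<open>The weights and directions of a Hilbert identity. It reduces the moments of the squared modulus of
  a Gaussian vector in the plane to those of one-dimensional Gaussian variables.\<close>

definition "dirc = (\<lambda>i. [39/70, 39/70, 11/630, 11/630, 1/1260, 1/1260, 1/1260, 1/1260 :: real] ! i)"
definition "dirp = (\<lambda>i. [1, 0, 1, 1, 2, 2, 1, 1 :: real] ! i)"
definition "dirq = (\<lambda>i. [0, 1, 1, -1, 1, -1, 2, -2 :: real] ! i)"

lemma sum_8: "(\<Sum>i<8. F i) = F 0 + F 1 + F 2 + F 3 + F 4 + F 5 + F 6 + F (7::nat)" for F :: "nat \<Rightarrow> real"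
proof -
  have "{..<8} = {0,1,2,3,4,5,6,7::nat}" by auto
  then show ?thesis by simp
qed

text \<open>The directions are the axes, the diagonals and the four vectors (2, 1), (2, -1), (1, 2),
  (1, -2). Odd powers cancel between directions of opposite sign, and the symmetry in x and y leaves
  three coefficients to match; these determine the three different weights.\<close>

lemma hilbert_identity: "(x\<^sup>2 + y\<^sup>2) ^ 4 = (\<Sum>i<8. dirc i * (dirp i * x + dirq i * y) ^ 8)"
proof -
  have e: "(s + t) ^ 8 = s^8 + 8 * s^7 * t + 28 * s^6 * t^2 + 56 * s^5 * t^3 + 70 * s^4 * t^4
     + 56 * s^3 * t^5 + 28 * s^2 * t^6 + 8 * s * t^7 + t^8" for s t :: real
    by (simp add: algebra_simps power_numeral_even power_numeral_odd)
  have "(x\<^sup>2 + y\<^sup>2) ^ 4 = x^8 + 4 * x^6 * y^2 + 6 * x^4 * y^4 + 4 * x^2 * y^6 + y^8"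
    by (simp add: algebra_simps power_numeral_even power_numeral_odd)
  moreover have e': "(s - t) ^ 8 = s^8 - 8 * s^7 * t + 28 * s^6 * t^2 - 56 * s^5 * t^3 + 70 * s^4 * t^4
     - 56 * s^3 * t^5 + 28 * s^2 * t^6 - 8 * s * t^7 + t^8" for s t :: real
    using e[of s "- t"] by simp
  ultimately show ?thesis
    unfolding sum_8 dirc_def dirp_def dirq_def by (simp add: e e' power_mult_distrib field_simps)
qed

text \<open>The identity averaged over a standard normal pair: the left side becomes the fourth
  moment of a chi-square variable with two degrees of freedom, 4! * 2^4.\<close>

lemma dirc_weights: "(\<Sum>i<8. dirc i * (105 * ((dirp i)\<^sup>2 + (dirq i)\<^sup>2) ^ 4)) = 24 * 16"
  unfolding sum_8 dirc_def dirp_def dirq_def by simp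

lemma moment88_scale: "moment88 (k * u) (k * v) (k * r) = k ^ 8 * moment88 u v r"
  unfolding moment88_def
  by (simp add: power_mult_distrib distrib_left power_numeral_even power_numeral_odd mult_ac)

context tapered_sample
begin

text \<open>The weights whose \<open>lin\<close> is the component of the cosine-sine vector along
  the i-th direction of the Hilbert identity.\<close>

definition dv :: "nat \<Rightarrow> nat \<Rightarrow> real^2 \<Rightarrow> real^2 \<Rightarrow> real" where
  "dv i n \<omega> s = dirp i * wv True n \<omega> s + dirq i * wv False n \<omega> s"

lemma dv_measurable [measurable]: "dv i n \<omega> \<in> borel_measurable borel"
  unfolding dv_def[abs_def] by measurable

lemma dv_bounded: "\<bar>dv i n \<omega> s\<bar> \<le> (\<bar>dirp i\<bar> + \<bar>dirq i\<bar>) * hB"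
proof -
  have "\<bar>dv i n \<omega> s\<bar> \<le> \<bar>dirp i\<bar> * \<bar>wv True n \<omega> s\<bar> + \<bar>dirq i\<bar> * \<bar>wv False n \<omega> s\<bar>"
    unfolding dv_def by (rule order_trans[OF abs_triangle_ineq]) (simp add: abs_mult)
  also have "\<dots> \<le> \<bar>dirp i\<bar> * hB + \<bar>dirq i\<bar> * hB" by (intro add_mono mult_left_mono wv_bounded) auto
  finally show ?thesis by (simp add: distrib_right)
qed

lemma lin_dv: "lin n (dv i n \<omega>) w = dirp i * lin n (wv True n \<omega>) w + dirq i * lin n (wv False n \<omega>) w"
  unfolding lin_def dv_def by (simp add: sum.distrib sum_distrib_left algebra_simps)

lemma quad_add_left: "quad n (\<lambda>s. a * \<alpha> s + b * \<beta> s) \<gamma> w = a * quad n \<alpha> \<gamma> w + b * quad n \<beta> \<gamma> w"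
  unfolding quad_def by (simp add: sum.distrib sum_distrib_left algebra_simps)

lemma quad_add_right: "quad n \<gamma> (\<lambda>s. a * \<alpha> s + b * \<beta> s) w = a * quad n \<gamma> \<alpha> w + b * quad n \<gamma> \<beta> w"
  unfolding quad_def by (simp add: sum.distrib sum_distrib_left algebra_simps)

lemma Q_dv: "Q n (dv i n \<omega>) (dv j n \<omega>') w =
    dirp i * dirp j * Q n (wv True n \<omega>) (wv True n \<omega>') w + dirp i * dirq j * Q n (wv True n \<omega>) (wv False n \<omega>') w
  + (dirq i * dirp j * Q n (wv False n \<omega>) (wv True n \<omega>') w + dirq i * dirq j * Q n (wv False n \<omega>) (wv False n \<omega>') w)"
proof -
  have gen: "K * (a * (a' * A + b' * B) + b * (a' * C + b' * D))
    = a * a' * (K * A) + a * b' * (K * B) + (b * a' * (K * C) + b * b' * (K * D))" for K a a' b b' A B C D :: real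
    by (simp add: algebra_simps)
  show ?thesis unfolding Q_def dv_def[abs_def] quad_add_left quad_add_right by (rule gen)
qed

lemma Lconv_dv_diag:
  assumes w: "w \<longlonglongrightarrow> \<omega>" and ne: "\<omega> \<noteq> 0"
  shows "Lconv M (\<lambda>n. Q n (dv i n (w n)) (dv i n (w n))) (((dirp i)\<^sup>2 + (dirq i)\<^sup>2) * (f \<omega> / 2))"
proof -
  note L = Lconv_Q_diag[OF w ne]
  have "Lconv M (\<lambda>n x. dirp i * dirp i * Q n (wv True n (w n)) (wv True n (w n)) x + dirp i * dirq i * Q n (wv True n (w n)) (wv False n (w n)) x
  + (dirq i * dirp i * Q n (wv False n (w n)) (wv True n (w n)) x + dirq i * dirq i * Q n (wv False n (w n)) (wv False n (w n)) x))
   (dirp i * dirp i * (f \<omega> / 2) + dirp i * dirq i * 0 + (dirq i * dirp i * 0 + dirq i * dirq i * (f \<omega> / 2)))"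
    using L[of True True] L[of True False] L[of False True] L[of False False]
    by (intro Lconv_add Lconv_cmult prob_space_axioms) simp_all
  moreover have "dirp i * dirp i * (f \<omega> / 2) + dirp i * dirq i * 0 + (dirq i * dirp i * 0 + dirq i * dirq i * (f \<omega> / 2)) = ((dirp i)\<^sup>2 + (dirq i)\<^sup>2) * (f \<omega> / 2)"
    by (simp add: power2_eq_square algebra_simps add_divide_distrib)
  ultimately show ?thesis unfolding Q_dv[abs_def] by (simp only:)
qed

lemma Lconv_dv_off:
  assumes w: "w \<longlonglongrightarrow> \<omega>" and v: "v \<longlonglongrightarrow> \<omega>'" and ne: "\<omega> \<noteq> \<omega>'" "\<omega> \<noteq> - \<omega>'"
  shows "Lconv M (\<lambda>n. Q n (dv i n (w n)) (dv j n (v n))) 0"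
proof -
  have "Lconv M (\<lambda>n x. dirp i * dirp j * Q n (wv True n (w n)) (wv True n (v n)) x + dirp i * dirq j * Q n (wv True n (w n)) (wv False n (v n)) x
  + (dirq i * dirp j * Q n (wv False n (w n)) (wv True n (v n)) x + dirq i * dirq j * Q n (wv False n (w n)) (wv False n (v n)) x))
   (dirp i * dirp j * 0 + dirp i * dirq j * 0 + (dirq i * dirp j * 0 + dirq i * dirq j * 0))"
    by (intro Lconv_add Lconv_cmult prob_space_axioms Lconv_Q_off[OF w v ne])
  then show ?thesis by (simp add: Q_dv[abs_def])
qed

lemma Re_H2_0: "Re (H2 h 0) = H0"
proof -
  have z: "(\<chi> i. 0) = (0 :: real^2)" by (simp add: vec_eq_iff)
  have "H2 h 0 = (\<integral>s. complex_of_real ((h s)\<^sup>2) \<partial>lborel)"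
    unfolding H2_def set_lebesgue_integral_def
    by (intro Bochner_Integration.integral_cong refl) (use h_outside in \<open>auto simp: z split: split_indicator\<close>)
  also have "\<dots> = complex_of_real H0" unfolding H0_def by (rule integral_complex_of_real)
  finally show ?thesis by simp
qed

definition I :: "nat \<Rightarrow> real^2 \<Rightarrow> 'a \<Rightarrow> real" where
  "I n \<omega> w = periodogram h n (lam n) Z (S n) \<omega> w"

definition kap :: "nat \<Rightarrow> real" where "kap n = (lam n)\<^sup>2 / ((real n)\<^sup>2 * H0)"

lemma kap_nonneg: "0 \<le> kap n" using H0_pos by (simp add: kap_def)

lemma I_eq: "I n \<omega> w = kap n * ((lin n (wv True n \<omega>) w)\<^sup>2 + (lin n (wv False n \<omega>) w)\<^sup>2)"
proof -
  let ?s = "\<lambda>j. S n j w"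
  let ?z = "\<Sum>j=1..n. complex_of_real (h ((1 / lam n) *\<^sub>R ?s j) * Z (?s j) w) * exp (\<i> * complex_of_real (?s j \<bullet> \<omega>))"
  have "Re ?z = lin n (wv True n \<omega>) w"
    unfolding lin_def wv_def Re_sum by (intro sum.cong refl) (simp add: Re_exp mult_ac)
  moreover have "Im ?z = lin n (wv False n \<omega>) w"
    unfolding lin_def wv_def Im_sum by (intro sum.cong refl) (simp add: Im_exp mult_ac)
  ultimately have "(cmod ?z)\<^sup>2 = (lin n (wv True n \<omega>) w)\<^sup>2 + (lin n (wv False n \<omega>) w)\<^sup>2"
    by (simp only: cmod_power2)
  then show ?thesis by (simp add: I_def periodogram_def Re_H2_0 kap_def)
qed

lemma I_measurable [measurable]: "I n \<omega> \<in> borel_measurable M"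
  unfolding I_eq[abs_def] by measurable

lemma I_power4: "I n \<omega> w ^ 4 = (\<Sum>i<8. dirc i * (kap n ^ 4 * lin n (dv i n \<omega>) w ^ 8))"
  unfolding I_eq power_mult_distrib hilbert_identity lin_dv sum_distrib_left
  by (intro sum.cong refl) (simp only: mult_ac)

lemma kap_quad: "kap n * quad n \<alpha> \<beta> w = Q n \<alpha> \<beta> w" by (simp add: kap_def Q_def)

text \<open>The factor 105 = 8!/(2^4 4!) is the eighth moment of the standard normal law.\<close>

lemma
  shows I4_integrable: "integrable M (\<lambda>w. I n \<omega> w ^ 4)"
    and I4_expectation: "expectation (\<lambda>w. I n \<omega> w ^ 4) = (\<Sum>i<8. dirc i * (105 * expectation (\<lambda>w. Q n (dv i n \<omega>) (dv i n \<omega>) w ^ 4)))"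
proof -
  note m = lin_even_integrable[OF dv_measurable dv_bounded, of n _ n \<omega> 4] lin_even_moment[OF dv_measurable dv_bounded, of n _ n \<omega> 4]
  have i: "integrable M (\<lambda>w. lin n (dv i n \<omega>) w ^ 8)" for i using m(1)[of i] by simp
  have e: "kap n ^ 4 * expectation (\<lambda>w. lin n (dv i n \<omega>) w ^ 8) = 105 * expectation (\<lambda>w. Q n (dv i n \<omega>) (dv i n \<omega>) w ^ 4)" for i
  proof -
    have "expectation (\<lambda>w. lin n (dv i n \<omega>) w ^ 8) = 105 * expectation (\<lambda>w. quad n (dv i n \<omega>) (dv i n \<omega>) w ^ 4)"
      using m(2)[of i] by (simp add: fact_numeral)
    then show ?thesis by (simp add: kap_quad[symmetric] power_mult_distrib)
  qed
  show "integrable M (\<lambda>w. I n \<omega> w ^ 4)" unfolding I_power4 using i by simp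
  show "expectation (\<lambda>w. I n \<omega> w ^ 4) = (\<Sum>i<8. dirc i * (105 * expectation (\<lambda>w. Q n (dv i n \<omega>) (dv i n \<omega>) w ^ 4)))"
    unfolding I_power4 e[symmetric] using i by simp
qed

lemma
  shows I44_integrable: "integrable M (\<lambda>w. I n \<omega> w ^ 4 * I n \<omega>' w ^ 4)"
    and I44_expectation: "expectation (\<lambda>w. I n \<omega> w ^ 4 * I n \<omega>' w ^ 4) = (\<Sum>i<8. \<Sum>j<8. dirc i * dirc j *
      expectation (\<lambda>w. moment88 (Q n (dv i n \<omega>) (dv i n \<omega>) w) (Q n (dv j n \<omega>') (dv j n \<omega>') w) (Q n (dv i n \<omega>) (dv j n \<omega>') w)))"
proof -
  have prod: "I n \<omega> w ^ 4 * I n \<omega>' w ^ 4 = (\<Sum>i<8. \<Sum>j<8. dirc i * dirc j * (kap n ^ 8 * (lin n (dv i n \<omega>) w ^ 8 * lin n (dv j n \<omega>') w ^ 8)))" for w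
  proof -
    have k: "kap n ^ 8 = kap n ^ 4 * kap n ^ 4" by (simp flip: power_add)
    show ?thesis unfolding I_power4 sum_product k by (intro sum.cong refl) (simp only: mult_ac)
  qed
  have i: "integrable M (\<lambda>w. lin n (dv i n \<omega>) w ^ 8 * lin n (dv j n \<omega>') w ^ 8)" for i j
    by (rule lin_moment88_integrable[OF dv_measurable dv_measurable dv_bounded dv_bounded])
  have e: "kap n ^ 8 * expectation (\<lambda>w. lin n (dv i n \<omega>) w ^ 8 * lin n (dv j n \<omega>') w ^ 8)
    = expectation (\<lambda>w. moment88 (Q n (dv i n \<omega>) (dv i n \<omega>) w) (Q n (dv j n \<omega>') (dv j n \<omega>') w) (Q n (dv i n \<omega>) (dv j n \<omega>') w))" for i j
    unfolding kap_quad[symmetric] moment88_scale integral_mult_right_zero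
    by (subst lin_moment88[OF dv_measurable dv_measurable dv_bounded dv_bounded]) simp
  show "integrable M (\<lambda>w. I n \<omega> w ^ 4 * I n \<omega>' w ^ 4)" unfolding prod using i by simp
  show "expectation (\<lambda>w. I n \<omega> w ^ 4 * I n \<omega>' w ^ 4) = (\<Sum>i<8. \<Sum>j<8. dirc i * dirc j *
      expectation (\<lambda>w. moment88 (Q n (dv i n \<omega>) (dv i n \<omega>) w) (Q n (dv j n \<omega>') (dv j n \<omega>') w) (Q n (dv i n \<omega>) (dv j n \<omega>') w)))"
    unfolding prod e[symmetric] using i by simp
qed

lemma I4_limit:
  assumes w: "w \<longlonglongrightarrow> \<omega>" and ne: "\<omega> \<noteq> 0"
  shows "(\<lambda>n. expectation (\<lambda>x. I n (w n) x ^ 4)) \<longlonglongrightarrow> 24 * f \<omega> ^ 4"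
proof -
  have "(\<lambda>n. expectation (\<lambda>x. I n (w n) x ^ 4)) \<longlonglongrightarrow> (\<Sum>i<8. dirc i * (105 * (((dirp i)\<^sup>2 + (dirq i)\<^sup>2) * (f \<omega> / 2)) ^ 4))"
    unfolding I4_expectation
    by (intro tendsto_sum tendsto_mult tendsto_const Lconv_integral[OF prob_space_axioms] Lconv_power[OF prob_space_axioms] Lconv_dv_diag[OF w ne])
  also have "(\<Sum>i<8. dirc i * (105 * (((dirp i)\<^sup>2 + (dirq i)\<^sup>2) * (f \<omega> / 2)) ^ 4)) = (\<Sum>i<8. dirc i * (105 * ((dirp i)\<^sup>2 + (dirq i)\<^sup>2) ^ 4)) * (f \<omega> ^ 4 / 16)"
    unfolding sum_distrib_right by (intro sum.cong refl) (simp add: power_mult_distrib power_divide)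
  finally show ?thesis unfolding dirc_weights by simp
qed

text \<open>The excluded pairs are those for which the covariance across frequencies or within one
  frequency need not vanish. Otherwise the joint moment factorises along each pair of directions,
  and hence after summation.\<close>

lemma I44_limit:
  assumes w: "w \<longlonglongrightarrow> \<omega>" and v: "v \<longlonglongrightarrow> \<omega>'" and ne: "\<omega> \<noteq> 0" "\<omega>' \<noteq> 0" "\<omega> \<noteq> \<omega>'" "\<omega> \<noteq> - \<omega>'"
  shows "(\<lambda>n. expectation (\<lambda>x. I n (w n) x ^ 4 * I n (v n) x ^ 4)) \<longlonglongrightarrow> (24 * f \<omega> ^ 4) * (24 * f \<omega>' ^ 4)"
proof -
  have K: "(\<Sum>i<8. dirc i * (105 * (((dirp i)\<^sup>2 + (dirq i)\<^sup>2) * (y / 2)) ^ 4)) = 24 * y ^ 4" for y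
  proof -
    have "(\<Sum>i<8. dirc i * (105 * (((dirp i)\<^sup>2 + (dirq i)\<^sup>2) * (y / 2)) ^ 4)) = (\<Sum>i<8. dirc i * (105 * ((dirp i)\<^sup>2 + (dirq i)\<^sup>2) ^ 4)) * (y ^ 4 / 16)"
      unfolding sum_distrib_right by (intro sum.cong refl) (simp add: power_mult_distrib power_divide)
    then show ?thesis unfolding dirc_weights by simp
  qed
  let ?u = "\<lambda>i. ((dirp i)\<^sup>2 + (dirq i)\<^sup>2) * (f \<omega> / 2)" and ?v = "\<lambda>i. ((dirp i)\<^sup>2 + (dirq i)\<^sup>2) * (f \<omega>' / 2)"
  have "(\<lambda>n. expectation (\<lambda>x. I n (w n) x ^ 4 * I n (v n) x ^ 4)) \<longlonglongrightarrow> (\<Sum>i<8. \<Sum>j<8. dirc i * dirc j * (11025 * ?u i ^ 4 * ?v j ^ 4))"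
    unfolding I44_expectation
    by (intro tendsto_sum tendsto_mult[OF tendsto_const] Lconv_moment88[OF prob_space_axioms] Lconv_dv_diag[OF w ne(1)] Lconv_dv_diag[OF v ne(2)] Lconv_dv_off[OF w v ne(3,4)])
  also have "(\<Sum>i<8. \<Sum>j<8. dirc i * dirc j * (11025 * ?u i ^ 4 * ?v j ^ 4)) = (\<Sum>i<8. dirc i * (105 * ?u i ^ 4)) * (\<Sum>j<8. dirc j * (105 * ?v j ^ 4))"
    unfolding sum_product by (intro sum.cong refl) simp
  finally show ?thesis unfolding K .
qed

end

section \<open>Majorants for the moments of the periodogram\<close>

definition phi2 :: "real^2 \<Rightarrow> real" where "phi2 \<omega> = phi (\<omega>$1) ^ 2 * phi (\<omega>$2) ^ 2"

lemma phi2_pos: "0 < phi2 \<omega>" 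
  unfolding phi2_def by (intro mult_pos_pos zero_less_power phi_pos)

locale tapered_bounded = tapered_sample +
  fixes Kf :: real
  assumes Kf: "0 \<le> Kf" and f_le: "\<And>\<omega>. \<bar>f \<omega>\<bar> \<le> Kf * phi2 \<omega>"
begin

definition Kg :: real where "Kg = Kf * mK\<^sup>2 * (32 * phi2int)\<^sup>2"

lemma Kg_nonneg: "0 \<le> Kg" using Kf by (simp add: Kg_def)

text \<open>This refines \<open>kernel_cross_bound\<close> at equal frequencies: the decay of f is
  used in place of its supremum, and the convolution bound passes that decay on to \<omega>.\<close>

lemma TA_le:
  assumes l: "1 \<le> lam n"
  shows "TA n \<omega> \<le> Kg * phi2 \<omega>"
proof -
  let ?l = "lam n"
  let ?g = "\<lambda>i t. phi t ^ 2 * (?l * phi (?l * (t - \<omega>$i)) ^ 2)"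
  note ig = integrable_phi_conv[OF l, of "\<omega>$1"] integrable_phi_conv[OF l, of "\<omega>$2"]
  have p0: "0 \<le> phi y" for y using phi_pos[of y] by simp
  have le: "?l\<^sup>2 * (\<bar>f x\<bar> * (\<bar>ms n (x - \<omega>)\<bar> * \<bar>ms n (x - \<omega>)\<bar>)) \<le> Kf * mK\<^sup>2 * (?g 1 (x$1) * ?g 2 (x$2))" for x
  proof -
    have "\<bar>f x\<bar> * (\<bar>ms n (x - \<omega>)\<bar> * \<bar>ms n (x - \<omega>)\<bar>) \<le> (Kf * phi2 x) * ((mK * (phi (?l * (x$1 - \<omega>$1)) * phi (?l * (x$2 - \<omega>$2)))) * (mK * (phi (?l * (x$1 - \<omega>$1)) * phi (?l * (x$2 - \<omega>$2)))))"
      using mK(2)[of "?l *\<^sub>R (x - \<omega>)"] mK(1) p0 f_le[of x] Kf phi2_pos[of x]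
      by (intro mult_mono) (auto intro!: mult_nonneg_nonneg)
    then have "?l\<^sup>2 * (\<bar>f x\<bar> * (\<bar>ms n (x - \<omega>)\<bar> * \<bar>ms n (x - \<omega>)\<bar>)) \<le> ?l\<^sup>2 * ((Kf * phi2 x) * ((mK * (phi (?l * (x$1 - \<omega>$1)) * phi (?l * (x$2 - \<omega>$2)))) * (mK * (phi (?l * (x$1 - \<omega>$1)) * phi (?l * (x$2 - \<omega>$2))))))"
      by (rule mult_left_mono) simp
    also have "\<dots> = Kf * mK\<^sup>2 * (?g 1 (x$1) * ?g 2 (x$2))" by (simp only: power2_eq_square phi2_def mult_ac)
    finally show ?thesis .
  qed
  have "TA n \<omega> \<le> (\<integral>x. Kf * mK\<^sup>2 * (?g 1 (x$1) * ?g 2 (x$2)) \<partial>(lborel :: (real^2) measure))"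
    unfolding TA_def integral_mult_right_zero[symmetric]
    by (rule integral_mono[OF integrable_mult_right[OF kernel_cross_integrable]])
       (intro integrable_mult_right integrable_prod2 ig, rule le)
  also have "\<dots> = Kf * mK\<^sup>2 * ((\<integral>t. ?g 1 t \<partial>lborel) * (\<integral>t. ?g 2 t \<partial>lborel))"
    by (simp only: integral_mult_right_zero integral_prod2[OF ig])
  also have "\<dots> \<le> Kf * mK\<^sup>2 * ((32 * phi2int * phi (\<omega>$1) ^ 2) * (32 * phi2int * phi (\<omega>$2) ^ 2))"
  proof (intro mult_left_mono mult_mono integral_phi_conv l)
    show "0 \<le> 32 * phi2int * phi (\<omega>$1) ^ 2" using phi2int_nonneg by simp
    show "0 \<le> (\<integral>t. ?g 2 t \<partial>lborel)" using l by (intro integral_nonneg_AE AE_I2) simp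
    show "0 \<le> Kf * mK\<^sup>2" using Kf by simp
  qed
  also have "\<dots> = Kg * phi2 \<omega>" by (simp only: Kg_def phi2_def power2_eq_square mult_ac)
  finally show ?thesis .
qed

lemma mass_wave_le:
  assumes l: "1 \<le> lam n"
  shows "(lam n)\<^sup>2 * mass n (wv e n \<omega>) \<le> Kg * phi2 \<omega>"
proof -
  have "phi2 (- \<omega>) = phi2 \<omega>" by (simp add: phi2_def phi_def)
  then have "(TA n \<omega> + TA n (- \<omega>)) / 2 \<le> (Kg * phi2 \<omega> + Kg * phi2 \<omega>) / 2"
    using TA_le[OF l, of \<omega>] TA_le[OF l, of "- \<omega>"] by (intro divide_right_mono add_mono) auto
  also have "(Kg * phi2 \<omega> + Kg * phi2 \<omega>) / 2 = Kg * phi2 \<omega>" by simp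
  finally show ?thesis by (rule order_trans[OF mass_wave])
qed

abbreviation (input) rh :: "nat \<Rightarrow> real" where "rh n \<equiv> (lam n)\<^sup>2 / real n"

text \<open>The factors 2^8 and 2 come from separating the cosine and sine parts, 2027025 = 15!! is
  the sixteenth moment of the standard normal law, the power of H0 comes from the normalisation, and
  8^8 from \<open>quad_moment_bound\<close> with p = 7.\<close>

definition Kd :: real where
  "Kd = 2 ^ 8 * (2 * (2027025 * ((1 / H0) ^ 8 * (8 ^ 8 * (Kg ^ 8 + dmassK hB 7)))))"

lemma dmassK_nonneg: "0 \<le> dmassK A p"
  unfolding dmassK_def by (intro mult_nonneg_nonneg) auto

lemma Kd_nonneg: "0 \<le> Kd"
  unfolding Kd_def using Kg_nonneg dmassK_nonneg H0_pos by simp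

lemma lin_wave_moment16:
  assumes n: "1 \<le> n" and l: "1 \<le> lam n"
  shows "kap n ^ 8 * expectation (\<lambda>w. lin n (wv e n \<omega>) w ^ 16) \<le> 2027025 * ((1 / H0) ^ 8 * (8 ^ 8 * (Kg ^ 8 + dmassK hB 7))) * (phi2 \<omega> + rh n) ^ 8"
proof -
  let ?a = "phi2 \<omega> + rh n"
  have r0: "0 \<le> rh n" by simp
  have "expectation (\<lambda>w. lin n (wv e n \<omega>) w ^ 16) = 2027025 * expectation (\<lambda>w. quad n (wv e n \<omega>) (wv e n \<omega>) w ^ 8)"
    using lin_even_moment[OF wv_measurable wv_bounded, of n e n \<omega> 8] by (simp add: fact_numeral)
  moreover have "kap n ^ 8 * expectation (\<lambda>w. quad n (wv e n \<omega>) (wv e n \<omega>) w ^ 8)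
     = (1 / H0) ^ 8 * expectation (\<lambda>w. ((lam n)\<^sup>2 / (real n)\<^sup>2 * quad n (wv e n \<omega>) (wv e n \<omega>) w) ^ 8)"
  proof -
    have k: "kap n = (1 / H0) * ((lam n)\<^sup>2 / (real n)\<^sup>2)" by (simp add: kap_def)
    show ?thesis unfolding k power_mult_distrib by (simp only: integral_mult_right_zero mult.assoc)
  qed
  moreover have "expectation (\<lambda>w. ((lam n)\<^sup>2 / (real n)\<^sup>2 * quad n (wv e n \<omega>) (wv e n \<omega>) w) ^ 8) \<le> 8 ^ 8 * ((Kg ^ 8 + dmassK hB 7) * ?a ^ 8)"
  proof -
    have "expectation (\<lambda>w. ((lam n)\<^sup>2 / (real n)\<^sup>2 * quad n (wv e n \<omega>) (wv e n \<omega>) w) ^ Suc 7) \<le> 8 ^ Suc 7 * (((lam n)\<^sup>2 * mass n (wv e n \<omega>)) ^ Suc 7 + dmassK hB 7 * (rh n) ^ Suc 7)"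
      by (rule quad_moment_bound[OF n wv_measurable wv_bounded])
    also have "Suc 7 = 8" by simp
    also have "8 ^ 8 * (((lam n)\<^sup>2 * mass n (wv e n \<omega>)) ^ 8 + dmassK hB 7 * (rh n) ^ 8) \<le> 8 ^ 8 * ((Kg * ?a) ^ 8 + dmassK hB 7 * ?a ^ 8)"
    proof (intro mult_left_mono add_mono power_mono)
      show "(lam n)\<^sup>2 * mass n (wv e n \<omega>) \<le> Kg * ?a"
        using mass_wave_le[OF l, of e \<omega>] Kg_nonneg r0 by (meson add_increasing2 mult_left_mono order_refl order_trans)
      show "0 \<le> (lam n)\<^sup>2 * mass n (wv e n \<omega>)" by (intro mult_nonneg_nonneg mass_nonneg[OF wv_measurable wv_bounded]) simp
      show "rh n \<le> ?a" using phi2_pos[of \<omega>] by simp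
    qed (use dmassK_nonneg in auto)
    also have "\<dots> = 8 ^ 8 * ((Kg ^ 8 + dmassK hB 7) * ?a ^ 8)" by (simp only: power_mult_distrib distrib_right)
    finally show ?thesis .
  qed
  ultimately have "kap n ^ 8 * expectation (\<lambda>w. lin n (wv e n \<omega>) w ^ 16) \<le> 2027025 * ((1 / H0) ^ 8 * (8 ^ 8 * ((Kg ^ 8 + dmassK hB 7) * ?a ^ 8)))"
    by (simp only: mult.left_commute[of "kap n ^ 8"]) (intro mult_left_mono, simp_all only: zero_le_power divide_nonneg_nonneg, use H0_pos in auto)
  then show ?thesis by (simp only: mult.assoc)
qed

text \<open>Both moments that occur later, those of I^4 and of a product of two such powers, are
  dominated through this single bound.\<close>

lemma I8:
  assumes n: "1 \<le> n" and l: "1 \<le> lam n"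
  shows "integrable M (\<lambda>w. I n \<omega> w ^ 8)" and "expectation (\<lambda>w. I n \<omega> w ^ 8) \<le> Kd * (phi2 \<omega> + rh n) ^ 8"
proof -
  show "integrable M (\<lambda>w. I n \<omega> w ^ 8)"
    using I44_integrable[of n \<omega> \<omega>] by (simp flip: power_add)
  have i: "integrable M (\<lambda>w. lin n (wv e n \<omega>) w ^ 16)" for e
    using lin_even_integrable[OF wv_measurable wv_bounded, of n e n \<omega> 8] by simp
  have pw: "I n \<omega> w ^ 8 \<le> 2 ^ 8 * (kap n ^ 8 * lin n (wv True n \<omega>) w ^ 16 + kap n ^ 8 * lin n (wv False n \<omega>) w ^ 16)" for w
  proof -
    have "I n \<omega> w ^ 8 = kap n ^ 8 * ((lin n (wv True n \<omega>) w)\<^sup>2 + (lin n (wv False n \<omega>) w)\<^sup>2) ^ 8"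
      by (simp add: I_eq power_mult_distrib)
    also have "\<dots> \<le> kap n ^ 8 * (2 ^ 8 * (((lin n (wv True n \<omega>) w)\<^sup>2) ^ 8 + ((lin n (wv False n \<omega>) w)\<^sup>2) ^ 8))"
      by (intro mult_left_mono power_add_le) (simp_all add: kap_nonneg)
    also have "\<dots> = 2 ^ 8 * (kap n ^ 8 * lin n (wv True n \<omega>) w ^ 16 + kap n ^ 8 * lin n (wv False n \<omega>) w ^ 16)"
      by (simp add: distrib_left mult.left_commute flip: power_mult)
    finally show ?thesis .
  qed
  have "expectation (\<lambda>w. I n \<omega> w ^ 8) \<le> expectation (\<lambda>w. 2 ^ 8 * (kap n ^ 8 * lin n (wv True n \<omega>) w ^ 16 + kap n ^ 8 * lin n (wv False n \<omega>) w ^ 16))"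
    by (rule integral_mono) (use i pw \<open>integrable M (\<lambda>w. I n \<omega> w ^ 8)\<close> in auto)
  also have "\<dots> = 2 ^ 8 * (kap n ^ 8 * expectation (\<lambda>w. lin n (wv True n \<omega>) w ^ 16) + kap n ^ 8 * expectation (\<lambda>w. lin n (wv False n \<omega>) w ^ 16))"
    using i by simp
  also have "\<dots> \<le> 2 ^ 8 * (2027025 * ((1 / H0) ^ 8 * (8 ^ 8 * (Kg ^ 8 + dmassK hB 7))) * (phi2 \<omega> + rh n) ^ 8 + 2027025 * ((1 / H0) ^ 8 * (8 ^ 8 * (Kg ^ 8 + dmassK hB 7))) * (phi2 \<omega> + rh n) ^ 8)"
    by (intro mult_left_mono add_mono lin_wave_moment16 n l) auto
  also have "\<dots> = Kd * (phi2 \<omega> + rh n) ^ 8"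
  proof -
    have "2 ^ 8 * (C * x + C * x) = 2 ^ 8 * (2 * C) * x" for C x :: real by simp
    then show ?thesis unfolding Kd_def .
  qed
  finally show "expectation (\<lambda>w. I n \<omega> w ^ 8) \<le> Kd * (phi2 \<omega> + rh n) ^ 8" .
qed

lemma rescaled_pos: "0 < phi2 \<omega> + rh n"
  using phi2_pos[of \<omega>] by (simp add: add_pos_nonneg)

text \<open>A weighted arithmetic-geometric inequality instead of Cauchy-Schwarz: with a the sum of
  decay and noise, I^4 \<le> a^4 + I^8/a^4, and the eighth moment is at most a multiple of
  a^8.\<close>

lemma I4_dominated:
  assumes n: "1 \<le> n" and l: "1 \<le> lam n"
  shows "expectation (\<lambda>w. I n \<omega> w ^ 4) \<le> (1 + Kd) * (phi2 \<omega> + rh n) ^ 4"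
proof -
  let ?a = "phi2 \<omega> + rh n"
  have a: "0 < ?a" by (rule rescaled_pos)
  have pw: "I n \<omega> w ^ 4 \<le> ?a ^ 4 + I n \<omega> w ^ 8 / ?a ^ 4" for w
  proof -
    have "0 \<le> (?a ^ 4 - I n \<omega> w ^ 4)\<^sup>2" by simp
    then have "2 * (?a ^ 4 * I n \<omega> w ^ 4) \<le> ?a ^ 4 * ?a ^ 4 + I n \<omega> w ^ 8"
      by (simp add: power2_diff flip: power_mult power_add)
    moreover have "0 \<le> ?a ^ 4 * I n \<omega> w ^ 4" using a by simp
    ultimately have "?a ^ 4 * I n \<omega> w ^ 4 \<le> ?a ^ 4 * ?a ^ 4 + I n \<omega> w ^ 8" by linarith
    then show ?thesis using a by (simp add: field_simps)
  qed
  have "expectation (\<lambda>w. I n \<omega> w ^ 4) \<le> expectation (\<lambda>w. ?a ^ 4 + I n \<omega> w ^ 8 / ?a ^ 4)"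
    by (rule integral_mono) (use I4_integrable I8(1)[OF n l] pw in auto)
  also have "\<dots> = ?a ^ 4 + expectation (\<lambda>w. I n \<omega> w ^ 8) / ?a ^ 4"
    using I8(1)[OF n l, of \<omega>] by (simp add: prob_space)
  also have "\<dots> \<le> ?a ^ 4 + Kd * ?a ^ 8 / ?a ^ 4"
    by (intro add_left_mono divide_right_mono I8(2)[OF n l]) (use a in auto)
  also have "Kd * ?a ^ 8 / ?a ^ 4 = Kd * ?a ^ 4"
  proof -
    have 8: "?a ^ 8 = ?a ^ 4 * ?a ^ 4" by (simp flip: power_add)
    have gen: "K * (y * y) / y = K * y" if "0 < y" for K y :: real using that by simp
    show ?thesis unfolding 8 by (rule gen) (rule zero_less_power[OF a])
  qed
  finally show ?thesis by (simp only: distrib_right mult_1_left)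
qed

lemma I44_dominated:
  assumes n: "1 \<le> n" and l: "1 \<le> lam n"
  shows "expectation (\<lambda>w. I n \<omega> w ^ 4 * I n \<omega>' w ^ 4) \<le> Kd * ((phi2 \<omega> + rh n) ^ 4 * (phi2 \<omega>' + rh n) ^ 4)"
proof -
  let ?a = "(phi2 \<omega> + rh n) ^ 4" and ?b = "(phi2 \<omega>' + rh n) ^ 4"
  have a: "0 < ?a" and b: "0 < ?b" by (intro zero_less_power rescaled_pos)+
  \<comment> \<open>The weights B/A and A/B are chosen so that, after inserting moment bounds K A^2
    and K B^2, both terms become the same multiple of AB.\<close>
  have pw: "x * y \<le> (B / A * x\<^sup>2 + A / B * y\<^sup>2) / 2" if A: "0 < A" and B: "0 < B" for x y A B :: real
  proof -
    have "0 \<le> (B * x - A * y)\<^sup>2 / (A * B)" using A B by simp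
    also have "\<dots> = B / A * x\<^sup>2 + A / B * y\<^sup>2 - 2 * (x * y)"
      using A B by (simp add: power2_diff field_simps power2_eq_square)
    finally show ?thesis by simp
  qed
  have i: "integrable M (\<lambda>w. (I n v w ^ 4)\<^sup>2)" for v using I8(1)[OF n l, of v] by (simp flip: power_mult)
  have e: "expectation (\<lambda>w. (I n v w ^ 4)\<^sup>2) \<le> Kd * (phi2 v + rh n) ^ 8" for v
    using I8(2)[OF n l, of v] by (simp flip: power_mult)
  have "expectation (\<lambda>w. I n \<omega> w ^ 4 * I n \<omega>' w ^ 4) \<le> expectation (\<lambda>w. (?b / ?a * (I n \<omega> w ^ 4)\<^sup>2 + ?a / ?b * (I n \<omega>' w ^ 4)\<^sup>2) / 2)"
    by (rule integral_mono[OF I44_integrable]) (intro integrable_divide Bochner_Integration.integrable_add integrable_mult_right i, rule pw[OF a b])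
  also have "\<dots> = (?b / ?a * expectation (\<lambda>w. (I n \<omega> w ^ 4)\<^sup>2) + ?a / ?b * expectation (\<lambda>w. (I n \<omega>' w ^ 4)\<^sup>2)) / 2"
    by (simp only: integral_divide_zero integral_mult_right_zero Bochner_Integration.integral_add integrable_mult_right i)
  also have "\<dots> \<le> (?b / ?a * (Kd * (phi2 \<omega> + rh n) ^ 8) + ?a / ?b * (Kd * (phi2 \<omega>' + rh n) ^ 8)) / 2"
    by (intro divide_right_mono add_mono mult_left_mono e) (use a b in auto)
  also have "\<dots> = Kd * (?a * ?b)"
  proof -
    have 8: "(phi2 v + rh n) ^ 8 = (phi2 v + rh n) ^ 4 * (phi2 v + rh n) ^ 4" for v by (simp flip: power_add)
    have "(B / A * (K * (A * A)) + A / B * (K * (B * B))) / 2 = K * (A * B)" if "0 < A" "0 < B" for A B K :: real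
      using that by simp
    from this[OF a b, of Kd] show ?thesis unfolding 8 .
  qed
  finally show ?thesis .
qed

end

section \<open>Riemann sums and the main limit\<close>

lemma converges_in_probabilityI_moments:
  assumes "prob_space M" and X[measurable]: "\<And>n. X n \<in> borel_measurable M"
    and i: "\<And>n. integrable M (X n)" "\<And>n. integrable M (\<lambda>w. (X n w)\<^sup>2)"
    and lim1: "(\<lambda>n. \<integral>w. X n w \<partial>M) \<longlonglongrightarrow> L" and lim2: "(\<lambda>n. \<integral>w. (X n w)\<^sup>2 \<partial>M) \<longlonglongrightarrow> L\<^sup>2"
  shows "converges_in_probability M X L"
  unfolding converges_in_probability_def
proof (intro conjI allI impI X)
  interpret prob_space M by fact
  fix e :: real assume e: "0 < e"
  have sq: "(X n w - L)\<^sup>2 = (X n w)\<^sup>2 - (2 * L) * X n w + L\<^sup>2" for n w by (simp add: power2_diff)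
  have isq: "integrable M (\<lambda>w. (X n w - L)\<^sup>2)" for n unfolding sq using i by simp
  have E: "expectation (\<lambda>w. (X n w - L)\<^sup>2) = expectation (\<lambda>w. (X n w)\<^sup>2) - (2 * L) * expectation (X n) + L\<^sup>2" for n
    unfolding sq using i by (simp add: prob_space)
  have "(\<lambda>n. (expectation (\<lambda>w. (X n w)\<^sup>2) - (2 * L) * expectation (X n) + L\<^sup>2) / e\<^sup>2) \<longlonglongrightarrow> (L\<^sup>2 - (2 * L) * L + L\<^sup>2) / e\<^sup>2"
    by (intro tendsto_intros lim1 lim2) (use e in simp)
  then have lim: "(\<lambda>n. (expectation (\<lambda>w. (X n w)\<^sup>2) - (2 * L) * expectation (X n) + L\<^sup>2) / e\<^sup>2) \<longlonglongrightarrow> 0"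
    by (simp add: power2_eq_square)
  show "(\<lambda>n. prob {w \<in> space M. \<bar>X n w - L\<bar> > e}) \<longlonglongrightarrow> 0"
  proof (rule tendsto_sandwich[OF _ _ tendsto_const lim])
    show "\<forall>\<^sub>F n in sequentially. prob {w \<in> space M. \<bar>X n w - L\<bar> > e} \<le> (expectation (\<lambda>w. (X n w)\<^sup>2) - (2 * L) * expectation (X n) + L\<^sup>2) / e\<^sup>2"
    proof (intro always_eventually allI)
      fix n
      have "prob {w \<in> space M. \<bar>X n w - L\<bar> > e} \<le> prob {w \<in> space M. (X n w - L)\<^sup>2 \<ge> e\<^sup>2}"
      proof (rule finite_measure_mono)
        show "{w \<in> space M. \<bar>X n w - L\<bar> > e} \<subseteq> {w \<in> space M. (X n w - L)\<^sup>2 \<ge> e\<^sup>2}"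
        proof safe
          fix w assume "\<bar>X n w - L\<bar> > e"
          then have "e\<^sup>2 \<le> \<bar>X n w - L\<bar>\<^sup>2" using e by (intro power_mono) auto
          then show "e\<^sup>2 \<le> (X n w - L)\<^sup>2" by simp
        qed
      qed measurable
      also have "\<dots> \<le> expectation (\<lambda>w. (X n w - L)\<^sup>2) / e\<^sup>2"
        by (rule integral_Markov_inequality_measure[OF isq, where A="{}"]) (use e in auto)
      finally show "prob {w \<in> space M. \<bar>X n w - L\<bar> > e} \<le> (expectation (\<lambda>w. (X n w)\<^sup>2) - (2 * L) * expectation (X n) + L\<^sup>2) / e\<^sup>2"
        unfolding E .
    qed
  qed simp
qed

text \<open>Once |b n| stays below |\<beta>| + 1 and the deterministic error is below e/2, an error
  above e forces X n to be off by more than e/(2B).\<close>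

lemma converges_in_probability_scale:
  assumes "prob_space M" and X: "converges_in_probability M X L" and b: "b \<longlonglongrightarrow> \<beta>"
  shows "converges_in_probability M (\<lambda>n w. b n * X n w) (\<beta> * L)"
  unfolding converges_in_probability_def
proof (intro conjI allI impI)
  interpret prob_space M by fact
  have Xm[measurable]: "X n \<in> borel_measurable M" for n using X by (simp add: converges_in_probability_def)
  then show "(\<lambda>w. b n * X n w) \<in> borel_measurable M" for n by measurable
  fix e :: real assume e: "0 < e"
  define B where "B = \<bar>\<beta>\<bar> + 1"
  have B: "0 < B" by (simp add: B_def)
  have ev1: "\<forall>\<^sub>F n in sequentially. \<bar>b n\<bar> < B"
    using tendsto_rabs[OF b] by (rule order_tendstoD(2)) (simp add: B_def)
  have "(\<lambda>n. \<bar>b n - \<beta>\<bar> * \<bar>L\<bar>) \<longlonglongrightarrow> \<bar>\<beta> - \<beta>\<bar> * \<bar>L\<bar>" by (intro tendsto_intros b)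
  then have ev2: "\<forall>\<^sub>F n in sequentially. \<bar>b n - \<beta>\<bar> * \<bar>L\<bar> < e / 2"
    by (rule order_tendstoD(2)) (use e in simp)
  have lim: "(\<lambda>n. prob {w \<in> space M. \<bar>X n w - L\<bar> > e / (2 * B)}) \<longlonglongrightarrow> 0"
    using X e B by (simp add: converges_in_probability_def)
  show "(\<lambda>n. prob {w \<in> space M. \<bar>b n * X n w - \<beta> * L\<bar> > e}) \<longlonglongrightarrow> 0"
  proof (rule tendsto_sandwich[OF _ _ tendsto_const lim])
    show "\<forall>\<^sub>F n in sequentially. prob {w \<in> space M. \<bar>b n * X n w - \<beta> * L\<bar> > e} \<le> prob {w \<in> space M. \<bar>X n w - L\<bar> > e / (2 * B)}"
      using ev1 ev2
    proof eventually_elim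
      case (elim n)
      show ?case
      proof (rule finite_measure_mono)
        show "{w \<in> space M. \<bar>b n * X n w - \<beta> * L\<bar> > e} \<subseteq> {w \<in> space M. \<bar>X n w - L\<bar> > e / (2 * B)}"
        proof safe
          fix w assume "\<bar>b n * X n w - \<beta> * L\<bar> > e"
          moreover have "\<bar>b n * X n w - \<beta> * L\<bar> \<le> \<bar>b n\<bar> * \<bar>X n w - L\<bar> + \<bar>b n - \<beta>\<bar> * \<bar>L\<bar>"
          proof -
            have "b n * X n w - \<beta> * L = b n * (X n w - L) + (b n - \<beta>) * L" by (simp add: algebra_simps)
            then show ?thesis using abs_triangle_ineq[of "b n * (X n w - L)" "(b n - \<beta>) * L"] by (simp add: abs_mult)
          qed
          moreover have "\<bar>b n\<bar> * \<bar>X n w - L\<bar> \<le> B * \<bar>X n w - L\<bar>" using elim by (intro mult_right_mono) auto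
          ultimately have "e / 2 < B * \<bar>X n w - L\<bar>" using elim(2) by linarith
          then show "\<bar>X n w - L\<bar> > e / (2 * B)" using B by (simp add: field_simps)
        qed
      qed measurable
    qed
  qed simp
qed

lemma pair_product:
  fixes F :: "'a::euclidean_space \<Rightarrow> real" and H :: "'b::euclidean_space \<Rightarrow> real"
  assumes F: "integrable lborel F" and H: "integrable lborel H"
  shows "integrable (lborel \<Otimes>\<^sub>M lborel) (\<lambda>p. F (fst p) * H (snd p))"
    and "(\<integral>p. F (fst p) * H (snd p) \<partial>(lborel \<Otimes>\<^sub>M lborel)) = (\<integral>x. F x \<partial>lborel) * (\<integral>y. H y \<partial>lborel)"
proof -
  have one: "\<bar>1::real\<bar> \<le> 1" by simp
  show i: "integrable (lborel \<Otimes>\<^sub>M lborel) (\<lambda>p. F (fst p) * H (snd p))"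
    using Fubini_kernel(3)[OF F H _ one] by (simp add: case_prod_beta')
  show "(\<integral>p. F (fst p) * H (snd p) \<partial>(lborel \<Otimes>\<^sub>M lborel)) = (\<integral>x. F x \<partial>lborel) * (\<integral>y. H y \<partial>lborel)"
    using lborel_pair.integral_fst'[OF i] by simp
qed

section \<open>The frequency grid as a partition of the plane\<close>

definition cellidx :: "real \<Rightarrow> real^2 \<Rightarrow> int^2" where
  "cellidx l \<omega> = (\<chi> i. \<lfloor>\<omega> $ i * l / (2 * pi)\<rfloor>)"

text \<open>The indicator of a half-open grid cell, written as a product over the coordinates so
  that its integral factorises. Half-open cells tile the plane, so every point has exactly one
  index.\<close>

definition cind :: "real \<Rightarrow> int^2 \<Rightarrow> real^2 \<Rightarrow> real" where
  "cind l k \<omega> = indicator {2 * pi * of_int (k$1) / l ..< 2 * pi * (of_int (k$1) + 1) / l} (\<omega>$1)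
    * indicator {2 * pi * of_int (k$2) / l ..< 2 * pi * (of_int (k$2) + 1) / l} (\<omega>$2)"

lemma cind_eq: "l > 0 \<Longrightarrow> cind l k \<omega> = (if k = cellidx l \<omega> then 1 else 0)"
proof -
  assume l: "l > 0"
  have "t \<in> {2 * pi * of_int m / l ..< 2 * pi * (of_int m + 1) / l} \<longleftrightarrow> m = \<lfloor>t * l / (2 * pi)\<rfloor>" for t m
  proof -
    have "m = \<lfloor>t * l / (2 * pi)\<rfloor> \<longleftrightarrow> \<lfloor>t * l / (2 * pi)\<rfloor> = m" by auto
    also have "\<dots> \<longleftrightarrow> of_int m \<le> t * l / (2 * pi) \<and> t * l / (2 * pi) < of_int m + 1" by (rule floor_eq_iff)
    also have "\<dots> \<longleftrightarrow> t \<in> {2 * pi * of_int m / l ..< 2 * pi * (of_int m + 1) / l}"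
      using l by (simp add: field_simps)
    finally show ?thesis by simp
  qed
  then show ?thesis unfolding cind_def indicator_def cellidx_def by (auto simp: vec_eq_iff forall_2)
qed

lemma
  assumes l: "l > 0"
  shows cind_integrable: "integrable lborel (cind l k)" and cind_integral: "(\<integral>\<omega>. cind l k \<omega> \<partial>lborel) = (2 * pi / l)\<^sup>2"
proof -
  let ?A = "\<lambda>m. {2 * pi * real_of_int m / l ..< 2 * pi * (of_int m + 1) / l}"
  have e: "emeasure lborel (?A m) = ennreal (2 * pi / l)" for m
  proof -
    have "2 * pi * of_int m / l \<le> 2 * pi * (of_int m + 1) / l" using l by (intro divide_right_mono mult_left_mono) auto
    then show ?thesis by (simp add: diff_divide_distrib[symmetric] algebra_simps)
  qed
  have i: "integrable lborel (indicator (?A m) :: real \<Rightarrow> real)" for m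
    using e[of m] by (intro integrable_real_indicator) auto
  have I: "(\<integral>t. indicator (?A m) t \<partial>lborel) = 2 * pi / l" for m
    using e[of m] l by (simp add: measure_def)
  show "integrable lborel (cind l k)" unfolding cind_def[abs_def] by (rule integrable_prod2[OF i i])
  show "(\<integral>\<omega>. cind l k \<omega> \<partial>lborel) = (2 * pi / l)\<^sup>2"
    unfolding cind_def integral_prod2[OF i i] I by (simp add: power2_eq_square)
qed

lemma cind_step:
  assumes "l > 0" "finite R"
  shows "(\<Sum>k\<in>R. e k * cind l k \<omega>) = (if cellidx l \<omega> \<in> R then e (cellidx l \<omega>) else 0)"
  using assms by (simp add: cind_eq if_distrib cong: if_cong)

lemma card_index_range: "card (index_range a) \<le> (2 * a)\<^sup>2"
proof -
  let ?A = "{- int a..int a - 1}" and ?g = "\<lambda>(x, y). (\<chi> i. if i = 1 then x else y) :: int^2"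
  have "index_range a \<subseteq> ?g ` (?A \<times> ?A)"
  proof
    fix k :: "int^2" assume k: "k \<in> index_range a"
    have "k = ?g (k $ 1, k $ 2)"
      by (simp add: vec_eq_iff forall_2)
    with k show "k \<in> ?g ` (?A \<times> ?A)"
      unfolding index_range_def by (intro image_eqI[where x="(k $ 1, k $ 2)"]) auto
  qed
  then have "card (index_range a) \<le> card (?g ` (?A \<times> ?A))"
    by (intro card_mono) auto
  also have "\<dots> \<le> card (?A \<times> ?A)" by (rule card_image_le) simp
  also have "\<dots> = (2 * a)\<^sup>2" by (simp add: card_cartesian_product power2_eq_square nat_mult_distrib)
  finally show ?thesis .
qed

locale tapered_grid = tapered_bounded +
  fixes a :: "nat \<Rightarrow> nat" and aB :: real
  assumes ratio: "filterlim (\<lambda>n. real (a n) / lam n) at_top sequentially"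
    and aB: "\<forall>\<^sub>F n in sequentially. (real (a n))\<^sup>2 / real n \<le> aB"
begin

text \<open>The midpoint of the cell that contains \<omega>: this is what the shift by pi/lam in the
  frequencies amounts to.\<close>

definition ctr :: "nat \<Rightarrow> real^2 \<Rightarrow> real^2" where "ctr n \<omega> = shifted_freq (lam n) (cellidx (lam n) \<omega>)"

lemma ctr_close: "\<bar>ctr n \<omega> $ i - \<omega> $ i\<bar> \<le> pi / lam n"
proof -
  let ?l = "lam n"
  have l: "?l > 0" by (rule lam_pos)
  let ?y = "\<omega> $ i * ?l / (2 * pi)"
  have "ctr n \<omega> $ i - \<omega> $ i = 2 * pi / ?l * (of_int \<lfloor>?y\<rfloor> + 1 / 2 - ?y)"
    using l by (simp add: ctr_def shifted_freq_def cellidx_def field_simps)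
  moreover have "\<bar>of_int \<lfloor>?y\<rfloor> + 1 / 2 - ?y\<bar> \<le> 1 / 2" by linarith
  then have "2 * pi / ?l * \<bar>of_int \<lfloor>?y\<rfloor> + 1 / 2 - ?y\<bar> \<le> 2 * pi / ?l * (1 / 2)"
    using l by (intro mult_left_mono) auto
  ultimately show ?thesis using l by (simp add: abs_mult)
qed

lemma ctr_tendsto: "(\<lambda>n. ctr n \<omega>) \<longlonglongrightarrow> \<omega>"
proof (rule vec_tendstoI)
  fix i
  have inv: "(\<lambda>n. pi * inverse (lam n)) \<longlonglongrightarrow> pi * 0"
    by (intro tendsto_mult tendsto_const tendsto_inverse_0_at_top lam_top)
  have "(\<lambda>n. ctr n \<omega> $ i - \<omega> $ i) \<longlonglongrightarrow> 0"
    by (rule Lim_null_comparison[where g="\<lambda>n. pi * inverse (lam n)"])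
       (use ctr_close inv in \<open>auto simp: divide_inverse\<close>)
  then show "(\<lambda>n. ctr n \<omega> $ i) \<longlonglongrightarrow> \<omega> $ i" by (rule LIM_zero_cancel)
qed

abbreviation (input) inR :: "nat \<Rightarrow> real^2 \<Rightarrow> bool" where "inR n \<omega> \<equiv> cellidx (lam n) \<omega> \<in> index_range (a n)"

text \<open>The grid reaches out to 2 pi a/lam, which tends to infinity by
  \<open>ratio\<close>.\<close>

lemma inR_eventually: "\<forall>\<^sub>F n in sequentially. inR n \<omega>"
proof -
  have ev: "\<forall>\<^sub>F n in sequentially. real (a n) / lam n > \<bar>\<omega> $ i\<bar> / (2 * pi)" for i
    using ratio by (simp add: filterlim_at_top_dense)
  show ?thesis
    using ev[of 1] ev[of 2]
  proof eventually_elim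
    case (elim n)
    have l: "lam n > 0" by (rule lam_pos)
    have "\<lfloor>\<omega> $ i * lam n / (2 * pi)\<rfloor> \<in> {- int (a n)..int (a n) - 1}" if "real (a n) / lam n > \<bar>\<omega> $ i\<bar> / (2 * pi)" for i
    proof -
      have "\<bar>\<omega> $ i\<bar> / (2 * pi) * lam n < real (a n) / lam n * lam n"
        by (rule mult_strict_right_mono[OF that l])
      then have "\<bar>\<omega> $ i\<bar> * lam n / (2 * pi) < real (a n)" using l by simp
      moreover have "\<bar>\<omega> $ i * lam n / (2 * pi)\<bar> = \<bar>\<omega> $ i\<bar> * lam n / (2 * pi)"
        using l by (simp add: abs_mult)
      ultimately have "\<bar>\<omega> $ i * lam n / (2 * pi)\<bar> < real (a n)" by simp
      then have "- real (a n) \<le> \<omega> $ i * lam n / (2 * pi)" "\<omega> $ i * lam n / (2 * pi) < real (a n)" by linarith+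
      then have "- int (a n) \<le> \<lfloor>\<omega> $ i * lam n / (2 * pi)\<rfloor>" "\<lfloor>\<omega> $ i * lam n / (2 * pi)\<rfloor> < int (a n)"
        by (simp_all only: le_floor_iff floor_less_iff of_int_minus of_int_of_nat_eq)
      then show ?thesis by simp
    qed
    from this[OF elim(1)] this[OF elim(2)] show ?case
      unfolding index_range_def cellidx_def by (simp add: forall_2)
  qed
qed

abbreviation (input) R :: "nat \<Rightarrow> (int^2) set" where "R n \<equiv> index_range (a n)"
abbreviation (input) fr :: "nat \<Rightarrow> int^2 \<Rightarrow> real^2" where "fr n k \<equiv> shifted_freq (lam n) k"

text \<open>A step function of the frequency whose integral is the expectation of the estimator;
  \<open>E2\<close> plays the same role for the second moment, with 576 = 24^2.\<close>

definition E1 :: "nat \<Rightarrow> real^2 \<Rightarrow> real" where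
  "E1 n \<omega> = (\<Sum>k\<in>R n. (expectation (\<lambda>w. I n (fr n k) w ^ 4) / 24) * cind (lam n) k \<omega>)"

definition E2 :: "nat \<Rightarrow> (real^2) \<times> (real^2) \<Rightarrow> real" where
  "E2 n p = (\<Sum>k\<in>R n. \<Sum>m\<in>R n. (expectation (\<lambda>w. I n (fr n k) w ^ 4 * I n (fr n m) w ^ 4) / 576)
      * (cind (lam n) k (fst p) * cind (lam n) m (snd p)))"

lemma E1_eq: "E1 n \<omega> = (if inR n \<omega> then expectation (\<lambda>w. I n (ctr n \<omega>) w ^ 4) / 24 else 0)"
  unfolding E1_def ctr_def by (rule cind_step[OF lam_pos finite_index_range])

lemma E2_eq: "E2 n p = (if inR n (fst p) \<and> inR n (snd p)
    then expectation (\<lambda>w. I n (ctr n (fst p)) w ^ 4 * I n (ctr n (snd p)) w ^ 4) / 576 else 0)"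
proof -
  let ?e = "\<lambda>k m. expectation (\<lambda>w. I n (fr n k) w ^ 4 * I n (fr n m) w ^ 4) / 576"
  have "E2 n p = (\<Sum>k\<in>R n. (\<Sum>m\<in>R n. ?e k m * cind (lam n) m (snd p)) * cind (lam n) k (fst p))"
    unfolding E2_def by (simp add: sum_distrib_left sum_distrib_right mult_ac)
  also have "\<dots> = (if inR n (fst p) then \<Sum>m\<in>R n. ?e (cellidx (lam n) (fst p)) m * cind (lam n) m (snd p) else 0)"
    by (rule cind_step[OF lam_pos finite_index_range])
  also have "(\<Sum>m\<in>R n. ?e (cellidx (lam n) (fst p)) m * cind (lam n) m (snd p)) = (if inR n (snd p) then ?e (cellidx (lam n) (fst p)) (cellidx (lam n) (snd p)) else 0)"
    by (rule cind_step[OF lam_pos finite_index_range])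
  finally show ?thesis by (simp add: ctr_def)
qed

definition Fh :: "nat \<Rightarrow> 'a \<Rightarrow> real" where "Fh n w = F_hat h n (lam n) (a n) Z (S n) w"

lemma Fh_eq: "Fh n w = 1 / 24 * (2 * pi / lam n)\<^sup>2 * (\<Sum>k\<in>R n. I n (fr n k) w ^ 4)"
  by (simp add: Fh_def F_hat_def I_def)

lemma Fh_measurable: "Fh n \<in> borel_measurable M"
  unfolding Fh_eq[abs_def] by measurable

lemma Fh_integrable: "integrable M (Fh n)"
  unfolding Fh_eq[abs_def] using I4_integrable by simp

lemma Fh_square: "(Fh n w)\<^sup>2 = 1 / 576 * ((2 * pi / lam n)\<^sup>2 * (2 * pi / lam n)\<^sup>2) * (\<Sum>k\<in>R n. \<Sum>m\<in>R n. I n (fr n k) w ^ 4 * I n (fr n m) w ^ 4)"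
  unfolding Fh_eq power_mult_distrib sum_product[symmetric] by (simp add: power2_eq_square)

lemma Fh_square_integrable: "integrable M (\<lambda>w. (Fh n w)\<^sup>2)"
  unfolding Fh_square using I44_integrable by simp

lemma E1_integrable: "integrable lborel (E1 n)" and E1_integral: "(\<integral>\<omega>. E1 n \<omega> \<partial>lborel) = expectation (Fh n)"
proof -
  note i = cind_integrable[OF lam_pos, of n]
  show "integrable lborel (E1 n)" unfolding E1_def[abs_def] using i by simp
  have "(\<integral>\<omega>. E1 n \<omega> \<partial>lborel) = (\<Sum>k\<in>R n. (expectation (\<lambda>w. I n (fr n k) w ^ 4) / 24) * (2 * pi / lam n)\<^sup>2)"
    unfolding E1_def using i by (subst Bochner_Integration.integral_sum) (auto simp: cind_integral[OF lam_pos])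
  also have "\<dots> = 1 / 24 * (2 * pi / lam n)\<^sup>2 * (\<Sum>k\<in>R n. expectation (\<lambda>w. I n (fr n k) w ^ 4))"
    unfolding sum_distrib_left by (intro sum.cong refl) simp
  also have "\<dots> = expectation (Fh n)"
    unfolding Fh_eq using I4_integrable by simp
  finally show "(\<integral>\<omega>. E1 n \<omega> \<partial>lborel) = expectation (Fh n)" .
qed

lemma E2_integrable: "integrable (lborel \<Otimes>\<^sub>M lborel) (E2 n)" and E2_integral: "(\<integral>p. E2 n p \<partial>(lborel \<Otimes>\<^sub>M lborel)) = expectation (\<lambda>w. (Fh n w)\<^sup>2)"
proof -
  note i = pair_product[OF cind_integrable[OF lam_pos, of n] cind_integrable[OF lam_pos, of n]]
  let ?e = "\<lambda>k m. expectation (\<lambda>w. I n (fr n k) w ^ 4 * I n (fr n m) w ^ 4)"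
  show "integrable (lborel \<Otimes>\<^sub>M lborel) (E2 n)" unfolding E2_def[abs_def]
    by (intro Bochner_Integration.integrable_sum integrable_mult_right i(1))
  have "(\<integral>p. E2 n p \<partial>(lborel \<Otimes>\<^sub>M lborel)) = (\<Sum>k\<in>R n. \<Sum>m\<in>R n. (?e k m / 576) * ((2 * pi / lam n)\<^sup>2 * (2 * pi / lam n)\<^sup>2))"
    unfolding E2_def
    by (simp only: Bochner_Integration.integral_sum Bochner_Integration.integrable_sum integrable_mult_right i integral_mult_right_zero cind_integral[OF lam_pos])
  also have "\<dots> = 1 / 576 * ((2 * pi / lam n)\<^sup>2 * (2 * pi / lam n)\<^sup>2) * (\<Sum>k\<in>R n. \<Sum>m\<in>R n. ?e k m)"
    unfolding sum_distrib_left by (intro sum.cong refl) simp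
  also have "\<dots> = expectation (\<lambda>w. (Fh n w)\<^sup>2)"
    unfolding Fh_square using I44_integrable by simp
  finally show "(\<integral>p. E2 n p \<partial>(lborel \<Otimes>\<^sub>M lborel)) = expectation (\<lambda>w. (Fh n w)\<^sup>2)" .
qed

section \<open>Domination and passage to the limit\<close>

definition K1 :: real where "K1 = (1 + Kd) * (16 * ((1 + pi) ^ 4) ^ 4)"

text \<open>The noise term is confined to the grid, since a positive constant is not integrable over
  the plane.\<close>

definition GG :: "nat \<Rightarrow> real^2 \<Rightarrow> real" where
  "GG n \<omega> = K1 * (phi2 \<omega> ^ 4 + rh n ^ 4 * (\<Sum>k\<in>R n. 1 * cind (lam n) k \<omega>))"

lemma GG_eq: "GG n \<omega> = K1 * (phi2 \<omega> ^ 4 + rh n ^ 4 * (if inR n \<omega> then 1 else 0))"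
  unfolding GG_def cind_step[OF lam_pos finite_index_range, where e="\<lambda>_. 1"] ..

lemma K1_nonneg: "0 \<le> K1" unfolding K1_def using Kd_nonneg pi_ge_zero by simp

lemma GG_nonneg: "0 \<le> GG n \<omega>"
  unfolding GG_eq using K1_nonneg phi2_pos[of \<omega>] by simp

text \<open>Passing to the midpoint moves each coordinate by at most pi, which costs a factor 1 + pi
  per profile; \<open>phi2\<close> contains four profiles.\<close>

lemma phi2_ctr:
  assumes l: "1 \<le> lam n"
  shows "phi2 (ctr n \<omega>) \<le> (1 + pi) ^ 4 * phi2 \<omega>"
proof -
  have c: "phi (ctr n \<omega> $ i) \<le> (1 + pi) * phi (\<omega> $ i)" for i
  proof -
    have "\<bar>ctr n \<omega> $ i - \<omega> $ i\<bar> \<le> pi"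
    proof -
      have "pi / lam n \<le> pi / 1" using l by (intro divide_left_mono) auto
      then show ?thesis using ctr_close[of n \<omega> i] by simp
    qed
    from phi_shift_le[OF this, of "\<omega> $ i"] show ?thesis by simp
  qed
  have p0: "0 \<le> phi y" for y using phi_pos[of y] by simp
  have "phi2 (ctr n \<omega>) \<le> ((1 + pi) * phi (\<omega> $ 1)) ^ 2 * ((1 + pi) * phi (\<omega> $ 2)) ^ 2"
    unfolding phi2_def by (intro mult_mono power_mono c p0) auto
  also have "\<dots> = (1 + pi) ^ 4 * phi2 \<omega>"
  proof -
    have "(1 + pi) ^ 4 = (1 + pi) ^ 2 * (1 + pi) ^ 2" by (simp flip: power_add)
    then show ?thesis by (simp only: phi2_def power_mult_distrib mult_ac)
  qed
  finally show ?thesis .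
qed

lemma ctr_power4:
  assumes l: "1 \<le> lam n"
  shows "(phi2 (ctr n \<omega>) + rh n) ^ 4 \<le> (16 * ((1 + pi) ^ 4) ^ 4) * (phi2 \<omega> ^ 4 + rh n ^ 4)"
proof -
  let ?c = "(1 + pi) ^ 4"
  have r0: "0 \<le> rh n" by simp
  have c1: "1 \<le> ?c" by (rule one_le_power) simp
  have "phi2 (ctr n \<omega>) + rh n \<le> ?c * phi2 \<omega> + ?c * rh n"
    using phi2_ctr[OF l, of \<omega>] mult_right_mono[OF c1 r0] by simp
  then have "(phi2 (ctr n \<omega>) + rh n) ^ 4 \<le> (?c * phi2 \<omega> + ?c * rh n) ^ 4"
    using phi2_pos[of "ctr n \<omega>"] r0 by (intro power_mono) auto
  also have "\<dots> = ?c ^ 4 * (phi2 \<omega> + rh n) ^ 4" by (simp only: distrib_left[symmetric] power_mult_distrib)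
  also have "\<dots> \<le> ?c ^ 4 * (2 ^ 4 * (phi2 \<omega> ^ 4 + rh n ^ 4))"
    using phi2_pos[of \<omega>] r0 by (intro mult_left_mono power_add_le) auto
  finally show ?thesis by (simp only: mult_ac) simp
qed

lemma E1_dominated:
  assumes n: "1 \<le> n" and l: "1 \<le> lam n"
  shows "0 \<le> E1 n \<omega>" "E1 n \<omega> \<le> GG n \<omega>"
proof -
  have nn: "0 \<le> expectation (\<lambda>w. I n v w ^ 4)" for v by (intro integral_nonneg_AE AE_I2) simp
  then show "0 \<le> E1 n \<omega>" by (simp add: E1_eq)
  have "expectation (\<lambda>w. I n (ctr n \<omega>) w ^ 4) / 24 \<le> expectation (\<lambda>w. I n (ctr n \<omega>) w ^ 4)"
    using nn[of "ctr n \<omega>"] by simp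
  also have "\<dots> \<le> (1 + Kd) * (phi2 (ctr n \<omega>) + rh n) ^ 4" by (rule I4_dominated[OF n l])
  also have "\<dots> \<le> (1 + Kd) * ((16 * ((1 + pi) ^ 4) ^ 4) * (phi2 \<omega> ^ 4 + rh n ^ 4))"
    using Kd_nonneg by (intro mult_left_mono ctr_power4 l) auto
  also have "\<dots> = K1 * (phi2 \<omega> ^ 4 + rh n ^ 4)" by (simp only: K1_def mult.assoc)
  finally have le: "expectation (\<lambda>w. I n (ctr n \<omega>) w ^ 4) / 24 \<le> K1 * (phi2 \<omega> ^ 4 + rh n ^ 4)" .
  show "E1 n \<omega> \<le> GG n \<omega>"
  proof (cases "inR n \<omega>")
    case True
    then show ?thesis using le by (simp only: E1_eq GG_eq if_True mult_1_right)
  next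
    case False
    then have "E1 n \<omega> = 0" by (simp add: E1_eq)
    then show ?thesis using GG_nonneg[of n \<omega>] by simp
  qed
qed

lemma E2_dominated:
  assumes n: "1 \<le> n" and l: "1 \<le> lam n"
  shows "0 \<le> E2 n p" "E2 n p \<le> GG n (fst p) * GG n (snd p)"
proof -
  let ?a = "\<lambda>v. (phi2 (ctr n v) + rh n) ^ 4" and ?b = "\<lambda>v. phi2 v ^ 4 + rh n ^ 4"
  let ?C = "16 * ((1 + pi) ^ 4) ^ 4"
  have nn: "0 \<le> expectation (\<lambda>w. I n v w ^ 4 * I n u w ^ 4)" for v u by (intro integral_nonneg_AE AE_I2) simp
  then show "0 \<le> E2 n p" by (simp add: E2_eq)
  have b0: "0 \<le> ?b v" for v by simp
  have a0: "0 \<le> ?a v" for v by simp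
  have "expectation (\<lambda>w. I n (ctr n (fst p)) w ^ 4 * I n (ctr n (snd p)) w ^ 4) / 576 \<le> expectation (\<lambda>w. I n (ctr n (fst p)) w ^ 4 * I n (ctr n (snd p)) w ^ 4)"
    using nn[of "ctr n (fst p)" "ctr n (snd p)"] by simp
  also have "\<dots> \<le> Kd * (?a (fst p) * ?a (snd p))" by (rule I44_dominated[OF n l])
  also have "\<dots> \<le> ((1 + Kd) * (1 + Kd)) * ((?C * ?b (fst p)) * (?C * ?b (snd p)))"
  proof (intro mult_mono ctr_power4 l)
    \<comment> \<open>The constant is enlarged so that the majorant on pairs is a product of the
      one-point majorants and its integral factorises.\<close>
    have "Kd \<le> 1 + Kd" by simp
    also have "\<dots> \<le> (1 + Kd) * (1 + Kd)" using Kd_nonneg by (simp add: mult_le_cancel_right1)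
    finally show "Kd \<le> (1 + Kd) * (1 + Kd)" .
  qed (use Kd_nonneg in auto)
  also have "\<dots> = (K1 * ?b (fst p)) * (K1 * ?b (snd p))" by (simp only: K1_def mult_ac)
  finally show "E2 n p \<le> GG n (fst p) * GG n (snd p)"
    using mult_nonneg_nonneg[OF GG_nonneg[of n "fst p"] GG_nonneg[of n "snd p"]] by (simp add: E2_eq GG_eq)
qed

lemma E1_tendsto:
  assumes "\<omega> \<noteq> 0" shows "(\<lambda>n. E1 n \<omega>) \<longlonglongrightarrow> f \<omega> ^ 4"
proof -
  have "(\<lambda>n. expectation (\<lambda>w. I n (ctr n \<omega>) w ^ 4) / 24) \<longlonglongrightarrow> 24 * f \<omega> ^ 4 / 24"
    by (intro tendsto_divide tendsto_const I4_limit ctr_tendsto assms) simp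
  moreover have "\<forall>\<^sub>F n in sequentially. expectation (\<lambda>w. I n (ctr n \<omega>) w ^ 4) / 24 = E1 n \<omega>"
    using inR_eventually[of \<omega>] by eventually_elim (simp add: E1_eq)
  ultimately show ?thesis by (simp add: tendsto_cong)
qed

lemma E2_tendsto:
  assumes "fst p \<noteq> 0" "snd p \<noteq> 0" "fst p \<noteq> snd p" "fst p \<noteq> - snd p"
  shows "(\<lambda>n. E2 n p) \<longlonglongrightarrow> f (fst p) ^ 4 * f (snd p) ^ 4"
proof -
  have "(\<lambda>n. expectation (\<lambda>w. I n (ctr n (fst p)) w ^ 4 * I n (ctr n (snd p)) w ^ 4) / 576) \<longlonglongrightarrow> (24 * f (fst p) ^ 4) * (24 * f (snd p) ^ 4) / 576"
    by (intro tendsto_divide tendsto_const I44_limit ctr_tendsto assms) simp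
  moreover have "\<forall>\<^sub>F n in sequentially. expectation (\<lambda>w. I n (ctr n (fst p)) w ^ 4 * I n (ctr n (snd p)) w ^ 4) / 576 = E2 n p"
    using inR_eventually[of "fst p"] inR_eventually[of "snd p"] by eventually_elim (simp add: E2_eq)
  ultimately show ?thesis by (simp add: tendsto_cong)
qed

lemma phi2_power4_integrable: "integrable lborel (\<lambda>\<omega>. phi2 \<omega> ^ 4)"
proof -
  have "integrable lborel (\<lambda>t. (phi t ^ 2) ^ 4)"
  proof (rule Bochner_Integration.integrable_bound[OF integrable_phi2])
    show "AE t in lborel. norm ((phi t ^ 2) ^ 4) \<le> norm (phi t ^ 2)"
    proof (intro AE_I2)
      fix t
      have "phi t ^ 2 \<le> 1" using phi_pos[of t] phi_le1[of t] by (simp add: power_le_one)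
      then have "(phi t ^ 2) ^ 4 \<le> (phi t ^ 2) ^ 1" by (intro power_decreasing) auto
      then show "norm ((phi t ^ 2) ^ 4) \<le> norm (phi t ^ 2)" by simp
    qed
  qed measurable
  from integrable_prod2[OF this this] show ?thesis by (simp only: phi2_def power_mult_distrib)
qed

lemma GG_integrable: "integrable lborel (GG n)"
  and GG_integral: "(\<integral>\<omega>. GG n \<omega> \<partial>lborel) = K1 * ((\<integral>\<omega>. phi2 \<omega> ^ 4 \<partial>lborel) + rh n ^ 4 * (real (card (R n)) * (2 * pi / lam n)\<^sup>2))"
proof -
  note i = phi2_power4_integrable cind_integrable[OF lam_pos, of n]
  show "integrable lborel (GG n)" unfolding GG_def[abs_def] using i by simp
  show "(\<integral>\<omega>. GG n \<omega> \<partial>lborel) = K1 * ((\<integral>\<omega>. phi2 \<omega> ^ 4 \<partial>lborel) + rh n ^ 4 * (real (card (R n)) * (2 * pi / lam n)\<^sup>2))"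
    unfolding GG_def using i by (simp add: cind_integral[OF lam_pos])
qed

definition G0 :: "real^2 \<Rightarrow> real" where "G0 \<omega> = K1 * phi2 \<omega> ^ 4"

lemma G0_integrable: "integrable lborel G0"
  unfolding G0_def[abs_def] using phi2_power4_integrable by simp

lemma GG_tendsto: "(\<lambda>n. GG n \<omega>) \<longlonglongrightarrow> G0 \<omega>"
proof -
  have "(\<lambda>n. K1 * (phi2 \<omega> ^ 4 + rh n ^ 4 * 1)) \<longlonglongrightarrow> K1 * (phi2 \<omega> ^ 4 + 0 ^ 4 * 1)"
    by (intro tendsto_intros rho)
  moreover have "\<forall>\<^sub>F n in sequentially. K1 * (phi2 \<omega> ^ 4 + rh n ^ 4 * 1) = GG n \<omega>"
    using inR_eventually[of \<omega>] by eventually_elim (simp add: GG_eq)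
  ultimately show ?thesis by (simp add: tendsto_cong G0_def)
qed

text \<open>At most (2a)^2 cells of area (2 pi/lam)^2 carry noise of size (lam^2/n)^4. The product
  is at most 4 (2 pi)^2 (lam^2/n)^3 (a^2/n), and here the boundedness of a^2/n enters.\<close>

lemma GG_integral_tendsto: "(\<lambda>n. \<integral>\<omega>. GG n \<omega> \<partial>lborel) \<longlonglongrightarrow> (\<integral>\<omega>. G0 \<omega> \<partial>lborel)"
proof -
  have z: "(\<lambda>n. rh n ^ 4 * (real (card (R n)) * (2 * pi / lam n)\<^sup>2)) \<longlonglongrightarrow> 0"
  proof (rule tendsto_sandwich[OF _ _ tendsto_const])
    have "(\<lambda>n. 4 * (2 * pi)\<^sup>2 * aB * rh n ^ 3) \<longlonglongrightarrow> 4 * (2 * pi)\<^sup>2 * aB * 0 ^ 3" by (intro tendsto_intros rho)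
    then show "(\<lambda>n. 4 * (2 * pi)\<^sup>2 * aB * rh n ^ 3) \<longlonglongrightarrow> 0" by simp
    show "\<forall>\<^sub>F n in sequentially. rh n ^ 4 * (real (card (R n)) * (2 * pi / lam n)\<^sup>2) \<le> 4 * (2 * pi)\<^sup>2 * aB * rh n ^ 3"
      using aB
    proof eventually_elim
      case (elim n)
      have l: "lam n > 0" by (rule lam_pos)
      have "real (card (R n)) \<le> real ((2 * a n)\<^sup>2)" using card_index_range by (rule of_nat_mono)
      then have "real (card (R n)) \<le> 4 * (real (a n))\<^sup>2" by (simp add: power_mult_distrib)
      then have "rh n ^ 4 * (real (card (R n)) * (2 * pi / lam n)\<^sup>2) \<le> rh n ^ 4 * ((4 * (real (a n))\<^sup>2) * (2 * pi / lam n)\<^sup>2)"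
        by (intro mult_left_mono mult_right_mono) auto
      also have "\<dots> = 4 * (2 * pi)\<^sup>2 * rh n ^ 3 * ((real (a n))\<^sup>2 / real n)"
      proof -
        have e4: "rh n ^ 4 = rh n ^ 3 * ((lam n)\<^sup>2 / real n)" by (simp add: power4_eq_xxxx power3_eq_cube)
        have e: "(2 * pi / lam n)\<^sup>2 = (2 * pi)\<^sup>2 / (lam n)\<^sup>2" by (rule power_divide)
        have gen: "r * (L / m) * ((4 * x) * (P / L)) = 4 * P * r * (x / m)" if "L \<noteq> 0" for r L m x P :: real
          using that by simp
        show ?thesis unfolding e4 e by (rule gen) (use l in simp)
      qed
      also have "\<dots> \<le> 4 * (2 * pi)\<^sup>2 * rh n ^ 3 * aB" using elim by (intro mult_left_mono) auto
      finally show ?case by (simp only: mult_ac)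
    qed
    show "\<forall>\<^sub>F n in sequentially. 0 \<le> rh n ^ 4 * (real (card (R n)) * (2 * pi / lam n)\<^sup>2)" by simp
  qed
  have "(\<lambda>n. K1 * ((\<integral>\<omega>. phi2 \<omega> ^ 4 \<partial>lborel) + rh n ^ 4 * (real (card (R n)) * (2 * pi / lam n)\<^sup>2))) \<longlonglongrightarrow> K1 * ((\<integral>\<omega>. phi2 \<omega> ^ 4 \<partial>lborel) + 0)"
    by (intro tendsto_mult tendsto_add tendsto_const z)
  then show ?thesis unfolding GG_integral G0_def by simp
qed

lemma eventually_regular: "\<exists>N. \<forall>n\<ge>N. 1 \<le> n \<and> 1 \<le> lam n"
proof -
  have "\<forall>\<^sub>F n in sequentially. 1 \<le> n \<and> 1 \<le> lam n"
    using lam_top by (intro eventually_conj eventually_ge_at_top) (auto simp: filterlim_at_top)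
  then show ?thesis by (simp add: eventually_sequentially)
qed

lemma
  shows f4_integrable: "integrable lborel (\<lambda>\<omega>. f \<omega> ^ 4)"
    and Fh_mean: "(\<lambda>n. expectation (Fh n)) \<longlonglongrightarrow> (\<integral>\<omega>. f \<omega> ^ 4 \<partial>lborel)"
    and Fh_second: "(\<lambda>n. expectation (\<lambda>w. (Fh n w)\<^sup>2)) \<longlonglongrightarrow> (\<integral>\<omega>. f \<omega> ^ 4 \<partial>lborel)\<^sup>2"
proof -
  \<comment> \<open>Domination holds only for large n, whereas \<open>pratt_nonneg\<close> asks for
    it at every index; hence the shift by N.\<close>
  obtain N where N: "\<And>n. n \<ge> N \<Longrightarrow> 1 \<le> n" "\<And>n. n \<ge> N \<Longrightarrow> 1 \<le> lam n" using eventually_regular by blast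
  have fm: "(\<lambda>\<omega>. f \<omega> ^ 4) \<in> borel_measurable borel" by measurable
  have P1: "integrable lborel (\<lambda>\<omega>. f \<omega> ^ 4) \<and> (\<lambda>n. \<integral>\<omega>. E1 (n + N) \<omega> \<partial>lborel) \<longlonglongrightarrow> (\<integral>\<omega>. f \<omega> ^ 4 \<partial>lborel)"
  proof (rule pratt_nonneg[where g="\<lambda>n. GG (n + N)" and G=G0])
    show "E1 (n + N) \<in> borel_measurable lborel" for n by (rule borel_measurable_integrable[OF E1_integrable])
    show "AE x in lborel. (\<lambda>n. E1 (n + N) x) \<longlonglongrightarrow> f x ^ 4"
      using AE_lborel_singleton[of 0] by eventually_elim (intro LIMSEQ_ignore_initial_segment E1_tendsto)
    show "AE x in lborel. (\<lambda>n. GG (n + N) x) \<longlonglongrightarrow> G0 x"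
      by (intro AE_I2 LIMSEQ_ignore_initial_segment GG_tendsto)
    show "(\<lambda>n. \<integral>x. GG (n + N) x \<partial>lborel) \<longlonglongrightarrow> (\<integral>x. G0 x \<partial>lborel)"
      by (rule LIMSEQ_ignore_initial_segment[OF GG_integral_tendsto])
    show "0 \<le> E1 (n + N) x" "E1 (n + N) x \<le> GG (n + N) x" for n x
      using E1_dominated[OF N(1)[of "n + N"] N(2)[of "n + N"]] by auto
  qed (use fm GG_integrable G0_integrable in auto)
  then show i4: "integrable lborel (\<lambda>\<omega>. f \<omega> ^ 4)" by blast
  from P1 show "(\<lambda>n. expectation (Fh n)) \<longlonglongrightarrow> (\<integral>\<omega>. f \<omega> ^ 4 \<partial>lborel)"
    unfolding E1_integral by (blast intro: LIMSEQ_offset)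
  let ?M = "lborel \<Otimes>\<^sub>M lborel :: ((real^2) \<times> (real^2)) measure"
  have P2: "integrable ?M (\<lambda>p. f (fst p) ^ 4 * f (snd p) ^ 4) \<and> (\<lambda>n. \<integral>p. E2 (n + N) p \<partial>?M) \<longlonglongrightarrow> (\<integral>p. f (fst p) ^ 4 * f (snd p) ^ 4 \<partial>?M)"
  proof (rule pratt_nonneg[where g="\<lambda>n p. GG (n + N) (fst p) * GG (n + N) (snd p)" and G="\<lambda>p. G0 (fst p) * G0 (snd p)"])
    show "E2 (n + N) \<in> borel_measurable ?M" for n by (rule borel_measurable_integrable[OF E2_integrable])
    show "AE p in ?M. (\<lambda>n. E2 (n + N) p) \<longlonglongrightarrow> f (fst p) ^ 4 * f (snd p) ^ 4"
    proof -
      \<comment> \<open>For every nonzero first coordinate only three second coordinates are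
        excluded, so the exceptional set is null by Fubini's theorem.\<close>
      have "AE p in ?M. fst p \<noteq> 0 \<and> snd p \<noteq> 0 \<and> fst p \<noteq> snd p \<and> fst p \<noteq> - snd p"
      proof (rule lborel_pair.AE_pair_measure)
        show "{x \<in> space ?M. fst x \<noteq> 0 \<and> snd x \<noteq> 0 \<and> fst x \<noteq> snd x \<and> fst x \<noteq> - snd x} \<in> sets ?M" by measurable
        have Px: "AE y in lborel. fst (x, y) \<noteq> 0 \<and> snd (x, y) \<noteq> 0 \<and> fst (x, y) \<noteq> snd (x, y) \<and> fst (x, y) \<noteq> - snd (x, y)" if "x \<noteq> 0" for x :: "real^2"
          using AE_lborel_singleton[of 0] AE_lborel_singleton[of x] AE_lborel_singleton[of "- x"]
          by eventually_elim (use that in auto)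
        show "AE x in lborel. AE y in lborel. fst (x, y) \<noteq> (0::real^2) \<and> snd (x, y) \<noteq> 0 \<and> fst (x, y) \<noteq> snd (x, y) \<and> fst (x, y) \<noteq> - snd (x, y)"
          using AE_lborel_singleton[of "0::real^2"] by eventually_elim (rule Px)
      qed
      then show ?thesis by eventually_elim (intro LIMSEQ_ignore_initial_segment E2_tendsto, auto)
    qed
    show "AE p in ?M. (\<lambda>n. GG (n + N) (fst p) * GG (n + N) (snd p)) \<longlonglongrightarrow> G0 (fst p) * G0 (snd p)"
      by (intro AE_I2 tendsto_mult LIMSEQ_ignore_initial_segment GG_tendsto)
    show "(\<lambda>n. \<integral>p. GG (n + N) (fst p) * GG (n + N) (snd p) \<partial>?M) \<longlonglongrightarrow> (\<integral>p. G0 (fst p) * G0 (snd p) \<partial>?M)"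
      unfolding pair_product(2)[OF GG_integrable GG_integrable] pair_product(2)[OF G0_integrable G0_integrable]
      by (intro tendsto_mult LIMSEQ_ignore_initial_segment[OF GG_integral_tendsto])
    show "0 \<le> E2 (n + N) p" "E2 (n + N) p \<le> GG (n + N) (fst p) * GG (n + N) (snd p)" for n p
      using E2_dominated[OF N(1)[of "n + N"] N(2)[of "n + N"]] by auto
  qed (use pair_product(1)[OF GG_integrable GG_integrable] pair_product(1)[OF G0_integrable G0_integrable] in \<open>auto intro: borel_measurable_integrable pair_product(1)[OF i4 i4]\<close>)
  have "(\<integral>p. f (fst p) ^ 4 * f (snd p) ^ 4 \<partial>?M) = (\<integral>\<omega>. f \<omega> ^ 4 \<partial>lborel)\<^sup>2"
    using pair_product(2)[OF i4 i4] by (simp add: power2_eq_square)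
  with P2 have "(\<lambda>n. expectation (\<lambda>w. (Fh (n + N) w)\<^sup>2)) \<longlonglongrightarrow> (\<integral>\<omega>. f \<omega> ^ 4 \<partial>lborel)\<^sup>2"
    unfolding E2_integral by simp
  then show "(\<lambda>n. expectation (\<lambda>w. (Fh n w)\<^sup>2)) \<longlonglongrightarrow> (\<integral>\<omega>. f \<omega> ^ 4 \<partial>lborel)\<^sup>2"
    by (rule LIMSEQ_offset)
qed

lemma F_hat_converges: "converges_in_probability M (\<lambda>n. F_hat h n (lam n) (a n) Z (S n)) (\<integral>\<omega>. f \<omega> ^ 4 \<partial>lborel)"
proof -
  have "converges_in_probability M Fh (\<integral>\<omega>. f \<omega> ^ 4 \<partial>lborel)"
    by (rule converges_in_probabilityI_moments[OF prob_space_axioms Fh_measurable Fh_integrable Fh_square_integrable Fh_mean Fh_second])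
  then show ?thesis by (simp add: Fh_def[abs_def])
qed

end

section \<open>The lattice sum of the taper transform\<close>

lemma sum_phi2_int_bounded: "\<exists>B. \<forall>A. finite A \<longrightarrow> (\<Sum>k\<in>A. phi (real_of_int k) ^ 2) \<le> B"
proof -
  let ?s = "\<lambda>n::nat. 1 / (1 + real n) ^ 2"
  have sm: "summable ?s"
  proof -
    have "summable (\<lambda>n. inverse (real (Suc n) ^ 2))"
      using inverse_power_summable[of 2, where 'a=real] by (subst summable_Suc_iff) simp
    then show ?thesis by (simp add: inverse_eq_divide add.commute)
  qed
  have half: "(\<Sum>k\<in>A. phi (real_of_int k) ^ 2) \<le> suminf ?s" if A: "finite A" and inj: "inj_on (\<lambda>k. nat \<bar>k\<bar>) A" for A
  proof -
    have "(\<Sum>k\<in>A. phi (real_of_int k) ^ 2) = (\<Sum>k\<in>A. ?s (nat \<bar>k\<bar>))"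
      by (intro sum.cong refl) (simp add: phi_def power_divide)
    also have "\<dots> = sum ?s ((\<lambda>k. nat \<bar>k\<bar>) ` A)" using inj by (simp add: sum.reindex)
    also have "\<dots> \<le> suminf ?s" by (rule sum_le_suminf[OF sm]) (use A in auto)
    finally show ?thesis .
  qed
  have "(\<Sum>k\<in>A. phi (real_of_int k) ^ 2) \<le> suminf ?s + suminf ?s" if A: "finite A" for A
  proof -
    \<comment> \<open>On each sign separately the absolute value is injective, so the sum is part of
      the series over natural numbers.\<close>
    let ?P = "A \<inter> {0..}" and ?N = "A \<inter> {..<0}"
    have "A = ?P \<union> ?N" "?P \<inter> ?N = {}" by auto
    then have "(\<Sum>k\<in>A. phi (real_of_int k) ^ 2) = (\<Sum>k\<in>?P. phi (real_of_int k) ^ 2) + (\<Sum>k\<in>?N. phi (real_of_int k) ^ 2)"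
      using A by (metis finite_Int sum.union_disjoint)
    also have "\<dots> \<le> suminf ?s + suminf ?s"
      by (intro add_mono half) (use A in \<open>auto simp: inj_on_def\<close>)
    finally show ?thesis .
  qed
  then show ?thesis by blast
qed

text \<open>A finite set of lattice points lies in the product of its two projections, which bounds
  its sum by the square of the one-dimensional bound.\<close>

lemma summable_phi2_lattice: "(\<lambda>m::int^2. phi (real_of_int (m$1)) ^ 2 * phi (real_of_int (m$2)) ^ 2) summable_on UNIV"
proof (rule nonneg_bdd_above_summable_on)
  obtain B where B: "\<And>A. finite A \<Longrightarrow> (\<Sum>k\<in>A. phi (real_of_int k) ^ 2) \<le> B" using sum_phi2_int_bounded by blast
  have B0: "0 \<le> B" using B[of "{}"] by simp
  let ?t = "\<lambda>k. phi (real_of_int k) ^ 2"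
  have "sum (\<lambda>m::int^2. ?t (m$1) * ?t (m$2)) F \<le> B * B" if F: "finite F" for F
  proof -
    let ?A1 = "(\<lambda>m::int^2. m$1) ` F" and ?A2 = "(\<lambda>m::int^2. m$2) ` F"
    let ?p = "\<lambda>m::int^2. (m$1, m$2)"
    have inj: "inj_on ?p F" by (auto simp: inj_on_def vec_eq_iff forall_2)
    have "sum (\<lambda>m::int^2. ?t (m$1) * ?t (m$2)) F = sum (\<lambda>(x, y). ?t x * ?t y) (?p ` F)"
      using inj by (simp add: sum.reindex)
    also have "\<dots> \<le> sum (\<lambda>(x, y). ?t x * ?t y) (?A1 \<times> ?A2)"
      by (rule sum_mono2) (use F in auto)
    also have "\<dots> = sum ?t ?A1 * sum ?t ?A2"
      by (simp add: sum_product sum.cartesian_product)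
    also have "\<dots> \<le> B * B" using F B0 by (intro mult_mono B) (auto intro: sum_nonneg)
    finally show ?thesis .
  qed
  then show "bdd_above (sum (\<lambda>m::int^2. ?t (m$1) * ?t (m$2)) ` {F. F \<subseteq> UNIV \<and> finite F})"
    by (intro bdd_aboveI[of _ "B * B"]) auto
qed simp

text \<open>The infinite sum is unordered, so the growing index squares have to be cofinal among the
  finite sets.\<close>

lemma index_range_exhausts:
  assumes "filterlim a at_top sequentially"
  shows "filterlim (\<lambda>n. index_range (a n)) (finite_subsets_at_top UNIV) sequentially"
  unfolding filterlim_finite_subsets_at_top
proof (intro allI impI)
  fix X :: "(int^2) set" assume X: "finite X \<and> X \<subseteq> UNIV"
  define b where "b = nat (Max (insert 0 ((\<lambda>k. \<bar>k$1\<bar> + \<bar>k$2\<bar>) ` X))) + 1"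
  have b: "\<bar>k$1\<bar> < int b \<and> \<bar>k$2\<bar> < int b" if "k \<in> X" for k
  proof -
    have "\<bar>k$1\<bar> + \<bar>k$2\<bar> \<le> Max (insert 0 ((\<lambda>k. \<bar>k$1\<bar> + \<bar>k$2\<bar>) ` X))"
      using X that by (intro Max_ge) auto
    then show ?thesis unfolding b_def by linarith
  qed
  have "\<forall>\<^sub>F n in sequentially. b \<le> a n" using assms by (simp add: filterlim_at_top)
  then show "\<forall>\<^sub>F n in sequentially. finite (index_range (a n)) \<and> X \<subseteq> index_range (a n) \<and> index_range (a n) \<subseteq> UNIV"
  proof eventually_elim
    case (elim n)
    have "k \<in> index_range (a n)" if "k \<in> X" for k
      using b[OF that] elim unfolding index_range_def by (auto simp: forall_2)
    then show ?case using finite_index_range by auto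
  qed
qed

context tapered_sample
begin

text \<open>The square of a taper factor is again continuously differentiable with the same support,
  so the transform of the squared taper decays like the profile in each coordinate; the frequency
  factor 2 pi exceeds 1 and only improves the bound.\<close>

lemma Re_H2_decay: "\<exists>K\<ge>0. \<forall>m. \<bar>Re (H2 h m)\<bar> \<le> K * (phi (real_of_int (m$1)) * phi (real_of_int (m$2)))"
proof -
  have dec: "\<exists>K\<ge>0. \<forall>y. \<bar>\<integral>u. (g u)\<^sup>2 * cos (y * u) \<partial>lborel\<bar> \<le> K * phi y" if t: "taper1 g" for g
  proof (rule cosine_transform_decay[where g'="\<lambda>x. 2 * g x * deriv g x"])
    show "((\<lambda>u. (g u)\<^sup>2) has_real_derivative 2 * g x * deriv g x) (at x)" for x
      using taper1_facts(2)[OF t, of x] by (auto intro!: derivative_eq_intros)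
    show "continuous_on UNIV (\<lambda>x. 2 * g x * deriv g x)"
      using taper1_facts(1,3)[OF t] by (intro continuous_intros)
    show "(g x)\<^sup>2 = 0" if "x \<notin> {-1/2..1/2}" for x using t that unfolding taper1_def by auto
  qed
  obtain K1 where K1: "K1 \<ge> 0" "\<And>y. \<bar>\<integral>u. (h1 u)\<^sup>2 * cos (y * u) \<partial>lborel\<bar> \<le> K1 * phi y" using dec[OF t1] by blast
  obtain K2 where K2: "K2 \<ge> 0" "\<And>y. \<bar>\<integral>u. (h2 u)\<^sup>2 * cos (y * u) \<partial>lborel\<bar> \<le> K2 * phi y" using dec[OF t2] by blast
  have ph: "phi (- 2 * pi * y) \<le> phi y" for y
  proof -
    have "\<bar>y\<bar> \<le> \<bar>- 2 * pi * y\<bar>"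
    proof -
      have "1 * \<bar>y\<bar> \<le> (2 * pi) * \<bar>y\<bar>" using pi_gt3 by (intro mult_right_mono) auto
      then show ?thesis by (simp add: abs_mult)
    qed
    then show ?thesis unfolding phi_def by (intro divide_left_mono) (auto intro!: mult_pos_pos add_pos_nonneg)
  qed
  have "\<bar>Re (H2 h m)\<bar> \<le> K1 * K2 * (phi (real_of_int (m$1)) * phi (real_of_int (m$2)))" for m
  proof -
    define y :: "real^2" where "y = (\<chi> i. - 2 * pi * real_of_int (m $ i))"
    have "H2 h m = (LINT s|lborel. exp (\<i> * complex_of_real (s \<bullet> y)) * complex_of_real ((h s)\<^sup>2))"
      unfolding H2_def set_lebesgue_integral_def
    proof (intro Bochner_Integration.integral_cong refl)
      fix s
      have e: "s \<bullet> y = - 2 * pi * (s \<bullet> (\<chi> i. real_of_int (m $ i)))"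
        by (simp add: y_def inner_vec_def sum_2 algebra_simps)
      show "indicat_real (cube 1) s *\<^sub>R (complex_of_real ((h s)\<^sup>2) * exp (- (2 * pi * \<i> * complex_of_real (s \<bullet> (\<chi> i. of_int (m $ i)))))) = exp (\<i> * complex_of_real (s \<bullet> y)) * complex_of_real ((h s)\<^sup>2)"
        unfolding e using h_outside[of s] by (auto simp: mult_ac split: split_indicator)
    qed
    then have "Re (H2 h m) = (\<integral>s. (h s)\<^sup>2 * cos (s \<bullet> y) \<partial>lborel)"
      unfolding exp_weighted_integral[OF h2_integrable] by simp
    also have "\<dots> = (\<integral>s. (h1 (s$1))\<^sup>2 * (h2 (s$2))\<^sup>2 * cos (s \<bullet> y) \<partial>lborel)"
      by (simp add: h_eq power_mult_distrib)
    also have "\<dots> = (\<integral>u. (h1 u)\<^sup>2 * cos (y$1 * u) \<partial>lborel) * (\<integral>u. (h2 u)\<^sup>2 * cos (y$2 * u) \<partial>lborel)"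
      by (rule integral_cos_prod2[OF taper1_facts(6)[OF t1] taper1_facts(6)[OF t2]]) (simp_all add: h_even1 h_even2)
    also have "\<bar>\<dots>\<bar> \<le> (K1 * phi (y$1)) * (K2 * phi (y$2))"
      unfolding abs_mult using K1(1) phi_pos by (intro mult_mono K1 K2) (auto intro!: mult_nonneg_nonneg intro: less_imp_le)
    also have "\<dots> \<le> (K1 * phi (real_of_int (m$1))) * (K2 * phi (real_of_int (m$2)))"
      using K1(1) K2(1) phi_pos by (intro mult_mono mult_left_mono) (auto simp: y_def intro!: ph[simplified] mult_nonneg_nonneg intro: less_imp_le)
    finally show ?thesis by (simp only: mult_ac)
  qed
  then show ?thesis using K1(1) K2(1) by (intro exI[of _ "K1 * K2"]) auto
qed

text \<open>As the profile is at most 1, its fourth powers are bounded by its squares, whose lattice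
  sum is finite.\<close>

lemma Re_H2_summable: "(\<lambda>m. Re (H2 h m) ^ 4 / Re (H2 h 0) ^ 4) summable_on UNIV"
proof -
  obtain K where K: "K \<ge> 0" "\<And>m. \<bar>Re (H2 h m)\<bar> \<le> K * (phi (real_of_int (m$1)) * phi (real_of_int (m$2)))"
    using Re_H2_decay by blast
  have "(\<lambda>m::int^2. (K ^ 4 / H0 ^ 4) * (phi (real_of_int (m$1)) ^ 2 * phi (real_of_int (m$2)) ^ 2)) summable_on UNIV"
    by (rule summable_on_cmult_right[OF summable_phi2_lattice])
  then show ?thesis
  proof (rule summable_on_comparison_test)
    fix m :: "int^2"
    let ?p = "phi (real_of_int (m$1))" and ?q = "phi (real_of_int (m$2))"
    have p: "0 \<le> ?p" "?p \<le> 1" "0 \<le> ?q" "?q \<le> 1" using phi_pos phi_le1 by (auto intro: less_imp_le)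
    have "Re (H2 h m) ^ 4 = \<bar>Re (H2 h m)\<bar> ^ 4" by simp
    also have "\<dots> \<le> (K * (?p * ?q)) ^ 4" by (intro power_mono K) simp
    also have "\<dots> = K ^ 4 * (?p ^ 4 * ?q ^ 4)" by (simp only: power_mult_distrib)
    also have "\<dots> \<le> K ^ 4 * (?p ^ 2 * ?q ^ 2)"
      using p by (intro mult_left_mono mult_mono power_decreasing) auto
    finally have "Re (H2 h m) ^ 4 / H0 ^ 4 \<le> K ^ 4 * (?p ^ 2 * ?q ^ 2) / H0 ^ 4"
      by (rule divide_right_mono) simp
    then show "Re (H2 h m) ^ 4 / Re (H2 h 0) ^ 4 \<le> (K ^ 4 / H0 ^ 4) * (?p ^ 2 * ?q ^ 2)"
      by (simp add: Re_H2_0)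
  qed simp
qed

end

lemma (in tapered_grid) tau_sq_hat_converges:
  assumes a: "filterlim a at_top sequentially"
  shows "converges_in_probability M (\<lambda>n. tau_sq_hat h n (lam n) (a n) Z (S n)) (tau_sq h f)"
proof -
  let ?t = "\<lambda>m. Re (H2 h m) ^ 4 / Re (H2 h 0) ^ 4"
  have "(?t has_sum (\<Sum>\<^sub>\<infinity>m. ?t m)) UNIV" by (rule has_sum_infsum[OF Re_H2_summable])
  then have "(sum ?t \<longlongrightarrow> (\<Sum>\<^sub>\<infinity>m. ?t m)) (finite_subsets_at_top UNIV)" by (simp add: has_sum_def)
  from filterlim_compose[OF this index_range_exhausts[OF a]]
  have "(\<lambda>n. 2 * (2 * pi)\<^sup>2 * (\<Sum>m\<in>index_range (a n). ?t m)) \<longlonglongrightarrow> 2 * (2 * pi)\<^sup>2 * (\<Sum>\<^sub>\<infinity>m. ?t m)"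
    by (rule tendsto_mult_left)
  from converges_in_probability_scale[OF prob_space_axioms F_hat_converges this]
  show ?thesis by (simp only: tau_sq_hat_def[abs_def] tau_sq_def mult_ac)
qed

theorem theorem4p8:
  fixes M G :: "'w measure"
    and Z :: "real^2 \<Rightarrow> 'w \<Rightarrow> real"
    and c f h :: "real^2 \<Rightarrow> real"
    and S :: "nat \<Rightarrow> nat \<Rightarrow> 'w \<Rightarrow> real^2"
    and lam :: "nat \<Rightarrow> real"
    and a :: "nat \<Rightarrow> nat"
    and C \<epsilon> \<delta> :: real
  assumes "prob_space M"
    and "jointly_measurable_field M G Z"
    and "gaussian_field M Z" and "centered_field M Z"
    and "second_order_stationary M Z c" and "mean_square_continuous M Z"
    and "\<exists>B. \<forall>u. \<bar>c u\<bar> \<le> B"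
    and "\<epsilon> > 0" and "c \<in> O[at_infinity](\<lambda>u. norm u powr (- (2 + \<epsilon>)))"
    and "spectral_density c f" and "twice_differentiable2 f"
    and "C > 0" and "\<delta> > 2"
    and "\<And>\<omega>. f \<omega> \<le> beta2 C (1 + \<delta>) \<omega>"
    and "\<And>i \<omega>. \<bar>partial_deriv i f \<omega>\<bar> \<le> beta2 C (1 + \<delta>) \<omega>"
    and "\<And>i j \<omega>. \<bar>partial_deriv j (partial_deriv i f) \<omega>\<bar> \<le> beta2 C (1 + \<delta>) \<omega>"
    and "\<And>n. lam n > 0" and "filterlim lam at_top sequentially"
    and "(\<lambda>n. (lam n)\<^sup>2 / real n) \<longlonglongrightarrow> 0"
    and "uniform_sampling M G lam S"
    and "taper h"
    and "filterlim a at_top sequentially"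
    and "filterlim (\<lambda>n. real (a n) / lam n) at_top sequentially"
    and "(\<lambda>n. (real (a n))\<^sup>2 / real n) \<in> O(\<lambda>_. 1)"
  shows "integrable lborel (\<lambda>\<omega>. f \<omega> ^ 4) \<and>
         converges_in_probability M (\<lambda>n. F_hat h n (lam n) (a n) Z (S n)) (LINT \<omega>|lborel. f \<omega> ^ 4) \<and>
         (isotropic f \<longrightarrow>
            (\<lambda>m. Re (H2 h m) ^ 4 / Re (H2 h 0) ^ 4) summable_on UNIV \<and>
            converges_in_probability M (\<lambda>n. tau_sq_hat h n (lam n) (a n) Z (S n)) (tau_sq h f))"
proof -
  obtain cB where cB: "\<And>u. \<bar>c u\<bar> \<le> cB" using assms(7) by blast
  have cm: "c \<in> borel_measurable borel"
    using assms(10) borel_measurable_integrable[of lborel c] by (simp add: spectral_density_def)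
  obtain h1 h2 where t: "taper1 h1" "taper1 h2" "\<And>s. h s = h1 (s $ 1) * h2 (s $ 2)" and nz: "\<exists>s. h s \<noteq> 0"
    using assms(21) unfolding taper_def by blast
  interpret prob_space M by fact
  interpret T: tapered_sample M G Z c S lam cB f h h1 h2
    by unfold_locales (use assms cB cm t nz in auto)
  have fcont: "isCont f x" for x
    using assms(11) unfolding twice_differentiable2_def by (meson differentiable_imp_continuous_within)
  have fnn: "0 \<le> f \<omega>" for \<omega>
  proof (cases "\<omega> = 0")
    case True
    have "(f \<longlongrightarrow> f 0) (at 0)" using fcont[of 0] by (simp add: isCont_def)
    moreover have "\<forall>\<^sub>F x in at 0. 0 \<le> f x"
      using T.f_nonneg_nonzero by (auto simp: eventually_at_filter)
    ultimately have "0 \<le> f 0" by (intro tendsto_lowerbound) auto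
    then show ?thesis using True by simp
  qed (rule T.f_nonneg_nonzero)
  \<comment> \<open>For |x| \<le> 1 the profile is at least 1/2; for |x| > 1 the reciprocal 1/|x| is
    at most twice the profile, and 1 + \<delta> > 2. Both cases give the factor 4, so the two
    coordinates together give \<open>16 * C\<^sup>2\<close>.\<close>
  have beta: "beta1 C (1 + \<delta>) x \<le> 4 * C * phi x ^ 2" and beta0: "0 \<le> beta1 C (1 + \<delta>) x" for x
  proof -
    show "0 \<le> beta1 C (1 + \<delta>) x" using assms(12) by (simp add: beta1_def)
    show "beta1 C (1 + \<delta>) x \<le> 4 * C * phi x ^ 2"
    proof (cases "\<bar>x\<bar> \<le> 1")
      case True
      then have "1 / 2 \<le> phi x" by (simp add: phi_def field_simps)
      then have "(1 / 2) ^ 2 \<le> phi x ^ 2" by (intro power_mono) auto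
      then have "1 \<le> 4 * phi x ^ 2" by (simp add: power_divide)
      then show ?thesis using True assms(12) by (simp add: beta1_def)
    next
      case False
      have "\<bar>x\<bar> powr (- (1 + \<delta>)) \<le> \<bar>x\<bar> powr (- 2)" using False assms(13) by (intro powr_mono) auto
      also have "\<dots> = (1 / \<bar>x\<bar>) ^ 2" using False by (simp add: powr_minus powr_numeral power_divide inverse_eq_divide)
      also have "\<dots> \<le> (2 * phi x) ^ 2"
        using False by (intro power_mono) (auto simp: phi_def field_simps)
      also have "\<dots> = 4 * phi x ^ 2" by (simp add: power_mult_distrib)
      finally have "C * \<bar>x\<bar> powr (- (1 + \<delta>)) \<le> C * (4 * phi x ^ 2)" using assms(12) by (intro mult_left_mono) auto
      then show ?thesis using False by (simp add: beta1_def mult_ac)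
    qed
  qed
  have fle: "\<bar>f \<omega>\<bar> \<le> 16 * C\<^sup>2 * phi2 \<omega>" for \<omega>
  proof -
    have "\<bar>f \<omega>\<bar> \<le> beta2 C (1 + \<delta>) \<omega>" using fnn[of \<omega>] assms(14)[of \<omega>] by simp
    also have "\<dots> \<le> (4 * C * phi (\<omega>$1) ^ 2) * (4 * C * phi (\<omega>$2) ^ 2)"
      unfolding beta2_def using assms(12) by (intro mult_mono beta beta0) auto
    also have "\<dots> = 16 * C\<^sup>2 * phi2 \<omega>" by (simp add: phi2_def power2_eq_square)
    finally show ?thesis .
  qed
  obtain K where K: "\<forall>\<^sub>F n in sequentially. norm ((real (a n))\<^sup>2 / real n) \<le> K * norm (1::real)"
    using assms(24) by (auto elim!: landau_o.bigE)
  have aB: "\<forall>\<^sub>F n in sequentially. (real (a n))\<^sup>2 / real n \<le> K"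
    using K by eventually_elim simp
  interpret tapered_grid M G Z c S lam cB f h h1 h2 "16 * C\<^sup>2" a K
    by unfold_locales (use assms(23) aB fle in auto)
  show ?thesis
    using f4_integrable F_hat_converges T.Re_H2_summable tau_sq_hat_converges[OF assms(22)] by blast
qed

end
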